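(* Let $\Gamma$ be a countable group with a proper left-invariant distance, and let $\mu\neq\delta_e$ be a symmetric probability measure on $\Gamma$ with finite second moment and finite entropy, whose support generates $\Gamma$. Assume that at least one of the two equalities $$2\sqrt{1-\rho^2}\,\operatorname{artanh}\sqrt{1-\rho^2}= h\qquad\text{or}\qquad 2\,\tilde\ell\,\operatorname{artanh}\tilde\ell= h$$ holds, where $\tilde\ell=\ell/M_2(\mu)$. Then, on the Poisson boundary $(\mathcal B_0,\nu_0)$ of $(\Gamma,\mu)$, the Radon–Nikodym derivative $\frac{d\gamma^{-1}_*\nu_0}{d\nu_0}(\xi)$ takes only two values $e^{\alpha}$ and $e^{-\alpha}$, $\mu\otimes\nu_0$-almost surely; that is, there is $\alpha\in\mathbb R$ such that $\frac{d\gamma^{-1}_*\nu_0}{d\nu_0}(\xi)\in\{e^\alpha,e^{-\alpha}\}$ for $\mu\otimes\nu_0$-almost every $(\gamma,\xi)\in\Gamma\times\mathcal B_0$.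
   Context: A distance on $\Gamma$ is proper if all balls are finite; $|g|=\operatorname{dist}(g,e)$. The measure $\mu$ is symmetric if $\mu(g)=\mu(g^{-1})$ for all $g$; it has finite entropy if $-\sum_g\mu(g)\log\mu(g)<\infty$, and finite second moment if $M_2(\mu):=\left(\sum_g|g|^2\mu(g)\right)^{1/2}<\infty$. With $\mu^{*n}$ the $n$-fold convolution, $$h=\lim_n-\frac1n\sum_g\mu^{*n}(g)\log\mu^{*n}(g),\qquad \rho=\limsup_n\sqrt[n]{\mu^{*n}(e)},\qquad \ell=\lim_n\frac1n\sum_g|g|\,\mu^{*n}(g).$$ A $(\Gamma,\mu)$-space is a probability space $(\mathcal B,\nu)$ with a $\Gamma$-action such that $\nu$ is $\mu$-stationary: $\nu=\mu*\nu=\sum_\gamma\mu(\gamma)\gamma_*\nu$; then $\gamma_*\nu\ll\nu$ for every $\gamma\in\Gamma$ (as the support of $\mu$ generates $\Gamma$). The Poisson boundary $(\mathcal B_0,\nu_0)$ is the unique $(\Gamma,\mu)$-space parameterizing bounded harmonic functions: $f\mapsto\left(g\mapsto\int f(g\xi)\,d\nu_0(\xi)\right)$ is an isometric bijection from $L^\infty(\mathcal B_0,\nu_0)$ onto the bounded functions $u$ on $\Gamma$ satisfying $u(g)=\sum_s\mu(s)u(gs)$. Equivalently, it is the exit boundary of the right random walk $X_n=\gamma_1\cdots\gamma_n$ ($\gamma_i$ i.i.d. of law $\mu$) started at $e$, i.e. the quotient of the space of trajectories by the tail $\sigma$-algebra. *)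

theory Defs
  imports "HOL-Probability.Probability" "HOL-Algebra.Algebra"
begin

section \<open>Groups with a proper left-invariant distance\<close>

definition proper_distance :: "('a, 'm) monoid_scheme \<Rightarrow> ('a \<Rightarrow> 'a \<Rightarrow> real) \<Rightarrow> bool" where
  "proper_distance G d \<longleftrightarrow>
     Metric_space (carrier G) d \<and>
     (\<forall>x\<in>carrier G. \<forall>r. finite (Metric_space.mcball (carrier G) d x r))"

definition left_invariant_distance :: "('a, 'm) monoid_scheme \<Rightarrow> ('a \<Rightarrow> 'a \<Rightarrow> real) \<Rightarrow> bool" where
  "left_invariant_distance G d \<longleftrightarrow>
     (\<forall>g\<in>carrier G. \<forall>x\<in>carrier G. \<forall>y\<in>carrier G. d (g \<otimes>\<^bsub>G\<^esub> x) (g \<otimes>\<^bsub>G\<^esub> y) = d x y)"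

section \<open>Measures on a countable group and the associated random walk\<close>

text \<open>
  A probability measure on the group is a \<open>pmf\<close> on the underlying type whose support is contained
  in the carrier.
\<close>

definition symmetric_pmf :: "('a, 'm) monoid_scheme \<Rightarrow> 'a pmf \<Rightarrow> bool" where
  "symmetric_pmf G \<mu> \<longleftrightarrow> (\<forall>g\<in>carrier G. pmf \<mu> g = pmf \<mu> (inv\<^bsub>G\<^esub> g))"

text \<open>
  Here \<open>0 * ln 0 = 0\<close>, as usual for entropy.  All terms \<open>- p * ln p\<close> are nonnegative, so
  summability is finiteness of the sum.
\<close>

definition finite_entropy :: "('a, 'm) monoid_scheme \<Rightarrow> 'a pmf \<Rightarrow> bool" where
  "finite_entropy G \<mu> \<longleftrightarrow> (\<lambda>g. - (pmf \<mu> g * ln (pmf \<mu> g))) summable_on carrier G"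

definition finite_second_moment ::
    "('a, 'm) monoid_scheme \<Rightarrow> ('a \<Rightarrow> 'a \<Rightarrow> real) \<Rightarrow> 'a pmf \<Rightarrow> bool" where
  "finite_second_moment G d \<mu> \<longleftrightarrow> (\<lambda>g. (d g \<one>\<^bsub>G\<^esub>)\<^sup>2 * pmf \<mu> g) summable_on carrier G"

definition M2 :: "('a, 'm) monoid_scheme \<Rightarrow> ('a \<Rightarrow> 'a \<Rightarrow> real) \<Rightarrow> 'a pmf \<Rightarrow> real" where
  "M2 G d \<mu> = sqrt (\<Sum>\<^sub>\<infinity>g\<in>carrier G. (d g \<one>\<^bsub>G\<^esub>)\<^sup>2 * pmf \<mu> g)"

definition convolution :: "('a, 'm) monoid_scheme \<Rightarrow> 'a pmf \<Rightarrow> 'a pmf \<Rightarrow> 'a pmf" where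
  "convolution G \<mu> \<mu>' = map_pmf (\<lambda>(x, y). x \<otimes>\<^bsub>G\<^esub> y) (pair_pmf \<mu> \<mu>')"

primrec conv_power :: "('a, 'm) monoid_scheme \<Rightarrow> 'a pmf \<Rightarrow> nat \<Rightarrow> 'a pmf" where
  "conv_power G \<mu> 0 = return_pmf \<one>\<^bsub>G\<^esub>"
| "conv_power G \<mu> (Suc n) = convolution G (conv_power G \<mu> n) \<mu>"

text \<open>
  The terms with index \<open>n = 0\<close> in the next three definitions are meaningless but irrelevant to
  the limits.
\<close>

definition asymptotic_entropy :: "('a, 'm) monoid_scheme \<Rightarrow> 'a pmf \<Rightarrow> real" where
  "asymptotic_entropy G \<mu> =
     lim (\<lambda>n. - (1 / real n) *
       (\<Sum>\<^sub>\<infinity>g\<in>carrier G. pmf (conv_power G \<mu> n) g * ln (pmf (conv_power G \<mu> n) g)))"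

definition spectral_radius :: "('a, 'm) monoid_scheme \<Rightarrow> 'a pmf \<Rightarrow> real" where
  "spectral_radius G \<mu> =
     real_of_ereal (limsup (\<lambda>n. ereal (root n (pmf (conv_power G \<mu> n) \<one>\<^bsub>G\<^esub>))))"

definition drift :: "('a, 'm) monoid_scheme \<Rightarrow> ('a \<Rightarrow> 'a \<Rightarrow> real) \<Rightarrow> 'a pmf \<Rightarrow> real" where
  "drift G d \<mu> =
     lim (\<lambda>n. (1 / real n) *
       (\<Sum>\<^sub>\<infinity>g\<in>carrier G. d g \<one>\<^bsub>G\<^esub> * pmf (conv_power G \<mu> n) g))"

section \<open>Stationary spaces and the Poisson boundary\<close>

text \<open>
  \<open>T g \<xi>\<close> is the point \<open>g\<xi>\<close>, and \<open>distr B B (T g)\<close> is the push-forward of the measure of \<open>B\<close>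
  under \<open>g\<close>.  As the group is countable, measurability of the action means measurability of each
  \<open>T g\<close>.
\<close>

definition stationary_space ::
    "('a, 'm) monoid_scheme \<Rightarrow> 'a pmf \<Rightarrow> 'b measure \<Rightarrow> ('a \<Rightarrow> 'b \<Rightarrow> 'b) \<Rightarrow> bool" where
  "stationary_space G \<mu> B T \<longleftrightarrow>
     prob_space B \<and>
     group_action G (space B) T \<and>
     (\<forall>g\<in>carrier G. T g \<in> B \<rightarrow>\<^sub>M B) \<and>
     (\<forall>A\<in>sets B. measure B A = (\<Sum>\<^sub>\<infinity>g\<in>carrier G. pmf \<mu> g * measure (distr B B (T g)) A))"

text \<open>Representatives of \<open>L\<^sup>\<infinity>\<close>-classes; classes are compared by almost everywhere equality below.\<close>

definition Linfty :: "'b measure \<Rightarrow> ('b \<Rightarrow> real) set" where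
  "Linfty B = {f \<in> borel_measurable B. \<exists>C. AE \<xi> in B. \<bar>f \<xi>\<bar> \<le> C}"

definition bounded_harmonic :: "('a, 'm) monoid_scheme \<Rightarrow> 'a pmf \<Rightarrow> ('a \<Rightarrow> real) set" where
  "bounded_harmonic G \<mu> =
     {u. bounded (u ` carrier G) \<and>
         (\<forall>g\<in>carrier G. u g = (\<Sum>\<^sub>\<infinity>s\<in>carrier G. pmf \<mu> s * u (g \<otimes>\<^bsub>G\<^esub> s)))}"

definition poisson_transform ::
    "'b measure \<Rightarrow> ('a \<Rightarrow> 'b \<Rightarrow> 'b) \<Rightarrow> ('b \<Rightarrow> real) \<Rightarrow> 'a \<Rightarrow> real" where
  "poisson_transform B T f g = (\<integral>\<xi>. f (T g \<xi>) \<partial>B)"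

text \<open>
  A model of the Poisson boundary: a stationary space whose Poisson transform is an isometric
  bijection from \<open>L\<^sup>\<infinity>\<close> (with the essential supremum norm) onto the bounded harmonic functions
  (with the supremum norm).  The conditions are, in this order: the transform takes values in
  the bounded harmonic functions, is isometric, injective and surjective.  Harmonic functions
  are functions on the group, hence compared on the carrier only.
\<close>

definition poisson_boundary ::
    "('a, 'm) monoid_scheme \<Rightarrow> 'a pmf \<Rightarrow> 'b measure \<Rightarrow> ('a \<Rightarrow> 'b \<Rightarrow> 'b) \<Rightarrow> bool" where
  "poisson_boundary G \<mu> B T \<longleftrightarrow>
     stationary_space G \<mu> B T \<and>
     (\<forall>f\<in>Linfty B. poisson_transform B T f \<in> bounded_harmonic G \<mu>) \<and>
     (\<forall>f\<in>Linfty B. \<forall>f'\<in>Linfty B.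
        esssup B (\<lambda>\<xi>. ereal \<bar>f \<xi> - f' \<xi>\<bar>) =
        (SUP g\<in>carrier G. ereal \<bar>poisson_transform B T f g - poisson_transform B T f' g\<bar>)) \<and>
     (\<forall>f\<in>Linfty B. \<forall>f'\<in>Linfty B.
        (\<forall>g\<in>carrier G. poisson_transform B T f g = poisson_transform B T f' g) \<longrightarrow>
        (AE \<xi> in B. f \<xi> = f' \<xi>)) \<and>
     (\<forall>u\<in>bounded_harmonic G \<mu>. \<exists>f\<in>Linfty B. \<forall>g\<in>carrier G. u g = poisson_transform B T f g)"

end

theory Submission
  imports Defs "HOL-Complex_Analysis.Great_Picard"
begin

text \<open>
  Write \<open>D\<^sub>\<gamma>\<close> for the density of \<open>\<gamma>\<^sup>-\<^sup>1\<nu>\<close> with respect to the boundary measure \<open>\<nu>\<close>, and let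
  \<open>I = - \<Sum>\<^sub>\<gamma> \<mu>(\<gamma>) \<integral> ln D\<^sub>\<gamma> d\<nu>\<close> be the entropy of the boundary and
  \<open>A = \<Sum>\<^sub>\<gamma> \<mu>(\<gamma>) \<integral> sqrt D\<^sub>\<gamma> d\<nu>\<close> the mean Hellinger affinity of \<open>\<nu>\<close> with its translates. Averaging over \<open>\<gamma>\<close>
  and \<open>\<gamma>\<^sup>-\<^sup>1\<close> turns \<open>I\<close> into the mean of \<open>(D - 1) ln D / 2\<close>. Put \<open>D = e\<^sup>2\<^sup>x\<close>. For the probability
  measure with density \<open>(1 + D) / 2\<close>, the number \<open>I\<close> is the mean of \<open>2 x tanh x\<close> and \<open>A\<close> the mean of
  \<open>1 / cosh x\<close>. The first is a decreasing, strictly convex function of the second, so Jensen's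
  inequality gives \<open>I \<ge> 2 y tanh y\<close> as soon as \<open>A \<le> 1 / cosh y\<close>, and equality forces \<open>\<bar>x\<bar> = y\<close>, that
  is \<open>D = e\<^sup>2\<^sup>y\<close> or \<open>D = e\<^sup>-\<^sup>2\<^sup>y\<close>, almost everywhere. It remains to bound \<open>I\<close> by \<open>h\<close>, and \<open>A\<close> by \<open>\<rho>\<close>
  and by \<open>sqrt (1 - (\<ell> / M\<^sub>2)\<^sup>2)\<close>: each of the two hypotheses says that one of the resulting lower
  bounds for \<open>h\<close> is attained.

  The bound on \<open>I\<close> (\<open>boundary_entropy_le\<close>) is the classical one. The cocycle relation for \<open>D\<close> makes
  the divergence additive along the walk, so its mean after \<open>n\<close> steps is \<open>n I\<close>; since \<open>\<nu>\<close> dominates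
  \<open>\<mu>\<^sup>*\<^sup>n(\<gamma>) \<gamma>\<nu>\<close>, it is at most the entropy of \<open>\<mu>\<^sup>*\<^sup>n\<close>.

  The bounds on \<open>A\<close> are first proved on the group. There \<open>\<nu>\<close> is replaced by the law \<open>\<lambda>\<close> of the walk at
  an independent geometric time, which is almost stationary when the parameter is small. The affinity
  of \<open>\<lambda>\<close> is the quadratic form of the convolution operator at the unit vector \<open>sqrt \<lambda>\<close> of
  \<open>\<ell>\<^sup>2\<close>, hence at most \<open>\<rho>\<close> (\<open>pmf_affinity_spectral\<close>). On the other hand the drift is at most the
  mean increment of the length under \<open>\<lambda>\<close>; after symmetrisation, an increment is controlled by \<open>\<bar>\<gamma>\<bar>\<close>
  times the total variation distance of \<open>\<lambda>\<close> and its translate, which is small when the affinity is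
  large (\<open>affinity_le_drift\<close>).

  The passage to the boundary (\<open>affinity_le_of_green\<close>) rests on a duality: twice an affinity is the
  minimum of \<open>\<integral> \<phi> D + \<psi> d\<nu>\<close> over positive functions with \<open>\<phi> \<psi> \<ge> 1\<close>. The minimisers for \<open>\<lambda>\<close> are
  bounded independently of the parameter, so their averages converge along a subsequence to bounded
  harmonic functions, and these are Poisson transforms of functions \<open>f\<close> and \<open>f'\<close> on the boundary. The
  constraint \<open>\<phi> \<psi> \<ge> 1\<close> is equivalent to the linear inequalities \<open>a\<^sup>2 \<phi> + \<psi> \<ge> 2 a\<close> for all \<open>a > 0\<close>,
  which pass to \<open>f\<close> and \<open>f'\<close> because a linear isometry that preserves constants is positive. Hence the
  affinity on the boundary is at most the limit of the affinities of the measures \<open>\<lambda>\<close>. This is where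
  the boundary has to be the Poisson boundary and not just any stationary space.
\<close>

section \<open>Subadditive sequences\<close>

text \<open>
  Fekete's lemma. The limit is the infimum of the ratios, and both facts matter: entropy needs that
  the limit exists, and the drift also that it is a lower bound for every ratio.
\<close>

lemma subadditive_ratio:
  fixes a :: "nat \<Rightarrow> real"
  assumes nonneg: "\<And>n. 0 \<le> a n" and subadd: "\<And>m n. a (m + n) \<le> a m + a n"
  obtains l where "(\<lambda>n. a n / real n) \<longlonglongrightarrow> l" "\<And>n. l * real n \<le> a n"
proof -
  define l where "l = (INF n\<in>{1..}. a n / real n)"
  have bdd: "bdd_below ((\<lambda>n. a n / real n) ` {1..})"
    using nonneg by (intro bdd_belowI[where m = 0]) auto
  have low: "l * real n \<le> a n" for n
  proof (cases "n = 0")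
    case False
    then have "l \<le> a n / real n"
      unfolding l_def by (intro cINF_lower[OF bdd]) auto
    then show ?thesis using False by (simp add: field_simps)
  qed (use nonneg in auto)
  have multiple: "a (m * k + r) \<le> real k * a m + a r" for m k r
  proof (induction k)
    case (Suc k)
    have "a (m * Suc k + r) \<le> a m + a (m * k + r)"
      using subadd[of m "m * k + r"] by (simp add: algebra_simps)
    then show ?case using Suc by (simp add: algebra_simps)
  qed simp
  have "(\<lambda>n. a n / real n) \<longlonglongrightarrow> l"
  proof (rule LIMSEQ_I)
    fix e :: real assume "0 < e"
    have "\<exists>m\<in>{1..}. a m / real m < l + e / 2"
      using \<open>0 < e\<close> cINF_less_iff[OF _ bdd, of "l + e / 2"] unfolding l_def by auto
    then obtain m where m: "m \<ge> 1" "a m / real m < l + e / 2" by auto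
    \<comment> \<open>Writing \<open>n = m k + r\<close> with \<open>r < m\<close>, the remainder contributes at most \<open>C\<close>.\<close>
  define C where "C = Max (a ` {..<m})"
    have C: "a r \<le> C" if "r < m" for r unfolding C_def using that by auto
    obtain N :: nat where N: "real N > 2 * C / e" using reals_Archimedean2 by blast
    show "\<exists>no. \<forall>n\<ge>no. norm (a n / real n - l) < e"
    proof (intro exI[of _ "max N 1"] allI impI)
      fix n assume "n \<ge> max N 1"
      then have n: "n \<ge> N" "n \<ge> 1" by auto
      have "a n \<le> real (n div m) * a m + a (n mod m)"
        using multiple[of m "n div m" "n mod m"] by simp
      also have "\<dots> \<le> real (n div m) * a m + C" using C m by simp
      also have "\<dots> \<le> (real n / real m) * a m + C"
        using of_nat_div_le_of_nat[of n m] nonneg[of m] by (intro add_mono mult_right_mono) auto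
      finally have "a n / real n \<le> ((real n / real m) * a m + C) / real n"
        by (intro divide_right_mono) auto
      also have "\<dots> = a m / real m + C / real n" using n by (simp add: field_simps)
      also have "C / real n < e / 2"
        using N n \<open>0 < e\<close> by (simp add: field_simps) (smt (verit) mult_left_mono of_nat_le_iff)
      finally have "a n / real n < l + e" using m by simp
      moreover have "l \<le> a n / real n" using low[of n] n by (simp add: field_simps)
      ultimately show "norm (a n / real n - l) < e" by simp
    qed
  qed
  then show thesis using low that by blast
qed

section \<open>The convexity inequality\<close>

text \<open>\<open>x coth x\<close>, extended by its limit at 0.\<close>

definition xcoth :: "real \<Rightarrow> real" where
  "xcoth x = (if x = 0 then 1 else x * cosh x / sinh x)"

lemma sinh_mult_xcoth: "sinh x * xcoth x = x * cosh x"
  by (simp add: xcoth_def)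

text \<open>
  The derivative of \<open>x coth x\<close> has the sign of \<open>sinh x cosh x - x\<close>; at the left end point the claim is
  \<open>sinh y < y cosh y\<close>.
\<close>

lemma xcoth_strict_mono:
  fixes x y :: real
  assumes "0 \<le> x" "x < y"
  shows "xcoth x < xcoth y"
proof -
  have pos: "sinh t < t * cosh t" "t < sinh t * cosh t" if "0 < t" for t :: real
  proof -
    have "((\<lambda>t::real. t * cosh t - sinh t) has_real_derivative t * sinh t) (at t)" for t
      by (auto intro!: derivative_eq_intros)
    then have "0 * cosh 0 - sinh 0 < t * cosh t - sinh t"
      using that by (intro DERIV_pos_imp_increasing_open[OF \<open>0 < t\<close>])
        (auto intro!: continuous_intros exI)
    then show "sinh t < t * cosh t" by simp
    have "((\<lambda>t::real. sinh t * cosh t - t) has_real_derivative 2 * (sinh t)\<^sup>2) (at t)" for t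
      by (auto intro!: derivative_eq_intros simp: power2_eq_square)
        (use cosh_square_eq[of t] in \<open>simp add: power2_eq_square algebra_simps\<close>)
    then have "sinh 0 * cosh 0 - 0 < sinh t * cosh t - t"
      using that by (intro DERIV_pos_imp_increasing_open[OF \<open>0 < t\<close>])
        (auto intro!: continuous_intros exI)
    then show "t < sinh t * cosh t" by simp
  qed
  show ?thesis
  proof (cases "x = 0")
    case True
    then show ?thesis using pos(1)[of y] assms by (simp add: xcoth_def field_simps)
  next
    case False
    have "\<exists>D. ((\<lambda>t::real. t * cosh t / sinh t) has_real_derivative D) (at z) \<and> 0 < D" if "x \<le> z" for z
    proof -
      have z: "0 < z" "0 < sinh z" using that assms False by auto
      have "((\<lambda>t::real. t * cosh t / sinh t) has_real_derivative
          ((cosh z + z * sinh z) * sinh z - z * cosh z * cosh z) / (sinh z * sinh z)) (at z)"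
        using z by (auto intro!: derivative_eq_intros simp: mult_ac)
      moreover have "(cosh z + z * sinh z) * sinh z - z * cosh z * cosh z = sinh z * cosh z - z"
        using cosh_square_eq[of z] by (simp add: algebra_simps power2_eq_square)
      ultimately show ?thesis using z pos(2)[of z] by (auto intro!: exI)
    qed
    then have "x * cosh x / sinh x < y * cosh y / sinh y"
      by (intro DERIV_pos_imp_increasing[OF assms(2)]) auto
    then show ?thesis using assms False by (simp add: xcoth_def)
  qed
qed

lemma entropy_profile_deriv:
  "((\<lambda>x::real. x * sinh x - (1 + c) * cosh x) has_real_derivative sinh t * (xcoth t - c)) (at t)"
  by (auto intro!: derivative_eq_intros) (use sinh_mult_xcoth[of t] in \<open>simp add: algebra_simps\<close>)

text \<open>
  The tangent inequality behind the equality case of Jensen's inequality. Seen as a function of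
  \<open>s = 1 / cosh x\<close>, the quantity \<open>2 x tanh x\<close> is strictly convex, so it lies above its tangent at
  \<open>s = 1 / cosh y\<close> and touches it only there. Multiplying by \<open>cosh x / 2\<close> gives the form below, an even
  function whose derivative \<open>sinh x (x coth x - y coth y)\<close> changes sign, for positive \<open>x\<close>, exactly at \<open>y\<close>.
\<close>

lemma entropy_profile_min:
  fixes x y :: real
  defines "p \<equiv> \<lambda>x. x * sinh x - (1 + xcoth y) * cosh x"
  assumes "0 \<le> y" and "\<bar>x\<bar> \<noteq> y"
  shows "p y < p x"
proof -
  have deriv: "(p has_real_derivative sinh t * (xcoth t - xcoth y)) (at t)" for t
    unfolding p_def by (rule entropy_profile_deriv)
  have cont: "continuous_on S p" for S
    unfolding p_def by (intro continuous_intros)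
  have "p y < p \<bar>x\<bar>"
  proof (cases "\<bar>x\<bar> < y")
    case True
    have "\<exists>D. (p has_real_derivative D) (at t) \<and> D < 0" if "\<bar>x\<bar> < t" "t < y" for t
      using deriv[of t] xcoth_strict_mono[of t y] that
      by (intro exI[of _ "sinh t * (xcoth t - xcoth y)"]) (auto simp: mult_less_0_iff)
    then show ?thesis
      using DERIV_neg_imp_decreasing_open[OF True _ cont] by blast
  next
    case False
    then have "y < \<bar>x\<bar>" using assms by simp
    have "\<exists>D. (p has_real_derivative D) (at t) \<and> D > 0" if "y < t" "t < \<bar>x\<bar>" for t
      using deriv[of t] xcoth_strict_mono[of y t] that assms
      by (intro exI[of _ "sinh t * (xcoth t - xcoth y)"]) (auto simp: zero_less_mult_iff)
    then show ?thesis
      using DERIV_pos_imp_increasing_open[OF \<open>y < \<bar>x\<bar>\<close> _ cont] by blast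
  qed
  also have "p \<bar>x\<bar> = p x" by (simp add: p_def abs_if)
  finally show ?thesis .
qed

text \<open>
  Half the negative slope of \<open>2 x tanh x\<close>, as a function of \<open>1 / cosh x\<close>, at \<open>x = y\<close>.
\<close>

definition affinity_weight :: "real \<Rightarrow> real" where
  "affinity_weight y = (1 + xcoth y) * cosh y - y * sinh y"

text \<open>
  The gap between \<open>2 x tanh x\<close> and its tangent in the variable \<open>1 / cosh x\<close>, multiplied by the weight
  \<open>(1 + D) / 2\<close> and written in terms of \<open>D = e\<^sup>2\<^sup>x\<close>. In this form its integral only involves
  \<open>\<integral> (D - 1) ln D\<close>, \<open>\<integral> D\<close> and \<open>\<integral> sqrt D\<close>.
\<close>

definition entropy_excess :: "real \<Rightarrow> real \<Rightarrow> real" where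
  "entropy_excess y D =
     (D - 1) * ln D / 2 - (1 + xcoth y) * (1 + D) + 2 * affinity_weight y * sqrt D"

lemma entropy_excess_exp:
  "entropy_excess y (exp (2 * x)) =
     2 * exp x * ((x * sinh x - (1 + xcoth y) * cosh x) - (y * sinh y - (1 + xcoth y) * cosh y))"
proof -
  have e: "exp (2 * x) = exp x * exp x" by (simp flip: exp_add)
  have s: "sqrt (exp x * exp x) = exp x" by simp
  have sh: "2 * exp x * sinh x = exp x * exp x - 1" and ch: "2 * exp x * cosh x = exp x * exp x + 1"
    by (simp_all add: sinh_field_def cosh_field_def exp_minus field_simps)
  have "entropy_excess y (exp (2 * x)) = x * (exp x * exp x - 1) - (1 + xcoth y) * (exp x * exp x + 1)
     + 2 * affinity_weight y * exp x"
    unfolding entropy_excess_def e s ln_exp[of "2 * x", unfolded e] by (simp add: field_simps)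
  also have "\<dots> = 2 * exp x * ((x * sinh x - (1 + xcoth y) * cosh x) -
      (y * sinh y - (1 + xcoth y) * cosh y))"
    unfolding sh[symmetric] ch[symmetric] affinity_weight_def by (simp add: algebra_simps)
  finally show ?thesis .
qed

lemma entropy_excess_nonneg:
  assumes "0 \<le> y" "0 < D" shows "0 \<le> entropy_excess y D"
proof -
  have D: "D = exp (2 * (ln D / 2))" using assms by simp
  show ?thesis
  proof (cases "\<bar>ln D / 2\<bar> = y")
    case True
    then have "ln D / 2 = y \<or> ln D / 2 = - y" using assms by linarith
    then show ?thesis by (subst D, subst entropy_excess_exp) auto
  next
    case False
    from entropy_profile_min[OF assms(1) this] show ?thesis
      by (subst D, subst entropy_excess_exp) auto
  qed
qed

lemma entropy_excess_eq_0D: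
  assumes "0 \<le> y" "0 < D" "entropy_excess y D = 0" shows "D \<in> {exp (2 * y), exp (- (2 * y))}"
proof -
  have D: "D = exp (2 * (ln D / 2))" using assms by simp
  have "entropy_excess y (exp (2 * (ln D / 2))) = 0" using assms(3) D by simp
  then have "\<bar>ln D / 2\<bar> = y"
    using entropy_profile_min[OF assms(1), of "ln D / 2"]
    unfolding entropy_excess_exp by fastforce
  then have "ln D = 2 * y \<or> ln D = - (2 * y)" by linarith
  then show ?thesis using assms(2) by (metis exp_ln insertCI)
qed

lemma affinity_weight_nonneg:
  assumes "0 \<le> y" shows "0 \<le> affinity_weight y"
proof -
  have "0 \<le> xcoth y" using assms by (auto simp: xcoth_def)
  have "affinity_weight y * cosh y = (1 + xcoth y) * (cosh y)\<^sup>2 - sinh y * (y * cosh y)"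
    by (simp add: affinity_weight_def algebra_simps power2_eq_square)
  also have "\<dots> = (cosh y)\<^sup>2 + xcoth y"
    unfolding sinh_mult_xcoth[symmetric] cosh_square_eq by (simp add: algebra_simps power2_eq_square)
  finally have "0 \<le> affinity_weight y * cosh y" using \<open>0 \<le> xcoth y\<close> by simp
  then show ?thesis using cosh_real_pos[of y] by (simp add: zero_le_mult_iff)
qed

text \<open>
  The tangent meets the curve at \<open>1 / cosh y\<close>: with entropy \<open>2 y tanh y\<close>, total mass 1 and affinity
  \<open>1 / cosh y\<close>, the integral of the excess vanishes.
\<close>

lemma tanh_affinity_weight:
  "2 * y * tanh y - 2 * (1 + xcoth y) + 2 * affinity_weight y / cosh y = (0::real)"
  using cosh_real_pos[of y] by (simp add: affinity_weight_def tanh_def field_simps)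

section \<open>Expectations of discrete measures\<close>

lemma integrable_pmf_iff_summable:
  fixes f :: "'a \<Rightarrow> real"
  assumes "set_pmf p \<subseteq> A"
  shows "integrable (measure_pmf p) f \<longleftrightarrow> (\<lambda>x. pmf p x * f x) summable_on A"
proof -
  have "integrable (measure_pmf p) f \<longleftrightarrow> integrable (count_space UNIV) (\<lambda>x. pmf p x * f x)"
    unfolding measure_pmf_eq_density by (subst integrable_density) auto
  also have "\<dots> \<longleftrightarrow> (\<lambda>x. pmf p x * f x) summable_on UNIV"
    unfolding abs_summable_on_def[symmetric] abs_summable_equivalent[symmetric]
      summable_on_iff_abs_summable_on_real[symmetric] ..
  also have "\<dots> \<longleftrightarrow> (\<lambda>x. pmf p x * f x) summable_on A"
    using assms by (intro summable_on_cong_neutral) (auto simp: set_pmf_eq)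
  finally show ?thesis .
qed

lemma expectation_eq_infsum:
  fixes f :: "'a \<Rightarrow> real"
  assumes "set_pmf p \<subseteq> A"
  shows "measure_pmf.expectation p f = (\<Sum>\<^sub>\<infinity>x\<in>A. pmf p x * f x)"
proof (cases "integrable (measure_pmf p) f")
  case True
  then have "(\<lambda>x. pmf p x * f x) summable_on UNIV"
    using integrable_pmf_iff_summable[of p UNIV] by simp
  then have "infsetsum (\<lambda>x. pmf p x * f x) UNIV = (\<Sum>\<^sub>\<infinity>x. pmf p x * f x)"
    by (intro infsetsum_infsum)
      (simp only: abs_summable_equivalent[symmetric] summable_on_iff_abs_summable_on_real[symmetric])
  also have "\<dots> = (\<Sum>\<^sub>\<infinity>x\<in>A. pmf p x * f x)"
    using assms by (intro infsum_cong_neutral) (auto simp: set_pmf_eq)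
  finally show ?thesis by (simp add: pmf_expectation_eq_infsetsum)
next
  case False
  then show ?thesis
    using integrable_pmf_iff_summable[OF assms, of f]
    by (simp add: infsum_not_exists not_integrable_integral_eq)
qed

text \<open>
  Change of measure between discrete laws. It plays the part of the Radon-Nikodym theorem for
  translates of measures on the group.
\<close>

lemma expectation_reweight:
  fixes f :: "'a \<Rightarrow> real"
  assumes "set_pmf q \<subseteq> set_pmf p"
  shows "integrable (measure_pmf q) f \<longleftrightarrow> integrable (measure_pmf p) (\<lambda>x. pmf q x / pmf p x * f x)"
    and "measure_pmf.expectation q f = measure_pmf.expectation p (\<lambda>x. pmf q x / pmf p x * f x)"
proof -
  have "pmf q x * f x = pmf p x * (pmf q x / pmf p x * f x)" for x
    using assms by (cases "x \<in> set_pmf p") (auto simp: set_pmf_eq)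
  then show "integrable (measure_pmf q) f \<longleftrightarrow> integrable (measure_pmf p) (\<lambda>x. pmf q x / pmf p x * f x)"
    "measure_pmf.expectation q f = measure_pmf.expectation p (\<lambda>x. pmf q x / pmf p x * f x)"
    by (simp_all add: integrable_pmf_iff_summable[OF subset_UNIV] expectation_eq_infsum[OF subset_UNIV])
qed

lemma pmf_integrable_bounded:
  fixes f :: "'a \<Rightarrow> real"
  assumes "\<And>x. x \<in> set_pmf p \<Longrightarrow> \<bar>f x\<bar> \<le> C"
  shows "integrable (measure_pmf p) f"
  using assms by (intro measure_pmf.integrable_const_bound[where B = C]) (auto simp: AE_measure_pmf_iff)

lemma pmf_integrable_nn_bound:
  fixes f :: "'a \<Rightarrow> real"
  assumes "\<And>x. x \<in> set_pmf p \<Longrightarrow> 0 \<le> f x" "(\<integral>\<^sup>+x. ennreal (f x) \<partial>measure_pmf p) \<le> ennreal c" "0 \<le> c"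
  shows "integrable (measure_pmf p) f" "measure_pmf.expectation p f \<le> c"
proof -
  have AE: "AE x in measure_pmf p. 0 \<le> f x" using assms(1) by (simp add: AE_measure_pmf_iff)
  show int: "integrable (measure_pmf p) f"
    using assms(2) AE by (intro integrableI_nonneg) (auto intro: le_less_trans)
  show "measure_pmf.expectation p f \<le> c"
    using assms(2,3) nn_integral_eq_integral[OF int AE] by simp
qed

lemma pmf_expectation_mono:
  fixes f g :: "'a \<Rightarrow> real"
  assumes "integrable (measure_pmf p) f" "integrable (measure_pmf p) g"
    and "\<And>x. x \<in> set_pmf p \<Longrightarrow> f x \<le> g x"
  shows "measure_pmf.expectation p f \<le> measure_pmf.expectation p g"
  using assms by (intro integral_mono_AE) (auto simp: AE_measure_pmf_iff)

lemma pmf_expectation_cong: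
  fixes f g :: "'a \<Rightarrow> real"
  assumes "\<And>x. x \<in> set_pmf p \<Longrightarrow> f x = g x"
  shows "measure_pmf.expectation p f = measure_pmf.expectation p g"
  using assms by (intro integral_cong_AE) (auto simp: AE_measure_pmf_iff)

lemma pmf_integrable_cong:
  fixes f g :: "'a \<Rightarrow> real"
  assumes "\<And>x. x \<in> set_pmf p \<Longrightarrow> f x = g x"
  shows "integrable (measure_pmf p) f \<longleftrightarrow> integrable (measure_pmf p) g"
  using assms by (intro integrable_cong_AE) (auto simp: AE_measure_pmf_iff)

lemma pmf_integrable_mono:
  fixes f g :: "'a \<Rightarrow> real"
  assumes "integrable (measure_pmf p) g" "\<And>x. x \<in> set_pmf p \<Longrightarrow> \<bar>f x\<bar> \<le> g x"
  shows "integrable (measure_pmf p) f"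
  by (rule Bochner_Integration.integrable_bound[OF assms(1)]) (use assms(2) in \<open>force simp: AE_measure_pmf_iff\<close>)+

lemma expectation_bind_pmf_nonneg:
  fixes g :: "'b \<Rightarrow> real"
  assumes "\<And>y. 0 \<le> g y" and int: "\<And>x. x \<in> set_pmf p \<Longrightarrow> integrable (measure_pmf (k x)) g"
    and "integrable (measure_pmf p) (\<lambda>x. measure_pmf.expectation (k x) g)"
  shows "integrable (measure_pmf (bind_pmf p k)) g"
    and "measure_pmf.expectation (bind_pmf p k) g = measure_pmf.expectation p (\<lambda>x. measure_pmf.expectation (k x) g)"
proof -
  let ?E = "measure_pmf.expectation p (\<lambda>x. measure_pmf.expectation (k x) g)"
  have "(\<integral>\<^sup>+y. ennreal (g y) \<partial>bind_pmf p k) = (\<integral>\<^sup>+x. (\<integral>\<^sup>+y. ennreal (g y) \<partial>k x) \<partial>p)" by simp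
  also have "\<dots> = (\<integral>\<^sup>+x. ennreal (measure_pmf.expectation (k x) g) \<partial>p)"
    using assms(1) int by (intro nn_integral_cong_AE) (auto simp: AE_measure_pmf_iff nn_integral_eq_integral)
  also have "\<dots> = ennreal ?E"
    using assms by (intro nn_integral_eq_integral) (auto intro!: integral_nonneg)
  finally have *: "(\<integral>\<^sup>+y. ennreal (g y) \<partial>bind_pmf p k) = ennreal ?E" .
  have "0 \<le> ?E" using assms(1) by simp
  then show int: "integrable (measure_pmf (bind_pmf p k)) g"
    using * assms(1) by (intro pmf_integrable_nn_bound[where c = ?E]) auto
  show "measure_pmf.expectation (bind_pmf p k) g = ?E"
    using * nn_integral_eq_integral[OF int] assms(1) \<open>0 \<le> ?E\<close> by (simp add: integral_nonneg)
qed

text \<open>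
  Fubini's theorem for two-step experiments. The proof treats \<open>\<bar>g\<bar>\<close> and \<open>g + \<bar>g\<bar>\<close> as nonnegative
  functions and subtracts.
\<close>

lemma expectation_bind_pmf:
  fixes g :: "'b \<Rightarrow> real"
  assumes int: "\<And>x. x \<in> set_pmf p \<Longrightarrow> integrable (measure_pmf (k x)) g"
    and int2: "integrable (measure_pmf p) (\<lambda>x. measure_pmf.expectation (k x) (\<lambda>y. \<bar>g y\<bar>))"
  shows "integrable (measure_pmf (bind_pmf p k)) g"
    and "integrable (measure_pmf p) (\<lambda>x. measure_pmf.expectation (k x) g)"
    and "measure_pmf.expectation (bind_pmf p k) g = measure_pmf.expectation p (\<lambda>x. measure_pmf.expectation (k x) g)"
proof -
  let ?h = "\<lambda>y. g y + \<bar>g y\<bar>"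
  show int3: "integrable (measure_pmf p) (\<lambda>x. measure_pmf.expectation (k x) g)"
    by (rule pmf_integrable_mono[OF int2]) (use integral_abs_bound in blast)
  have h: "measure_pmf.expectation (k x) ?h = measure_pmf.expectation (k x) g + measure_pmf.expectation (k x) (\<lambda>y. \<bar>g y\<bar>)"
    if "x \<in> set_pmf p" for x
    using int[OF that] by simp
  have "integrable (measure_pmf p) (\<lambda>x. measure_pmf.expectation (k x) ?h)"
    using int3 int2 by (subst pmf_integrable_cong[OF h]) auto
  then have H: "integrable (measure_pmf (bind_pmf p k)) ?h"
    "measure_pmf.expectation (bind_pmf p k) ?h = measure_pmf.expectation p (\<lambda>x. measure_pmf.expectation (k x) ?h)"
    using int by (intro expectation_bind_pmf_nonneg; force)+
  have A: "integrable (measure_pmf (bind_pmf p k)) (\<lambda>y. \<bar>g y\<bar>)"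
    "measure_pmf.expectation (bind_pmf p k) (\<lambda>y. \<bar>g y\<bar>) = measure_pmf.expectation p (\<lambda>x. measure_pmf.expectation (k x) (\<lambda>y. \<bar>g y\<bar>))"
    using int int2 by (intro expectation_bind_pmf_nonneg; force)+
  show G: "integrable (measure_pmf (bind_pmf p k)) g"
    using Bochner_Integration.integrable_diff[OF H(1) A(1)] by simp
  have "measure_pmf.expectation p (\<lambda>x. measure_pmf.expectation (k x) ?h) =
    measure_pmf.expectation p (\<lambda>x. measure_pmf.expectation (k x) g) + measure_pmf.expectation p (\<lambda>x. measure_pmf.expectation (k x) (\<lambda>y. \<bar>g y\<bar>))"
    using int2 int3 by (subst pmf_expectation_cong[OF h]) auto
  then show "measure_pmf.expectation (bind_pmf p k) g = measure_pmf.expectation p (\<lambda>x. measure_pmf.expectation (k x) g)"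
    using H(2) A G by simp
qed

lemma integrable_bind_pmfD:
  fixes g :: "'b \<Rightarrow> real"
  assumes "integrable (measure_pmf (bind_pmf p k)) g"
  shows "x \<in> set_pmf p \<Longrightarrow> integrable (measure_pmf (k x)) g"
    and "integrable (measure_pmf p) (\<lambda>x. measure_pmf.expectation (k x) (\<lambda>y. \<bar>g y\<bar>))"
proof -
  have fin: "(\<integral>\<^sup>+x. (\<integral>\<^sup>+y. ennreal \<bar>g y\<bar> \<partial>k x) \<partial>p) < \<infinity>"
    using assms unfolding integrable_iff_bounded by simp
  have "AE x in p. (\<integral>\<^sup>+y. ennreal \<bar>g y\<bar> \<partial>k x) \<noteq> \<infinity>"
    using fin by (intro nn_integral_PInf_AE) auto
  then show int: "integrable (measure_pmf (k x)) g" if "x \<in> set_pmf p" for x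
    using that by (auto simp: AE_measure_pmf_iff integrable_iff_bounded less_top)
  have "(\<integral>\<^sup>+x. ennreal (measure_pmf.expectation (k x) (\<lambda>y. \<bar>g y\<bar>)) \<partial>p) =
      (\<integral>\<^sup>+x. (\<integral>\<^sup>+y. ennreal \<bar>g y\<bar> \<partial>k x) \<partial>p)"
    using int by (intro nn_integral_cong_AE) (auto simp: AE_measure_pmf_iff nn_integral_eq_integral)
  then show "integrable (measure_pmf p) (\<lambda>x. measure_pmf.expectation (k x) (\<lambda>y. \<bar>g y\<bar>))"
    using fin by (intro integrableI_nonneg) (auto intro!: integral_nonneg)
qed

lemma expectation_Cauchy_Schwarz:
  fixes f g :: "'a \<Rightarrow> real"
  assumes "integrable M (\<lambda>x. (f x)\<^sup>2)" "integrable M (\<lambda>x. (g x)\<^sup>2)"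
    and [measurable]: "f \<in> borel_measurable M" "g \<in> borel_measurable M"
  shows "integrable M (\<lambda>x. f x * g x)"
    and "\<integral>x. f x * g x \<partial>M \<le> sqrt (\<integral>x. (f x)\<^sup>2 \<partial>M) * sqrt (\<integral>x. (g x)\<^sup>2 \<partial>M)"
proof -
  have am: "\<bar>a * b\<bar> \<le> a\<^sup>2 + b\<^sup>2" for a b :: real
  proof -
    have "2 * (\<bar>a\<bar> * \<bar>b\<bar>) \<le> a\<^sup>2 + b\<^sup>2" using sum_squares_bound[of "\<bar>a\<bar>" "\<bar>b\<bar>"] by simp
    then show ?thesis
      using mult_nonneg_nonneg[of "\<bar>a\<bar>" "\<bar>b\<bar>"] unfolding abs_mult by linarith
  qed
  show int: "integrable M (\<lambda>x. f x * g x)"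
    by (rule Bochner_Integration.integrable_bound[OF Bochner_Integration.integrable_add[OF assms(1,2)]])
      (use am in auto)
  let ?F = "\<integral>x. (f x)\<^sup>2 \<partial>M" and ?G = "\<integral>x. (g x)\<^sup>2 \<partial>M" and ?H = "\<integral>x. f x * g x \<partial>M"
  have "0 \<le> (\<integral>x. (s * f x + t * g x)\<^sup>2 \<partial>M)" for s t by simp
  also have "(\<integral>x. (s * f x + t * g x)\<^sup>2 \<partial>M) =
      (\<integral>x. s\<^sup>2 * (f x)\<^sup>2 + 2 * s * t * (f x * g x) + t\<^sup>2 * (g x)\<^sup>2 \<partial>M)" for s t
    by (intro Bochner_Integration.integral_cong) (auto simp: power2_sum power_mult_distrib mult_ac)
  also have "\<dots> s t = s\<^sup>2 * ?F + 2 * s * t * ?H + t\<^sup>2 * ?G" for s t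
    using assms int by simp
  finally have q: "0 \<le> s\<^sup>2 * ?F + 2 * s * t * ?H + t\<^sup>2 * ?G" for s t .
  have pos: "0 \<le> ?F" "0 \<le> ?G" by simp_all
  have "?H\<^sup>2 \<le> ?F * ?G"
  proof (cases "?F = 0 \<and> ?G = 0")
    case True
    then show ?thesis using q[of 1 1] q[of 1 "-1"] by (auto simp: True)
  next
    case False
    have 1: "0 \<le> ?F * (?F * ?G - ?H\<^sup>2)" using q[of "?H" "- ?F"] by (simp add: power2_eq_square algebra_simps)
    have 2: "0 \<le> ?G * (?F * ?G - ?H\<^sup>2)" using q[of "?G" "- ?H"] by (simp add: power2_eq_square algebra_simps)
    show ?thesis using 1 2 False pos by (auto simp: zero_le_mult_iff)
  qed
  then show "?H \<le> sqrt ?F * sqrt ?G"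
    by (metis real_sqrt_mult abs_le_D1 real_sqrt_abs real_sqrt_le_mono)
qed

section \<open>Convolution powers of a symmetric measure\<close>

locale symmetric_walk = group G for G (structure) +
  fixes \<mu> :: "'a pmf"
  assumes supp: "set_pmf \<mu> \<subseteq> carrier G" and sym: "symmetric_pmf G \<mu>"
begin

abbreviation walk :: "nat \<Rightarrow> 'a pmf" where "walk \<equiv> conv_power G \<mu>"

lemma convolution_eq_bind: "convolution G p q = bind_pmf p (\<lambda>x. map_pmf ((\<otimes>) x) q)"
  by (simp add: convolution_def pair_pmf_def map_bind_pmf map_pmf_def bind_assoc_pmf bind_return_pmf)

lemma set_convolution:
  assumes "set_pmf p \<subseteq> carrier G" "set_pmf q \<subseteq> carrier G"
  shows "set_pmf (convolution G p q) \<subseteq> carrier G"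
  using assms by (auto simp: convolution_eq_bind)

lemma convolution_assoc:
  assumes "set_pmf p \<subseteq> carrier G" "set_pmf q \<subseteq> carrier G" "set_pmf r \<subseteq> carrier G"
  shows "convolution G (convolution G p q) r = convolution G p (convolution G q r)"
  unfolding convolution_eq_bind bind_map_pmf bind_assoc_pmf map_bind_pmf map_pmf_comp comp_def
  using assms by (intro bind_pmf_cong map_pmf_cong refl m_assoc) blast+

lemma set_walk: "set_pmf (walk n) \<subseteq> carrier G"
proof (induction n)
  case (Suc n)
  from set_convolution[OF this supp] show ?case by simp
qed simp

lemma walk_add: "walk (m + n) = convolution G (walk m) (walk n)"
proof (induction n)
  case 0
  have "map_pmf (\<lambda>x. x \<otimes> \<one>) (walk m) = walk m"
    using set_walk[of m] by (intro map_pmf_idI) auto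
  then show ?case by (simp add: convolution_def pair_return_pmf2 map_pmf_comp case_prod_beta)
next
  case (Suc n)
  then show ?case by (simp add: convolution_assoc set_walk supp)
qed

lemma walk_1: "walk 1 = \<mu>"
proof -
  have "map_pmf (\<lambda>x. \<one> \<otimes> x) \<mu> = \<mu>" using supp by (intro map_pmf_idI) auto
  then show ?thesis by (simp add: convolution_eq_bind bind_return_pmf)
qed

lemma walk_Suc: "walk (Suc n) = convolution G \<mu> (walk n)"
  using walk_add[of 1 n] by (simp only: walk_1 plus_1_eq_Suc)

lemma pmf_convolution: "pmf (convolution G p q) z = measure_pmf.expectation p (\<lambda>x. measure_pmf.prob q {y. x \<otimes> y = z})"
  by (simp add: convolution_eq_bind pmf_bind pmf_map vimage_def)

lemma pmf_convolution_sum_le: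
  assumes "finite I" "inj_on a I" "\<And>i. i \<in> I \<Longrightarrow> a i \<otimes> b i = z"
  shows "(\<Sum>i\<in>I. pmf p (a i) * pmf q (b i)) \<le> pmf (convolution G p q) z"
proof -
  have "(\<Sum>i\<in>I. pmf p (a i) * pmf q (b i)) = (\<Sum>i\<in>I. pmf (pair_pmf p q) (a i, b i))"
    by (simp add: pmf_pair)
  also have "\<dots> = (\<Sum>w\<in>(\<lambda>i. (a i, b i)) ` I. pmf (pair_pmf p q) w)"
    using assms(2) by (subst sum.reindex) (auto simp: inj_on_def)
  also have "\<dots> = measure_pmf.prob (pair_pmf p q) ((\<lambda>i. (a i, b i)) ` I)"
    using assms(1) by (simp add: measure_measure_pmf_finite)
  also have "\<dots> \<le> measure_pmf.prob (pair_pmf p q) ((\<lambda>(x, y). x \<otimes> y) -` {z})"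
    using assms(3) by (intro measure_pmf.finite_measure_mono) auto
  finally show ?thesis by (simp add: convolution_def pmf_map)
qed

lemma pmf_convolution_ge: "pmf p x * pmf q y \<le> pmf (convolution G p q) (x \<otimes> y)"
  using pmf_convolution_sum_le[of "{x}" "\<lambda>_. x" "\<lambda>_. y" "x \<otimes> y" p q] by simp

lemma pmf_convolution_infsum:
  assumes "set_pmf p \<subseteq> carrier G" "set_pmf q \<subseteq> carrier G" "z \<in> carrier G"
  shows "pmf (convolution G p q) z = (\<Sum>\<^sub>\<infinity>x\<in>carrier G. pmf p x * pmf q (inv x \<otimes> z))"
    and "(\<lambda>x. pmf p x * pmf q (inv x \<otimes> z)) summable_on carrier G"
proof -
  have "measure_pmf.prob q {y. x \<otimes> y = z} = pmf q (inv x \<otimes> z)" if "x \<in> set_pmf p" for x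
  proof -
    have "measure_pmf.prob q {y. x \<otimes> y = z} = measure_pmf.prob q {inv x \<otimes> z}"
      using that assms by (intro measure_pmf.finite_measure_eq_AE)
        (auto simp: AE_measure_pmf_iff inv_solve_left subset_iff)
    then show ?thesis by (simp add: measure_pmf_single)
  qed
  then have "pmf (convolution G p q) z = measure_pmf.expectation p (\<lambda>x. pmf q (inv x \<otimes> z))"
    unfolding pmf_convolution by (rule pmf_expectation_cong)
  then show "pmf (convolution G p q) z = (\<Sum>\<^sub>\<infinity>x\<in>carrier G. pmf p x * pmf q (inv x \<otimes> z))"
    using assms by (simp add: expectation_eq_infsum)
  show "(\<lambda>x. pmf p x * pmf q (inv x \<otimes> z)) summable_on carrier G"
    by (subst integrable_pmf_iff_summable[OF assms(1), symmetric])
      (auto intro!: pmf_integrable_bounded[where C = 1] simp: pmf_le_1)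
qed

lemma pmf_map_inv:
  assumes "set_pmf p \<subseteq> carrier G" "g \<in> carrier G"
  shows "pmf (map_pmf (\<lambda>x. inv x) p) g = pmf p (inv g)"
proof -
  have "(inv x = g) = (x = inv g)" if "x \<in> set_pmf p" for x
    using that assms by (metis inv_inv subsetD)
  then have "measure_pmf.prob p ((\<lambda>x. inv x) -` {g}) = measure_pmf.prob p {inv g}"
    by (intro measure_pmf.finite_measure_eq_AE) (simp_all add: AE_measure_pmf_iff)
  then show ?thesis by (simp add: pmf_map measure_pmf_single)
qed

lemma map_inv_walk: "map_pmf (\<lambda>x. inv x) (walk n) = walk n"
proof (induction n)
  case (Suc n)
  have \<mu>: "map_pmf (\<lambda>x. inv x) \<mu> = \<mu>"
  proof (rule pmf_eqI)
    fix g
    show "pmf (map_pmf (\<lambda>x. inv x) \<mu>) g = pmf \<mu> g"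
    proof (cases "g \<in> carrier G")
      case True
      then show ?thesis using pmf_map_inv[OF supp True] sym unfolding symmetric_pmf_def by metis
    next
      case False
      then have "g \<notin> set_pmf \<mu>" using supp by blast
      moreover have "g \<notin> set_pmf (map_pmf (\<lambda>x. inv x) \<mu>)"
        using supp False inv_closed by (force simp only: set_map_pmf image_iff)
      ultimately show ?thesis by (simp only: set_pmf_eq mem_Collect_eq not_not)
    qed
  qed
  have "map_pmf (\<lambda>x. inv x) (walk (Suc n)) =
      bind_pmf (walk n) (\<lambda>x. bind_pmf \<mu> (\<lambda>y. return_pmf (inv (x \<otimes> y))))"
    by (simp add: convolution_eq_bind map_bind_pmf map_pmf_comp) (simp add: map_pmf_def)
  also have "\<dots> = bind_pmf (walk n) (\<lambda>x. bind_pmf \<mu> (\<lambda>y. return_pmf (inv y \<otimes> inv x)))"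
    using set_walk[of n] supp
    by (intro bind_pmf_cong refl arg_cong[where f = return_pmf] inv_mult_group) blast+
  also have "\<dots> = bind_pmf \<mu> (\<lambda>y. bind_pmf (walk n) (\<lambda>x. return_pmf (inv y \<otimes> inv x)))"
    by (rule bind_commute_pmf)
  also have "\<dots> = convolution G (map_pmf (\<lambda>x. inv x) \<mu>) (map_pmf (\<lambda>x. inv x) (walk n))"
    by (simp add: convolution_eq_bind bind_map_pmf map_pmf_comp) (simp add: map_pmf_def)
  finally show ?case using Suc \<mu> by (simp only: walk_Suc)
qed simp

lemma pmf_walk_inv: "g \<in> carrier G \<Longrightarrow> pmf (walk n) (inv g) = pmf (walk n) g"
  using pmf_map_inv[OF set_walk, of g n] by (simp only: map_inv_walk)

lemma expectation_inv:
  fixes f :: "'a \<Rightarrow> real"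
  shows "measure_pmf.expectation \<mu> (\<lambda>x. f (inv x)) = measure_pmf.expectation \<mu> f"
    and "integrable (measure_pmf \<mu>) (\<lambda>x. f (inv x)) \<longleftrightarrow> integrable (measure_pmf \<mu>) f"
proof -
  have "map_pmf (\<lambda>x. inv x) \<mu> = \<mu>" using map_inv_walk[of 1] by (simp only: walk_1)
  then show "measure_pmf.expectation \<mu> (\<lambda>x. f (inv x)) = measure_pmf.expectation \<mu> f"
    "integrable (measure_pmf \<mu>) (\<lambda>x. f (inv x)) \<longleftrightarrow> integrable (measure_pmf \<mu>) f"
    by (metis integral_map_pmf, metis integrable_map_pmf_eq)
qed

text \<open>
  By symmetry \<open>\<mu>\<^sup>*\<^sup>2\<^sup>n(g)\<close> is an inner product in \<open>\<ell>\<^sup>2\<close> of two translates of \<open>\<mu>\<^sup>*\<^sup>n\<close>, and at the identity it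
  is the squared norm.
\<close>

lemma pmf_walk_even_le:
  assumes "g \<in> carrier G"
  shows "pmf (walk (n + n)) g \<le> pmf (walk (n + n)) \<one>"
proof -
  let ?p = "pmf (walk n)"
  have sq: "(\<lambda>x. (?p x)\<^sup>2) summable_on carrier G" "pmf (walk (n + n)) \<one> = (\<Sum>\<^sub>\<infinity>x\<in>carrier G. (?p x)\<^sup>2)"
    using pmf_convolution_infsum[OF set_walk[of n] set_walk[of n], of \<one>]
    by (simp_all add: walk_add pmf_walk_inv power2_eq_square cong: infsum_cong summable_on_cong)
  have bij: "bij_betw (\<lambda>x. inv x \<otimes> g) (carrier G) (carrier G)"
    using assms by (intro bij_betw_byWitness[where f' = "\<lambda>y. g \<otimes> inv y"])
      (auto simp: inv_mult_group m_assoc[symmetric], simp add: m_assoc)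
  have sq': "(\<lambda>x. (?p (inv x \<otimes> g))\<^sup>2) summable_on carrier G"
    "(\<Sum>\<^sub>\<infinity>x\<in>carrier G. (?p (inv x \<otimes> g))\<^sup>2) = (\<Sum>\<^sub>\<infinity>x\<in>carrier G. (?p x)\<^sup>2)"
    using summable_on_reindex_bij_betw[OF bij, of "\<lambda>x. (?p x)\<^sup>2"]
      infsum_reindex_bij_betw[OF bij, of "\<lambda>x. (?p x)\<^sup>2"] sq by auto
  have "pmf (walk (n + n)) g = (\<Sum>\<^sub>\<infinity>x\<in>carrier G. ?p x * ?p (inv x \<otimes> g))"
    using pmf_convolution_infsum(1)[OF set_walk set_walk assms] by (simp add: walk_add)
  also have "\<dots> \<le> (\<Sum>\<^sub>\<infinity>x\<in>carrier G. 1/2 * ((?p x)\<^sup>2 + (?p (inv x \<otimes> g))\<^sup>2))"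
  proof (rule infsum_mono)
    show "?p x * ?p (inv x \<otimes> g) \<le> 1/2 * ((?p x)\<^sup>2 + (?p (inv x \<otimes> g))\<^sup>2)" for x
      using sum_squares_bound[of "?p x" "?p (inv x \<otimes> g)"] by simp
    show "(\<lambda>x. ?p x * ?p (inv x \<otimes> g)) summable_on carrier G"
      by (rule pmf_convolution_infsum(2)[OF set_walk set_walk assms])
  qed (intro summable_on_cmult_right summable_on_add sq sq')
  also have "\<dots> = 1/2 * ((\<Sum>\<^sub>\<infinity>x\<in>carrier G. (?p x)\<^sup>2) + (\<Sum>\<^sub>\<infinity>x\<in>carrier G. (?p (inv x \<otimes> g))\<^sup>2))"
    by (subst infsum_cmult_right') (simp add: infsum_add[OF sq(1) sq'(1)])
  also have "\<dots> = pmf (walk (n + n)) \<one>" by (simp add: sq sq')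
  finally show ?thesis .
qed

section \<open>The spectral radius bounds affinities on the group\<close>

abbreviation \<rho> :: real where "\<rho> \<equiv> spectral_radius G \<mu>"

text \<open>
  The roots lie between 0 and 1, so the conversion of their limes superior to a real number loses
  nothing.
\<close>

lemma spectral_radius_limsup:
  shows "limsup (\<lambda>n. ereal (root n (pmf (walk n) \<one>))) = ereal \<rho>" and "0 \<le> \<rho>" and "\<rho> \<le> 1"
proof -
  let ?L = "limsup (\<lambda>n. ereal (root n (pmf (walk n) \<one>)))"
  have "?L \<le> 1"
    by (rule Limsup_bounded, intro always_eventually allI)
      (metis ereal_less_eq(3) one_ereal_def pmf_le_1 pmf_nonneg real_root_le_1_iff root_0 zero_le_one not_gr_zero)
  moreover have "0 \<le> ?L"
    by (rule le_Limsup) (auto intro!: always_eventually real_root_ge_zero)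
  ultimately have "\<bar>?L\<bar> \<noteq> \<infinity>" by auto
  then show eq: "?L = ereal \<rho>" by (simp add: spectral_radius_def ereal_real)
  show "0 \<le> \<rho>" "\<rho> \<le> 1" using \<open>?L \<le> 1\<close> \<open>0 \<le> ?L\<close> unfolding eq by simp_all
qed

text \<open>
  The quadratic form of the \<open>n\<close>-th power of the convolution operator at a function \<open>f\<close> supported on the
  finite set \<open>F\<close>.
\<close>

definition walk_form :: "'a set \<Rightarrow> ('a \<Rightarrow> real) \<Rightarrow> nat \<Rightarrow> real" where
  "walk_form F f n = (\<Sum>x\<in>F. \<Sum>z\<in>F. f x * f z * pmf (walk n) (z \<otimes> inv x))"

text \<open>
  Cauchy-Schwarz for the convolution operator \<open>P\<close>: \<open>\<langle>P\<^sup>n f, f\<rangle>\<^sup>2 \<le> \<langle>f, f\<rangle> \<langle>P\<^sup>n f, P\<^sup>n f\<rangle>\<close>, where the last factor is \<open>\<langle>P\<^sup>2\<^sup>n f, f\<rangle>\<close> by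
  symmetry. Only the part of \<open>\<langle>P\<^sup>n f, P\<^sup>n f\<rangle>\<close> supported on \<open>F\<close> is used, so all sums stay finite.
\<close>

lemma walk_form_doubling:
  assumes F: "finite F" "F \<subseteq> carrier G" and f: "\<And>x. 0 \<le> f x"
  shows "(walk_form F f n)\<^sup>2 \<le> (\<Sum>x\<in>F. (f x)\<^sup>2) * walk_form F f (n + n)"
proof -
  let ?p = "pmf (walk n)"
  define h where "h x = (\<Sum>z\<in>F. f z * ?p (z \<otimes> inv x))" for x
  have "(walk_form F f n)\<^sup>2 = (\<Sum>x\<in>F. f x * h x)\<^sup>2"
    by (simp add: walk_form_def h_def sum_distrib_left mult.assoc)
  also have "\<dots> \<le> (\<Sum>x\<in>F. (f x)\<^sup>2) * (\<Sum>x\<in>F. (h x)\<^sup>2)" by (rule Cauchy_Schwarz_ineq_sum)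
  also have "(\<Sum>x\<in>F. (h x)\<^sup>2) \<le> walk_form F f (n + n)"
  proof -
    have "(\<Sum>x\<in>F. (h x)\<^sup>2) = (\<Sum>x\<in>F. \<Sum>z\<in>F. \<Sum>y\<in>F. f z * f y * (?p (z \<otimes> inv x) * ?p (y \<otimes> inv x)))"
      by (simp add: h_def power2_eq_square sum_product mult_ac)
    also have "\<dots> = (\<Sum>y\<in>F. \<Sum>z\<in>F. \<Sum>x\<in>F. f z * f y * (?p (z \<otimes> inv x) * ?p (y \<otimes> inv x)))"
      by (subst sum.swap, subst sum.swap[of _ F F, THEN sum.cong[OF refl]], subst sum.swap) (rule refl)
    also have "\<dots> = (\<Sum>y\<in>F. \<Sum>z\<in>F. f y * f z * (\<Sum>x\<in>F. ?p (z \<otimes> inv x) * ?p (y \<otimes> inv x)))"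
      by (simp add: sum_distrib_left mult_ac)
    also have "\<dots> \<le> walk_form F f (n + n)"
      unfolding walk_form_def
    proof (intro sum_mono mult_left_mono mult_nonneg_nonneg f)
      fix y z assume "y \<in> F" "z \<in> F"
      then have yz: "y \<in> carrier G" "z \<in> carrier G" using F by auto
      have "(\<Sum>x\<in>F. ?p (z \<otimes> inv x) * ?p (y \<otimes> inv x)) = (\<Sum>x\<in>F. ?p (z \<otimes> inv x) * ?p (x \<otimes> inv y))"
      proof (intro sum.cong refl)
        fix x assume "x \<in> F"
        then have "x \<in> carrier G" using F by auto
        then show "?p (z \<otimes> inv x) * ?p (y \<otimes> inv x) = ?p (z \<otimes> inv x) * ?p (x \<otimes> inv y)"
          using pmf_walk_inv[of "y \<otimes> inv x" n] yz by (simp add: inv_mult_group)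
      qed
      also have "\<dots> \<le> pmf (convolution G (walk n) (walk n)) (z \<otimes> inv y)"
      proof (rule pmf_convolution_sum_le[OF F(1)])
        show "inj_on (\<lambda>x. z \<otimes> inv x) F"
          using F yz by (intro inj_onI) (metis inv_closed inv_inv l_cancel subsetD)
        show "z \<otimes> inv x \<otimes> (x \<otimes> inv y) = z \<otimes> inv y" if "x \<in> F" for x
          using that F yz by (metis inv_closed inv_solve_left m_assoc m_closed subsetD)
      qed
      finally show "(\<Sum>x\<in>F. ?p (z \<otimes> inv x) * ?p (y \<otimes> inv x)) \<le> pmf (walk (n + n)) (z \<otimes> inv y)"
        by (simp only: walk_add)
    qed
    finally show ?thesis .
  qed
  finally show ?thesis by (simp add: mult_left_mono sum_nonneg)
qed

text \<open>
  The norm of the convolution operator is at most the spectral radius. Iterating the doubling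
  inequality gives \<open>(\<langle>P f, f\<rangle> / \<langle>f, f\<rangle>)\<^sup>N \<le> C \<mu>\<^sup>*\<^sup>N(e)\<close> for all powers \<open>N\<close> of 2, with \<open>C\<close> depending only on
  \<open>f\<close>, and the \<open>N\<close>-th root of \<open>C\<close> tends to 1.
\<close>

lemma walk_form_le_spectral_radius:
  assumes F: "finite F" "F \<subseteq> carrier G" and f: "\<And>x. 0 \<le> f x"
  shows "walk_form F f 1 \<le> \<rho> * (\<Sum>x\<in>F. (f x)\<^sup>2)"
proof -
  define S where "S = (\<Sum>x\<in>F. (f x)\<^sup>2)"
  have nonneg: "0 \<le> walk_form F f n" for n
    unfolding walk_form_def by (intro sum_nonneg mult_nonneg_nonneg f) auto
  have dbl: "(walk_form F f n)\<^sup>2 \<le> S * walk_form F f (n + n)" for n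
    unfolding S_def by (rule walk_form_doubling[OF F f])
  show ?thesis
  proof (cases "S = 0")
    case True
    then show ?thesis using dbl[of 1] unfolding S_def by simp
  next
    case False
    then have S: "0 < S" unfolding S_def by (simp add: sum_nonneg less_le)
    define r where "r = walk_form F f 1 / S"
    define C where "C = (\<Sum>x\<in>F. f x)\<^sup>2 / S"
    have r0: "0 \<le> r" using nonneg S by (simp add: r_def)
    have pow: "r ^ (2 ^ k) \<le> walk_form F f (2 ^ k) / S" for k
    proof (induction k)
      case (Suc k)
      have "r ^ (2 ^ Suc k) = (r ^ (2 ^ k))\<^sup>2" by (simp flip: power_mult add: mult.commute)
      also have "\<dots> \<le> (walk_form F f (2 ^ k) / S)\<^sup>2" using Suc r0 by (intro power_mono) auto
      also have "\<dots> = (walk_form F f (2 ^ k))\<^sup>2 / (S * S)" by (simp add: power_divide power2_eq_square)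
      also have "\<dots> \<le> S * walk_form F f (2 ^ k + 2 ^ k) / (S * S)"
        using S by (intro divide_right_mono dbl) auto
      also have "\<dots> = walk_form F f (2 ^ Suc k) / S" using S by (simp add: mult_2)
      finally show ?case .
    qed (simp add: r_def)
    have form_le: "walk_form F f (n + n) \<le> (\<Sum>x\<in>F. f x)\<^sup>2 * pmf (walk (n + n)) \<one>" for n
    proof -
      have "walk_form F f (n + n) \<le> (\<Sum>x\<in>F. \<Sum>z\<in>F. f x * f z * pmf (walk (n + n)) \<one>)"
        unfolding walk_form_def using F
        by (intro sum_mono mult_left_mono mult_nonneg_nonneg f pmf_walk_even_le) auto
      also have "\<dots> = (\<Sum>x\<in>F. f x)\<^sup>2 * pmf (walk (n + n)) \<one>"
        by (simp add: power2_eq_square sum_product sum_distrib_left sum_distrib_right mult_ac)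
      finally show ?thesis .
    qed
    have key: "r ^ (2 ^ Suc k) \<le> C * pmf (walk (2 ^ Suc k)) \<one>" for k
    proof -
      have "r ^ (2 ^ Suc k) \<le> walk_form F f (2 ^ Suc k) / S" by (rule pow)
      also have "\<dots> \<le> ((\<Sum>x\<in>F. f x)\<^sup>2 * pmf (walk (2 ^ Suc k)) \<one>) / S"
        using form_le[of "2 ^ k"] S by (intro divide_right_mono) (auto simp: mult_2)
      finally show ?thesis by (simp add: C_def)
    qed
    have "r \<le> \<rho>"
    proof (rule dense_ge)
      fix c assume "\<rho> < c"
      then have "limsup (\<lambda>n. ereal (root n (pmf (walk n) \<one>))) < ereal c"
        by (simp add: spectral_radius_limsup)
      then have "\<forall>\<^sub>F n in sequentially. root n (pmf (walk n) \<one>) < c"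
        by (auto dest: Limsup_lessD)
      moreover have N: "filterlim (\<lambda>k. 2 ^ Suc k :: nat) sequentially sequentially"
        by (rule filterlim_subseq) (auto intro!: strict_monoI_Suc)
      ultimately have "\<forall>\<^sub>F k in sequentially. root (2 ^ Suc k) (pmf (walk (2 ^ Suc k)) \<one>) < c"
        by (rule eventually_compose_filterlim)
      then have "\<forall>\<^sub>F k in sequentially. r \<le> root (2 ^ Suc k) (max C 1) * c"
      proof eventually_elim
        case (elim k)
        have "r = root (2 ^ Suc k) (r ^ (2 ^ Suc k))" using r0 by (simp add: real_root_power_cancel)
        also have "\<dots> \<le> root (2 ^ Suc k) (C * pmf (walk (2 ^ Suc k)) \<one>)"
          by (intro real_root_le_mono key) simp
        also have "\<dots> \<le> root (2 ^ Suc k) (max C 1 * pmf (walk (2 ^ Suc k)) \<one>)"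
          by (intro real_root_le_mono mult_right_mono) auto
        also have "\<dots> = root (2 ^ Suc k) (max C 1) * root (2 ^ Suc k) (pmf (walk (2 ^ Suc k)) \<one>)"
          by (rule real_root_mult)
        also have "\<dots> \<le> root (2 ^ Suc k) (max C 1) * c"
          using elim by (intro mult_left_mono) (auto intro: real_root_ge_zero)
        finally show ?case .
      qed
      moreover have "(\<lambda>k. root (2 ^ Suc k) (max C 1) * c) \<longlonglongrightarrow> 1 * c"
        by (intro tendsto_mult tendsto_const filterlim_compose[OF LIMSEQ_root_const N]) auto
      ultimately have "r \<le> 1 * c"
        by (intro tendsto_lowerbound[where F = sequentially]) auto
      then show "r \<le> c" by simp
    qed
    then show ?thesis using S unfolding r_def S_def by (simp add: field_simps)
  qed
qed

text \<open>
  The Hellinger affinity \<open>\<Sum>\<^sub>x sqrt (p(g x) p(x))\<close> of \<open>p\<close> and its translate by \<open>g\<^sup>-\<^sup>1\<close>, as an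
  expectation. It is the discrete counterpart of \<open>\<integral> sqrt D\<^sub>g d\<nu>\<close>.
\<close>

definition pmf_affinity :: "'a pmf \<Rightarrow> 'a \<Rightarrow> real" where
  "pmf_affinity p g = measure_pmf.expectation p (\<lambda>x. sqrt (pmf p (g \<otimes> x) / pmf p x))"

text \<open>
  The mean affinity is the quadratic form of the convolution operator at the unit vector \<open>sqrt p\<close>.
  This vector may have infinite support, so the bound is proved for finite partial sums of the double
  series.
\<close>

lemma pmf_affinity_spectral:
  assumes p: "set_pmf p \<subseteq> carrier G"
  shows "\<And>g. g \<in> set_pmf \<mu> \<Longrightarrow> integrable (measure_pmf p) (\<lambda>x. sqrt (pmf p (g \<otimes> x) / pmf p x))"
    and "integrable (measure_pmf \<mu>) (pmf_affinity p)"
    and "measure_pmf.expectation \<mu> (pmf_affinity p) \<le> \<rho>"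
proof -
  let ?P = "bind_pmf \<mu> (\<lambda>g. map_pmf (Pair g) p)"
  define F where "F w = (case w of (g, x) \<Rightarrow> sqrt (pmf p (g \<otimes> x) / pmf p x))" for w
  have P: "?P = pair_pmf \<mu> p" by (simp add: pair_pmf_def map_pmf_def)
  have weight: "t * sqrt (a / t) = sqrt t * sqrt a" if "0 \<le> t" for a t :: real
  proof -
    have "t * sqrt (a / t) = (t / sqrt t) * sqrt a" by (simp add: real_sqrt_divide)
    then show ?thesis using that by (simp add: real_div_sqrt)
  qed
  have bound: "(\<Sum>w\<in>W. pmf (pair_pmf \<mu> p) w * F w) \<le> \<rho>" if W: "finite W" for W
  proof -
    let ?c = "carrier G"
    define V where "V = W \<inter> ?c \<times> ?c"
    define A where "A = snd ` V \<union> (\<lambda>(g, x). g \<otimes> x) ` V"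
    let ?f = "\<lambda>x. sqrt (pmf p x)"
    have V: "finite V" "V \<subseteq> ?c \<times> ?c" using W by (auto simp: V_def)
    have A: "finite A" "A \<subseteq> ?c" using V by (auto simp: A_def)
    have "(\<Sum>w\<in>W. pmf (pair_pmf \<mu> p) w * F w) = (\<Sum>w\<in>V. pmf (pair_pmf \<mu> p) w * F w)"
      using W p supp unfolding V_def
      by (intro sum.mono_neutral_right) (auto simp: pmf_pair set_pmf_eq subset_iff)
    also have "\<dots> = (\<Sum>(g, x)\<in>V. ?f x * ?f (g \<otimes> x) * pmf \<mu> g)"
      by (intro sum.cong) (auto simp: pmf_pair F_def weight mult.assoc mult.commute[of "pmf \<mu> _"])
    also have "\<dots> = (\<Sum>(g, x)\<in>V. ?f x * ?f (g \<otimes> x) * pmf \<mu> (g \<otimes> x \<otimes> inv x))"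
      using V by (intro sum.cong) (auto simp: m_assoc)
    also have "\<dots> = (\<Sum>(x, z)\<in>(\<lambda>(g, x). (x, g \<otimes> x)) ` V. ?f x * ?f z * pmf \<mu> (z \<otimes> inv x))"
    proof (subst sum.reindex)
      show "inj_on (\<lambda>(g, x). (x, g \<otimes> x)) V"
        using V by (auto simp: inj_on_def subset_iff)
    qed (auto intro!: sum.cong)
    also have "\<dots> \<le> (\<Sum>(x, z)\<in>A \<times> A. ?f x * ?f z * pmf \<mu> (z \<otimes> inv x))"
      using A by (intro sum_mono2) (force simp: A_def)+
    also have "\<dots> = walk_form A ?f 1"
      unfolding walk_form_def walk_1 by (simp add: sum.cartesian_product)
    also have "\<dots> \<le> \<rho> * (\<Sum>x\<in>A. (?f x)\<^sup>2)"
      by (rule walk_form_le_spectral_radius[OF A]) simp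
    also have "\<dots> \<le> \<rho> * 1"
      using A(1) spectral_radius_limsup(2)
      by (intro mult_left_mono) (auto simp flip: measure_measure_pmf_finite)
    finally show ?thesis by simp
  qed
  have nn: "0 \<le> pmf (pair_pmf \<mu> p) w * F w" for w by (auto simp: F_def split: prod.split)
  have smb: "(\<lambda>w. pmf (pair_pmf \<mu> p) w * F w) summable_on UNIV"
    using bound nn by (intro nonneg_bdd_above_summable_on) (auto intro!: bdd_aboveI2)
  then have int: "integrable (measure_pmf ?P) F"
    unfolding P using integrable_pmf_iff_summable[of "pair_pmf \<mu> p" UNIV F] by simp
  have E: "measure_pmf.expectation ?P F \<le> \<rho>"
    unfolding P expectation_eq_infsum[OF subset_UNIV]
    by (rule infsum_le_finite_sums[OF smb]) (use bound in auto)
  note D = integrable_bind_pmfD[OF int]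
  have inner: "measure_pmf.expectation (map_pmf (Pair g) p) F = pmf_affinity p g" for g
    by (simp add: pmf_affinity_def F_def)
  show "integrable (measure_pmf p) (\<lambda>x. sqrt (pmf p (g \<otimes> x) / pmf p x))" if "g \<in> set_pmf \<mu>" for g
    using D(1)[OF that] by (simp add: F_def)
  show "integrable (measure_pmf \<mu>) (pmf_affinity p)"
    using expectation_bind_pmf(2)[OF D] unfolding inner by simp
  show "measure_pmf.expectation \<mu> (pmf_affinity p) \<le> \<rho>"
    using E expectation_bind_pmf(3)[OF D] unfolding inner by simp
qed

end

section \<open>Entropy of the convolution powers\<close>

definition pmf_entropy :: "'a pmf \<Rightarrow> real" where
  "pmf_entropy p = measure_pmf.expectation p (\<lambda>x. - ln (pmf p x))"

context symmetric_walk
begin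

lemma expectation_convolution:
  fixes f :: "'a \<Rightarrow> real"
  assumes "integrable (measure_pmf (convolution G p q)) f"
  shows "\<And>x. x \<in> set_pmf p \<Longrightarrow> integrable (measure_pmf q) (\<lambda>y. f (x \<otimes> y))"
    and "integrable (measure_pmf p) (\<lambda>x. measure_pmf.expectation q (\<lambda>y. f (x \<otimes> y)))"
    and "measure_pmf.expectation (convolution G p q) f =
      measure_pmf.expectation p (\<lambda>x. measure_pmf.expectation q (\<lambda>y. f (x \<otimes> y)))"
proof -
  note D = integrable_bind_pmfD[OF assms[unfolded convolution_eq_bind]]
  show "integrable (measure_pmf q) (\<lambda>y. f (x \<otimes> y))" if "x \<in> set_pmf p" for x
    using D(1)[OF that] by simp
  show "integrable (measure_pmf p) (\<lambda>x. measure_pmf.expectation q (\<lambda>y. f (x \<otimes> y)))"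
    using expectation_bind_pmf(2)[OF D] by simp
  show "measure_pmf.expectation (convolution G p q) f =
      measure_pmf.expectation p (\<lambda>x. measure_pmf.expectation q (\<lambda>y. f (x \<otimes> y)))"
    using expectation_bind_pmf(3)[OF D] by (simp add: convolution_eq_bind)
qed

lemma expectation_convolution_le:
  fixes f a b :: "'a \<Rightarrow> real"
  assumes nonneg: "\<And>z. z \<in> set_pmf (convolution G p q) \<Longrightarrow> 0 \<le> f z"
    and a: "integrable (measure_pmf p) a" "\<And>x. x \<in> set_pmf p \<Longrightarrow> 0 \<le> a x"
    and b: "integrable (measure_pmf q) b" "\<And>y. y \<in> set_pmf q \<Longrightarrow> 0 \<le> b y"
    and le: "\<And>x y. x \<in> set_pmf p \<Longrightarrow> y \<in> set_pmf q \<Longrightarrow> f (x \<otimes> y) \<le> a x + b y"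
  shows "integrable (measure_pmf (convolution G p q)) f"
    and "measure_pmf.expectation (convolution G p q) f \<le> measure_pmf.expectation p a + measure_pmf.expectation q b"
proof -
  let ?A = "measure_pmf.expectation p a" and ?B = "measure_pmf.expectation q b"
  have A0: "0 \<le> ?A" using a(2) by (intro integral_nonneg_AE) (simp add: AE_measure_pmf_iff)
  have B0: "0 \<le> ?B" using b(2) by (intro integral_nonneg_AE) (simp add: AE_measure_pmf_iff)
  have "(\<integral>\<^sup>+z. ennreal (f z) \<partial>convolution G p q) = (\<integral>\<^sup>+x. \<integral>\<^sup>+y. ennreal (f (x \<otimes> y)) \<partial>q \<partial>p)"
    by (simp add: convolution_eq_bind)
  also have "\<dots> \<le> (\<integral>\<^sup>+x. \<integral>\<^sup>+y. ennreal (a x) + ennreal (b y) \<partial>q \<partial>p)"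
  proof (intro nn_integral_mono_AE, simp only: AE_measure_pmf_iff, intro ballI)
    fix x assume x: "x \<in> set_pmf p"
    show "(\<integral>\<^sup>+y. ennreal (f (x \<otimes> y)) \<partial>q) \<le> (\<integral>\<^sup>+y. ennreal (a x) + ennreal (b y) \<partial>q)"
      using a(2)[OF x] b(2) le[OF x]
      by (intro nn_integral_mono_AE) (auto simp: AE_measure_pmf_iff ennreal_leI simp flip: ennreal_plus)
  qed
  also have "\<dots> = (\<integral>\<^sup>+x. ennreal (a x) + (\<integral>\<^sup>+y. ennreal (b y) \<partial>q) \<partial>p)"
    by (subst nn_integral_add) (auto simp: measure_pmf.emeasure_space_1[simplified])
  also have "\<dots> = (\<integral>\<^sup>+x. ennreal (a x) \<partial>p) + (\<integral>\<^sup>+y. ennreal (b y) \<partial>q)"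
    by (subst nn_integral_add) (auto simp: measure_pmf.emeasure_space_1[simplified])
  also have "\<dots> = ennreal ?A + ennreal ?B"
    using a b by (subst (1 2) nn_integral_eq_integral) (auto simp: AE_measure_pmf_iff)
  also have "\<dots> = ennreal (?A + ?B)" using A0 B0 by simp
  finally have "(\<integral>\<^sup>+z. ennreal (f z) \<partial>convolution G p q) \<le> ennreal (?A + ?B)" .
  then show "integrable (measure_pmf (convolution G p q)) f"
    "measure_pmf.expectation (convolution G p q) f \<le> ?A + ?B"
    using nonneg A0 B0 by (auto intro: pmf_integrable_nn_bound[where c = "?A + ?B"])
qed

text \<open>
  Since \<open>(p * q)(x y) \<ge> p(x) q(y)\<close>, the information of a product is at most the sum of the informations
  of the factors.
\<close>

lemma entropy_convolution_le:
  assumes "integrable (measure_pmf p) (\<lambda>x. - ln (pmf p x))" "integrable (measure_pmf q) (\<lambda>x. - ln (pmf q x))"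
  shows "integrable (measure_pmf (convolution G p q)) (\<lambda>x. - ln (pmf (convolution G p q) x))"
    and "pmf_entropy (convolution G p q) \<le> pmf_entropy p + pmf_entropy q"
proof -
  have nonneg: "0 \<le> - ln (pmf r x)" if "x \<in> set_pmf r" for r :: "'a pmf" and x
    using that by (simp add: pmf_le_1 pmf_positive ln_le_zero_iff)
  have le: "- ln (pmf (convolution G p q) (x \<otimes> y)) \<le> - ln (pmf p x) + - ln (pmf q y)"
    if "x \<in> set_pmf p" "y \<in> set_pmf q" for x y
  proof -
    have "0 < pmf p x" "0 < pmf q y" using that by (simp_all add: pmf_positive)
    then have "ln (pmf p x * pmf q y) \<le> ln (pmf (convolution G p q) (x \<otimes> y))"
      using pmf_convolution_ge[of p x q y] by (intro ln_mono) auto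
    then show ?thesis using \<open>0 < pmf p x\<close> \<open>0 < pmf q y\<close> by (simp add: ln_mult)
  qed
  show "integrable (measure_pmf (convolution G p q)) (\<lambda>x. - ln (pmf (convolution G p q) x))"
    "pmf_entropy (convolution G p q) \<le> pmf_entropy p + pmf_entropy q"
    unfolding pmf_entropy_def
    by (rule expectation_convolution_le[OF nonneg assms(1) nonneg assms(2) nonneg le]; assumption)+
qed

lemma pmf_entropy_nonneg: "0 \<le> pmf_entropy p"
  unfolding pmf_entropy_def
  by (intro integral_nonneg_AE) (auto simp: AE_measure_pmf_iff pmf_le_1 pmf_positive ln_le_zero_iff)

lemma integrable_walk_entropy:
  assumes "finite_entropy G \<mu>"
  shows "integrable (measure_pmf (walk n)) (\<lambda>x. - ln (pmf (walk n) x))"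
proof (induction n)
  case 0
  then show ?case by (intro pmf_integrable_bounded[where C = 0]) auto
next
  case (Suc n)
  have "integrable (measure_pmf \<mu>) (\<lambda>x. - ln (pmf \<mu> x))"
    using assms
    by (simp only: finite_entropy_def integrable_pmf_iff_summable[OF supp] mult_minus_right)
  from entropy_convolution_le(1)[OF Suc this] show ?case by simp
qed

lemma asymptotic_entropy_ge:
  assumes "finite_entropy G \<mu>" and "\<And>n. real n * c \<le> pmf_entropy (walk n)"
  shows "c \<le> asymptotic_entropy G \<mu>"
proof -
  have "pmf_entropy (walk (m + n)) \<le> pmf_entropy (walk m) + pmf_entropy (walk n)" for m n
    using entropy_convolution_le(2)[OF integrable_walk_entropy integrable_walk_entropy] assms(1)
    by (simp add: walk_add)
  then obtain l where l: "(\<lambda>n. pmf_entropy (walk n) / real n) \<longlonglongrightarrow> l"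
    using subadditive_ratio[of "\<lambda>n. pmf_entropy (walk n)"] pmf_entropy_nonneg by blast
  have "pmf_entropy (walk n) = - (\<Sum>\<^sub>\<infinity>g\<in>carrier G. pmf (walk n) g * ln (pmf (walk n) g))" for n
    by (simp add: pmf_entropy_def expectation_eq_infsum[OF set_walk] infsum_uminus)
  then have "asymptotic_entropy G \<mu> = lim (\<lambda>n. pmf_entropy (walk n) / real n)"
    by (simp add: asymptotic_entropy_def)
  then have "(\<lambda>n. pmf_entropy (walk n) / real n) \<longlonglongrightarrow> asymptotic_entropy G \<mu>"
    using l limI[OF l] by simp
  moreover have "\<forall>\<^sub>F n in sequentially. c \<le> pmf_entropy (walk n) / real n"
    using eventually_gt_at_top[of 0] by eventually_elim (use assms(2) in \<open>simp add: field_simps\<close>)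
  ultimately show ?thesis by (intro tendsto_lowerbound[where F = sequentially]) auto
qed

section \<open>The walk at a geometric time\<close>

text \<open>
  The law of the walk at an independent geometric time, that is, the Green function of the walk killed
  with probability \<open>t\<close> at each step, normalised to mass 1.
\<close>

definition green :: "real \<Rightarrow> 'a pmf" where
  "green t = bind_pmf (geometric_pmf t) walk"

text \<open>
  Conditioning on whether the walk is killed at once: \<open>\<lambda> = t \<delta>\<^sub>e + (1 - t) \<mu> * \<lambda>\<close>. Apart from
  the support and the mean length of \<open>\<lambda>\<close>, everything that follows comes from this equation.
\<close>

lemma green_unfold:
  assumes "0 < t" "t \<le> 1"
  shows "green t = bind_pmf (bernoulli_pmf t) (\<lambda>b. if b then return_pmf \<one> else convolution G \<mu> (green t))"
proof -
  have "bind_pmf (geometric_pmf t) (\<lambda>n. walk (Suc n)) = convolution G \<mu> (green t)"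
    unfolding walk_Suc unfolding green_def convolution_eq_bind
    by (subst bind_commute_pmf) (simp add: map_bind_pmf)
  then show ?thesis
    using assms unfolding green_def
    by (subst geometric_bind_pmf_unfold)
      (auto simp: bind_assoc_pmf bind_map_pmf bind_return_pmf intro!: bind_pmf_cong)
qed

lemma set_green: "set_pmf (green t) \<subseteq> carrier G"
  using set_walk by (auto simp: green_def)

context
  fixes t :: real
  assumes t: "0 < t" "t < 1"
begin

lemma expectation_green:
  fixes f :: "'a \<Rightarrow> real"
  assumes "integrable (measure_pmf (green t)) f"
  shows "integrable (measure_pmf (convolution G \<mu> (green t))) f"
    and "measure_pmf.expectation (green t) f =
      t * f \<one> + (1 - t) * measure_pmf.expectation (convolution G \<mu> (green t)) f"
proof -
  let ?k = "\<lambda>b. if b then return_pmf \<one> else convolution G \<mu> (green t)"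
  have int: "integrable (measure_pmf (bind_pmf (bernoulli_pmf t) ?k)) f"
    using assms green_unfold t by simp
  have "False \<in> set_pmf (bernoulli_pmf t)" using t by (simp add: set_pmf_bernoulli)
  from integrable_bind_pmfD(1)[OF int this]
  show "integrable (measure_pmf (convolution G \<mu> (green t))) f" by simp
  have "measure_pmf.expectation (green t) f =
      measure_pmf.expectation (bernoulli_pmf t) (\<lambda>b. measure_pmf.expectation (?k b) f)"
    using expectation_bind_pmf(3)[OF integrable_bind_pmfD[OF int]] green_unfold t by simp
  then show "measure_pmf.expectation (green t) f =
      t * f \<one> + (1 - t) * measure_pmf.expectation (convolution G \<mu> (green t)) f"
    using t by simp
qed

lemma green_quasi_invariant:
  "(1 - t) * pmf \<mu> g * pmf (green t) x \<le> pmf (green t) (g \<otimes> x)"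
proof -
  have "pmf (green t) (g \<otimes> x) = t * pmf (return_pmf \<one>) (g \<otimes> x) +
      (1 - t) * pmf (convolution G \<mu> (green t)) (g \<otimes> x)"
    using t by (subst green_unfold) (auto simp: pmf_bind)
  moreover have "(1 - t) * (pmf \<mu> g * pmf (green t) x) \<le> (1 - t) * pmf (convolution G \<mu> (green t)) (g \<otimes> x)"
    using t by (intro mult_left_mono pmf_convolution_ge) auto
  ultimately show ?thesis using t by (simp add: mult.assoc add_increasing)
qed

text \<open>
  Translation by an element of the support changes \<open>\<lambda>\<close> at most by a bounded factor, and the factor stays
  bounded as \<open>t\<close> tends to 0. This uniformity is why a geometric time is better suited than an average
  over the first \<open>n\<close> steps.
\<close>

lemma green_ratio_le:
  assumes "g \<in> set_pmf \<mu>" "x \<in> carrier G"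
  shows "pmf (green t) (g \<otimes> x) \<le> pmf (green t) x / ((1 - t) * pmf \<mu> g)"
    and "pmf (green t) x \<le> pmf (green t) (g \<otimes> x) / ((1 - t) * pmf \<mu> g)"
proof -
  have g: "g \<in> carrier G" "0 < pmf \<mu> g" using assms supp by (auto simp: pmf_positive)
  have "pmf \<mu> (inv g) = pmf \<mu> g" using g sym unfolding symmetric_pmf_def by metis
  moreover have "inv g \<otimes> (g \<otimes> x) = x" using g assms by (simp add: m_assoc[symmetric])
  ultimately show "pmf (green t) (g \<otimes> x) \<le> pmf (green t) x / ((1 - t) * pmf \<mu> g)"
    using green_quasi_invariant[of "inv g" "g \<otimes> x"] g t by (simp add: field_simps)
  show "pmf (green t) x \<le> pmf (green t) (g \<otimes> x) / ((1 - t) * pmf \<mu> g)"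
    using green_quasi_invariant[of g x] g t by (simp add: field_simps)
qed

lemma set_green_shift:
  assumes "g \<in> set_pmf \<mu>" "x \<in> carrier G"
  shows "g \<otimes> x \<in> set_pmf (green t) \<longleftrightarrow> x \<in> set_pmf (green t)"
proof -
  have "pmf (green t) (g \<otimes> x) = 0 \<longleftrightarrow> pmf (green t) x = 0"
    using green_ratio_le[OF assms] pmf_nonneg[of "green t"] by (metis div_0 order_antisym)
  then show ?thesis by (simp add: set_pmf_eq)
qed

text \<open>
  The translate of \<open>\<lambda>\<close> by \<open>g\<^sup>-\<^sup>1\<close> has density \<open>\<lambda>(g x) / \<lambda>(x)\<close> with respect to \<open>\<lambda>\<close>.
\<close>

lemma expectation_green_shift:
  fixes f :: "'a \<Rightarrow> real"
  assumes g: "g \<in> set_pmf \<mu>"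
  shows "measure_pmf.expectation (green t) (\<lambda>x. f (inv g \<otimes> x)) =
      measure_pmf.expectation (green t) (\<lambda>x. pmf (green t) (g \<otimes> x) / pmf (green t) x * f x)"
    and "integrable (measure_pmf (green t)) (\<lambda>x. f (inv g \<otimes> x)) \<longleftrightarrow>
      integrable (measure_pmf (green t)) (\<lambda>x. pmf (green t) (g \<otimes> x) / pmf (green t) x * f x)"
proof -
  have gc: "g \<in> carrier G" using g supp by auto
  let ?q = "map_pmf ((\<otimes>) (inv g)) (green t)"
  have iff: "(inv g \<otimes> y = x) = (y = g \<otimes> x)" if "x \<in> carrier G" "y \<in> carrier G" for x y
    using that gc by (metis inv_closed inv_inv inv_solve_left')
  have q: "pmf ?q x = pmf (green t) (g \<otimes> x)" if "x \<in> carrier G" for x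
  proof -
    have "measure_pmf.prob (green t) ((\<otimes>) (inv g) -` {x}) = measure_pmf.prob (green t) {g \<otimes> x}"
      using iff[OF that] set_green[of t]
      by (intro measure_pmf.finite_measure_eq_AE) (auto simp: AE_measure_pmf_iff subset_iff)
    then show ?thesis by (simp add: pmf_map measure_pmf_single)
  qed
  have sub: "set_pmf ?q \<subseteq> set_pmf (green t)"
  proof
    fix x assume x: "x \<in> set_pmf ?q"
    then have "x \<in> carrier G" using set_green gc by auto
    then show "x \<in> set_pmf (green t)"
      using x q set_green_shift[OF g] by (metis set_pmf_iff)
  qed
  have cong: "pmf ?q x / pmf (green t) x * f x = pmf (green t) (g \<otimes> x) / pmf (green t) x * f x"
    if "x \<in> set_pmf (green t)" for x
    using that set_green q by (metis subsetD)
  show "measure_pmf.expectation (green t) (\<lambda>x. f (inv g \<otimes> x)) =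
      measure_pmf.expectation (green t) (\<lambda>x. pmf (green t) (g \<otimes> x) / pmf (green t) x * f x)"
    using expectation_reweight(2)[OF sub, of f] pmf_expectation_cong[OF cong] by simp
  show "integrable (measure_pmf (green t)) (\<lambda>x. f (inv g \<otimes> x)) \<longleftrightarrow>
      integrable (measure_pmf (green t)) (\<lambda>x. pmf (green t) (g \<otimes> x) / pmf (green t) x * f x)"
    using expectation_reweight(1)[OF sub, of f] pmf_integrable_cong[OF cong] by simp
qed

end

end

section \<open>The drift bounds affinities on the group\<close>

text \<open>
  The comparison of total variation and Hellinger affinity: factor \<open>1 - R\<close> as
  \<open>(1 - sqrt R) (1 + sqrt R)\<close> and apply Cauchy-Schwarz; the two squared norms are \<open>2 - 2 a\<close> and
  \<open>2 + 2 a\<close> for the affinity \<open>a\<close>.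
\<close>

lemma (in prob_space) hellinger:
  fixes R :: "'a \<Rightarrow> real"
  assumes R: "\<And>x. 0 \<le> R x" "integrable M R" "expectation R = 1"
  shows "integrable M (\<lambda>x. sqrt (R x))"
    and "0 \<le> expectation (\<lambda>x. sqrt (R x))"
    and "expectation (\<lambda>x. sqrt (R x)) \<le> 1"
    and "expectation (\<lambda>x. \<bar>1 - R x\<bar>) \<le> 2 * sqrt (1 - (expectation (\<lambda>x. sqrt (R x)))\<^sup>2)"
proof -
  have [measurable]: "R \<in> borel_measurable M" using R(2) by simp
  let ?a = "expectation (\<lambda>x. sqrt (R x))"
  have bound: "sqrt (R x) \<le> 1 + R x" for x
    using R(1)[of x] sum_squares_bound[of 1 "sqrt (R x)"] by simp
  show int: "integrable M (\<lambda>x. sqrt (R x))"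
  proof (rule Bochner_Integration.integrable_bound[of M "\<lambda>x. 1 + R x"])
    have "norm (sqrt (R x)) \<le> norm (1 + R x)" for x using bound[of x] R(1)[of x] by simp
    then show "AE x in M. norm (sqrt (R x)) \<le> norm (1 + R x)" by simp
  qed (use R in auto)
  show a0: "0 \<le> ?a" using R(1) by simp
  have m: "(\<lambda>x. \<bar>1 - sqrt (R x)\<bar>\<^sup>2) = (\<lambda>x. 1 - 2 * sqrt (R x) + R x)"
    "(\<lambda>x. (1 + sqrt (R x))\<^sup>2) = (\<lambda>x. 1 + 2 * sqrt (R x) + R x)"
    using R(1) by (auto simp: fun_eq_iff power2_eq_square algebra_simps)
  have Em: "expectation (\<lambda>x. \<bar>1 - sqrt (R x)\<bar>\<^sup>2) = 2 - 2 * ?a"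
    "expectation (\<lambda>x. (1 + sqrt (R x))\<^sup>2) = 2 + 2 * ?a"
    unfolding m using int R(2,3) by (simp_all add: prob_space)
  show "?a \<le> 1"
  proof -
    have "0 \<le> expectation (\<lambda>x. \<bar>1 - sqrt (R x)\<bar>\<^sup>2)" by simp
    then show ?thesis unfolding Em by simp
  qed
  have "expectation (\<lambda>x. \<bar>1 - R x\<bar>) = expectation (\<lambda>x. \<bar>1 - sqrt (R x)\<bar> * (1 + sqrt (R x)))"
  proof (intro Bochner_Integration.integral_cong refl)
    fix x
    have "1 - R x = (1 - sqrt (R x)) * (1 + sqrt (R x))" using R(1)[of x] by (simp add: algebra_simps)
    then show "\<bar>1 - R x\<bar> = \<bar>1 - sqrt (R x)\<bar> * (1 + sqrt (R x))"
      using R(1)[of x] by (simp add: abs_mult)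
  qed
  also have "\<dots> \<le> sqrt (expectation (\<lambda>x. \<bar>1 - sqrt (R x)\<bar>\<^sup>2)) * sqrt (expectation (\<lambda>x. (1 + sqrt (R x))\<^sup>2))"
    by (rule expectation_Cauchy_Schwarz; (unfold m)?) (use int R(2) in auto)
  also have "\<dots> = sqrt ((2 - 2 * ?a) * (2 + 2 * ?a))"
    unfolding Em by (simp add: real_sqrt_mult)
  also have "(2 - 2 * ?a) * (2 + 2 * ?a) = 2\<^sup>2 * (1 - ?a\<^sup>2)"
    by (simp add: power2_eq_square algebra_simps)
  also have "sqrt (2\<^sup>2 * (1 - ?a\<^sup>2)) = 2 * sqrt (1 - ?a\<^sup>2)" by (subst real_sqrt_mult) simp
  finally show "expectation (\<lambda>x. \<bar>1 - R x\<bar>) \<le> 2 * sqrt (1 - ?a\<^sup>2)" .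
qed

lemma (in symmetric_walk) green_hellinger:
  assumes t: "0 < t" "t < 1" and g: "g \<in> set_pmf \<mu>"
  defines "R \<equiv> \<lambda>x. pmf (green t) (g \<otimes> x) / pmf (green t) x"
  shows "integrable (measure_pmf (green t)) R"
    and "0 \<le> pmf_affinity (green t) g" "pmf_affinity (green t) g \<le> 1"
    and "measure_pmf.expectation (green t) (\<lambda>x. \<bar>1 - R x\<bar>) \<le> 2 * sqrt (1 - (pmf_affinity (green t) g)\<^sup>2)"
proof -
  have R: "\<And>x. 0 \<le> R x" "integrable (measure_pmf (green t)) R" "measure_pmf.expectation (green t) R = 1"
    using expectation_green_shift[OF t g, of "\<lambda>_. 1"] by (auto simp: R_def)
  show "integrable (measure_pmf (green t)) R" by (rule R)
  show "0 \<le> pmf_affinity (green t) g" "pmf_affinity (green t) g \<le> 1"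
    "measure_pmf.expectation (green t) (\<lambda>x. \<bar>1 - R x\<bar>) \<le> 2 * sqrt (1 - (pmf_affinity (green t) g)\<^sup>2)"
    using measure_pmf.hellinger[OF R] unfolding pmf_affinity_def R_def by simp_all
qed

locale metric_walk = symmetric_walk G \<mu> for G (structure) and \<mu> +
  fixes d :: "'a \<Rightarrow> 'a \<Rightarrow> real"
  assumes metric: "Metric_space (carrier G) d"
    and left_inv: "left_invariant_distance G d"
    and second_moment: "finite_second_moment G d \<mu>"
begin

abbreviation len :: "'a \<Rightarrow> real" where "len g \<equiv> d g \<one>"

lemma len_nonneg: "0 \<le> len g"
  by (rule Metric_space.nonneg[OF metric])

lemma len_mult_le:
  assumes "g \<in> carrier G" "x \<in> carrier G" shows "len (g \<otimes> x) \<le> len g + len x"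
proof -
  have "len (g \<otimes> x) \<le> d (g \<otimes> x) (g \<otimes> \<one>) + d (g \<otimes> \<one>) \<one>"
    using Metric_space.triangle[OF metric] assms by simp
  also have "\<dots> = len x + len g"
  proof -
    have "d (g \<otimes> x) (g \<otimes> \<one>) = d x \<one>"
      using left_inv assms unfolding left_invariant_distance_def by blast
    then show ?thesis using assms by simp
  qed
  finally show ?thesis by simp
qed

lemma len_inv:
  assumes "g \<in> carrier G" shows "len (inv g) = len g"
proof -
  have "d (g \<otimes> inv g) (g \<otimes> \<one>) = d (inv g) \<one>"
    using left_inv assms unfolding left_invariant_distance_def by blast
  then show ?thesis using assms Metric_space.commute[OF metric] by simp
qed

lemma len_shift_le:
  assumes "g \<in> carrier G" "x \<in> carrier G" shows "\<bar>len (g \<otimes> x) - len x\<bar> \<le> len g"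
proof -
  have "inv g \<otimes> (g \<otimes> x) = x" using assms by (simp add: m_assoc[symmetric])
  then have "len x \<le> len g + len (g \<otimes> x)"
    using len_mult_le[of "inv g" "g \<otimes> x"] assms len_inv by simp
  then show ?thesis using len_mult_le[OF assms] by simp
qed

lemma integrable_len2: "integrable (measure_pmf \<mu>) (\<lambda>g. (len g)\<^sup>2)"
  using second_moment unfolding finite_second_moment_def integrable_pmf_iff_summable[OF supp]
  by (simp add: mult.commute)

lemma M2_eq: "M2 G d \<mu> = sqrt (measure_pmf.expectation \<mu> (\<lambda>g. (len g)\<^sup>2))"
  unfolding M2_def expectation_eq_infsum[OF supp] by (simp add: mult.commute)

lemma integrable_len: "integrable (measure_pmf \<mu>) len"
proof (rule pmf_integrable_mono)
  show "integrable (measure_pmf \<mu>) (\<lambda>g. 1 + (len g)\<^sup>2)" using integrable_len2 by simp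
  show "\<bar>len g\<bar> \<le> 1 + (len g)\<^sup>2" for g
    using sum_squares_bound[of 1 "len g"] len_nonneg[of g] by simp
qed

lemma integrable_walk_len: "integrable (measure_pmf (walk n)) len"
proof (induction n)
  case 0
  then show ?case by (intro pmf_integrable_bounded[where C = "len \<one>"]) (simp add: len_nonneg)
next
  case (Suc n)
  have "integrable (measure_pmf (convolution G (walk n) \<mu>)) len"
    using set_walk supp
    by (intro expectation_convolution_le(1)[OF _ Suc _ integrable_len] len_nonneg len_mult_le) blast+
  then show ?case by simp
qed

definition mean_len :: "nat \<Rightarrow> real" where
  "mean_len n = measure_pmf.expectation (walk n) len"

lemma mean_len_nonneg: "0 \<le> mean_len n"
  unfolding mean_len_def using len_nonneg by simp

lemma mean_len_subadditive: "mean_len (m + n) \<le> mean_len m + mean_len n"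
  unfolding mean_len_def walk_add using set_walk
  by (intro expectation_convolution_le(2)[OF _ integrable_walk_len _ integrable_walk_len]
      len_nonneg len_mult_le) blast+

lemma drift_bounds: shows "drift G d \<mu> * real n \<le> mean_len n" and "0 \<le> drift G d \<mu>"
proof -
  obtain l where l: "(\<lambda>n. mean_len n / real n) \<longlonglongrightarrow> l" "\<And>n. l * real n \<le> mean_len n"
    using subadditive_ratio[OF mean_len_nonneg mean_len_subadditive] by blast
  have "drift G d \<mu> = lim (\<lambda>n. mean_len n / real n)"
    by (simp add: drift_def mean_len_def expectation_eq_infsum[OF set_walk] mult.commute)
  also have "\<dots> = l" by (rule limI[OF l(1)])
  finally have eq: "drift G d \<mu> = l" .
  show "drift G d \<mu> * real n \<le> mean_len n" unfolding eq by (rule l(2))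
  show "0 \<le> drift G d \<mu>" unfolding eq
    by (rule LIMSEQ_le_const[OF l(1)]) (use mean_len_nonneg in auto)
qed

context
  fixes t :: real
  assumes t: "0 < t" "t < 1"
begin

lemma green_len:
  shows "integrable (measure_pmf (green t)) len"
    and "drift G d \<mu> * ((1 - t) / t) \<le> measure_pmf.expectation (green t) len"
proof -
  have linear: "mean_len n \<le> real n * mean_len 1" for n
  proof (induction n)
    case 0
    have "mean_len 0 = len \<one>" by (simp add: mean_len_def)
    then show ?case using Metric_space.zero[OF metric one_closed one_closed] by simp
  next
    case (Suc n)
    then show ?case using mean_len_subadditive[of n 1] by (simp add: algebra_simps)
  qed
  have geo: "integrable (measure_pmf (geometric_pmf t)) real"
    using t by (intro integrable_real_geometric_pmf) auto
  have int: "integrable (measure_pmf (geometric_pmf t)) mean_len"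
    by (rule pmf_integrable_mono[where g = "\<lambda>n. real n * mean_len 1"])
      (use geo linear mean_len_nonneg in auto)
  have B: "integrable (measure_pmf (bind_pmf (geometric_pmf t) walk)) len"
    "measure_pmf.expectation (bind_pmf (geometric_pmf t) walk) len = measure_pmf.expectation (geometric_pmf t) mean_len"
    using expectation_bind_pmf_nonneg[of len "geometric_pmf t" walk] len_nonneg integrable_walk_len
      int[unfolded mean_len_def] by (simp_all add: mean_len_def[abs_def])
  show "integrable (measure_pmf (green t)) len" using B(1) by (simp add: green_def)
  have "drift G d \<mu> * ((1 - t) / t) = measure_pmf.expectation (geometric_pmf t) (\<lambda>n. drift G d \<mu> * real n)"
    using t by (simp add: expectation_geometric_pmf)
  also have "\<dots> \<le> measure_pmf.expectation (geometric_pmf t) mean_len"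
    by (intro pmf_expectation_mono int) (use geo drift_bounds in auto)
  finally show "drift G d \<mu> * ((1 - t) / t) \<le> measure_pmf.expectation (green t) len"
    using B(2) by (simp add: green_def)
qed

text \<open>
  By the equation for \<open>\<lambda>\<close>, the mean increment of the length at a \<open>\<lambda>\<close>-distributed point is \<open>t / (1 - t)\<close>
  times the mean length under \<open>\<lambda>\<close>. The mean length after \<open>n\<close> steps is at least \<open>n\<close> times the drift, and a
  geometric time has mean \<open>(1 - t) / t\<close>.
\<close>

lemma drift_le_mean_displacement:
  defines "b \<equiv> \<lambda>g. measure_pmf.expectation (green t) (\<lambda>x. len (g \<otimes> x) - len x)"
  shows "integrable (measure_pmf \<mu>) b" and "drift G d \<mu> \<le> measure_pmf.expectation \<mu> b"
proof -
  let ?L = "measure_pmf.expectation (green t) len"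
  note conv = expectation_green[OF t green_len(1)]
  note E = expectation_convolution[OF conv(1)]
  have b: "b g = measure_pmf.expectation (green t) (\<lambda>x. len (g \<otimes> x)) - ?L" if "g \<in> set_pmf \<mu>" for g
    using E(1)[OF that] green_len(1) by (simp add: b_def)
  show "integrable (measure_pmf \<mu>) b"
    using E(2) by (subst pmf_integrable_cong[OF b]) auto
  let ?X = "measure_pmf.expectation (convolution G \<mu> (green t)) len"
  have "measure_pmf.expectation \<mu> b = ?X - ?L"
    using E(2) by (subst pmf_expectation_cong[OF b]) (auto simp: E(3))
  also have L: "?L = (1 - t) * ?X"
    using conv(2) Metric_space.zero[OF metric one_closed one_closed] by simp
  finally have "measure_pmf.expectation \<mu> b = t * ?X" by (simp add: algebra_simps)
  then have "?L * t = measure_pmf.expectation \<mu> b * (1 - t)"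
    by (simp only: L mult_ac)
  moreover have "drift G d \<mu> * (1 - t) \<le> ?L * t"
    using green_len(2) t by (simp add: field_simps)
  ultimately show "drift G d \<mu> \<le> measure_pmf.expectation \<mu> b"
    using t by simp
qed

text \<open>
  The increment \<open>c(g, x) = \<bar>g x\<bar> - \<bar>x\<bar>\<close> satisfies \<open>c(g\<^sup>-\<^sup>1, x) = - c(g, g\<^sup>-\<^sup>1 x)\<close>. After a change of
  variables, the increments of \<open>g\<close> and \<open>g\<^sup>-\<^sup>1\<close> together see only the difference of \<open>\<lambda>\<close> and its
  translate, while \<open>\<bar>c\<bar> \<le> \<bar>g\<bar>\<close>.
\<close>

lemma displacement_le:
  assumes g: "g \<in> set_pmf \<mu>"
  defines "b \<equiv> \<lambda>g. measure_pmf.expectation (green t) (\<lambda>x. len (g \<otimes> x) - len x)"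
  shows "b g + b (inv g) \<le> 2 * (len g * sqrt (1 - (pmf_affinity (green t) g)\<^sup>2))"
proof -
  have gc: "g \<in> carrier G" using g supp by auto
  define R where "R x = pmf (green t) (g \<otimes> x) / pmf (green t) x" for x
  define c where "c x = len (g \<otimes> x) - len x" for x
  note h = green_hellinger[OF t g, folded R_def]
  have carr: "x \<in> carrier G" if "x \<in> set_pmf (green t)" for x using that set_green by auto
  have c: "\<bar>c x\<bar> \<le> len g" if "x \<in> set_pmf (green t)" for x
    unfolding c_def by (rule len_shift_le[OF gc carr[OF that]])
  have R0: "0 \<le> R x" for x by (simp add: R_def)
  have int: "integrable (measure_pmf (green t)) c" "integrable (measure_pmf (green t)) (\<lambda>x. R x * c x)"
  proof -
    show "integrable (measure_pmf (green t)) c" using c by (rule pmf_integrable_bounded)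
    show "integrable (measure_pmf (green t)) (\<lambda>x. R x * c x)"
      by (rule pmf_integrable_mono[where g = "\<lambda>x. R x * len g"])
        (use h(1) c R0 in \<open>auto simp: abs_mult mult_left_mono\<close>)
  qed
  have "b (inv g) = measure_pmf.expectation (green t) (\<lambda>x. - c (inv g \<otimes> x))"
    unfolding b_def
  proof (rule pmf_expectation_cong)
    fix x assume "x \<in> set_pmf (green t)"
    then have "g \<otimes> (inv g \<otimes> x) = x" using gc carr by (simp add: m_assoc[symmetric])
    then show "len (inv g \<otimes> x) - len x = - c (inv g \<otimes> x)" by (simp add: c_def)
  qed
  also have "\<dots> = - measure_pmf.expectation (green t) (\<lambda>x. R x * c x)"
    using expectation_green_shift(1)[OF t g, of c] by (simp add: R_def)
  finally have "b g + b (inv g) = measure_pmf.expectation (green t) (\<lambda>x. c x - R x * c x)"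
    using int by (simp add: b_def c_def[abs_def])
  also have "\<dots> \<le> measure_pmf.expectation (green t) (\<lambda>x. len g * \<bar>1 - R x\<bar>)"
  proof (rule pmf_expectation_mono)
    fix x assume x: "x \<in> set_pmf (green t)"
    have "c x - R x * c x \<le> \<bar>c x\<bar> * \<bar>1 - R x\<bar>"
      unfolding abs_mult[symmetric] by (simp add: algebra_simps)
    also have "\<dots> \<le> len g * \<bar>1 - R x\<bar>" using c[OF x] by (intro mult_right_mono) auto
    finally show "c x - R x * c x \<le> len g * \<bar>1 - R x\<bar>" .
  qed (use int h(1) in auto)
  also have "\<dots> \<le> len g * (2 * sqrt (1 - (pmf_affinity (green t) g)\<^sup>2))"
    using h(4) len_nonneg by (simp add: mult_left_mono)
  finally show ?thesis by simp
qed

text \<open>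
  Cauchy-Schwarz over \<open>\<mu>\<close> separates \<open>\<bar>g\<bar>\<close>, which contributes \<open>M\<^sub>2\<close>, from \<open>sqrt (1 - a(g)\<^sup>2)\<close>; the mean of
  \<open>a(g)\<^sup>2\<close> is at least the square of the mean of \<open>a(g)\<close>.
\<close>

lemma affinity_le_drift:
  "measure_pmf.expectation \<mu> (pmf_affinity (green t)) \<le> sqrt (1 - (drift G d \<mu> / M2 G d \<mu>)\<^sup>2)"
proof -
  let ?a = "pmf_affinity (green t)" and ?l = "drift G d \<mu>" and ?M = "M2 G d \<mu>"
  let ?A = "measure_pmf.expectation \<mu> ?a"
  define b where "b g = measure_pmf.expectation (green t) (\<lambda>x. len (g \<otimes> x) - len x)" for g
  note drift_b = drift_le_mean_displacement[folded b_def[abs_def]]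
  note a = green_hellinger(2,3)[OF t]
  have a_int: "integrable (measure_pmf \<mu>) ?a"
    using a by (intro pmf_integrable_bounded[where C = 1]) auto
  have a2_int: "integrable (measure_pmf \<mu>) (\<lambda>g. (?a g)\<^sup>2)"
    using a by (intro pmf_integrable_bounded[where C = 1]) (auto simp: power_le_one)
  have s2: "(sqrt (1 - (?a g)\<^sup>2))\<^sup>2 = 1 - (?a g)\<^sup>2" if "g \<in> set_pmf \<mu>" for g
    using a[OF that] by (simp add: power_le_one)
  have s2_int: "integrable (measure_pmf \<mu>) (\<lambda>g. (sqrt (1 - (?a g)\<^sup>2))\<^sup>2)"
    using a2_int by (subst pmf_integrable_cong[OF s2]) auto
  note CS = expectation_Cauchy_Schwarz[OF integrable_len2 s2_int]
  have "?A\<^sup>2 \<le> measure_pmf.expectation \<mu> (\<lambda>g. (?a g)\<^sup>2)"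
    using measure_pmf.variance_positive[of \<mu> ?a] measure_pmf.variance_eq[OF a_int a2_int] by simp
  moreover have "measure_pmf.expectation \<mu> (\<lambda>g. (sqrt (1 - (?a g)\<^sup>2))\<^sup>2) =
      1 - measure_pmf.expectation \<mu> (\<lambda>g. (?a g)\<^sup>2)"
    using a2_int by (subst pmf_expectation_cong[OF s2]) auto
  ultimately have E: "measure_pmf.expectation \<mu> (\<lambda>g. (sqrt (1 - (?a g)\<^sup>2))\<^sup>2) \<le> 1 - ?A\<^sup>2" by simp
  have "2 * ?l \<le> measure_pmf.expectation \<mu> b + measure_pmf.expectation \<mu> (\<lambda>g. b (inv g))"
    using drift_b(2) expectation_inv(1)[of b] by simp
  also have "\<dots> = measure_pmf.expectation \<mu> (\<lambda>g. b g + b (inv g))"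
    using drift_b(1) expectation_inv(2)[of b] by simp
  also have "\<dots> \<le> measure_pmf.expectation \<mu> (\<lambda>g. 2 * (len g * sqrt (1 - (?a g)\<^sup>2)))"
    using drift_b(1) expectation_inv(2)[of b] CS(1) displacement_le[folded b_def]
    by (intro pmf_expectation_mono) auto
  also have "\<dots> \<le> 2 * (?M * sqrt (measure_pmf.expectation \<mu> (\<lambda>g. (sqrt (1 - (?a g)\<^sup>2))\<^sup>2)))"
    using CS(2) by (simp add: M2_eq)
  also have "\<dots> \<le> 2 * (?M * sqrt (1 - ?A\<^sup>2))"
    using E by (intro mult_left_mono real_sqrt_le_mono) (auto simp: M2_eq)
  finally have le: "?l \<le> ?M * sqrt (1 - ?A\<^sup>2)" by simp
  have "?A\<^sup>2 \<le> 1 - (?l / ?M)\<^sup>2"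
  proof -
    have M0: "0 \<le> ?M" by (simp add: M2_eq)
    have A1: "?A\<^sup>2 \<le> 1"
      using E by (smt (verit) Bochner_Integration.integral_nonneg zero_le_power2)
    have "(?l / ?M)\<^sup>2 \<le> (sqrt (1 - ?A\<^sup>2))\<^sup>2"
    proof (intro power_mono)
      show "?l / ?M \<le> sqrt (1 - ?A\<^sup>2)"
        using le M0 A1 by (cases "?M = 0") (auto simp: field_simps)
    qed (use drift_bounds(2) M0 in auto)
    then show ?thesis using A1 by simp
  qed
  then show ?thesis by (rule real_le_rsqrt)
qed

end

end

section \<open>Translates of the boundary measure\<close>

lemma AE_le_if_integrals_le:
  fixes f g :: "'b \<Rightarrow> ennreal"
  assumes [measurable]: "f \<in> borel_measurable M" "g \<in> borel_measurable M"
    and fin: "(\<integral>\<^sup>+x. g x \<partial>M) \<noteq> \<infinity>"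
    and le: "\<And>A. A \<in> sets M \<Longrightarrow> (\<integral>\<^sup>+x. f x * indicator A x \<partial>M) \<le> (\<integral>\<^sup>+x. g x * indicator A x \<partial>M)"
  shows "AE x in M. f x \<le> g x"
proof -
  \<comment> \<open>On this set the hypothesis reverses the strict inequality of the integrands, so it must be null.\<close>
  define A where "A = {x \<in> space M. g x < f x}"
  have [measurable]: "A \<in> sets M" by (simp add: A_def)
  have "(\<integral>\<^sup>+x. g x * indicator A x \<partial>M) \<le> (\<integral>\<^sup>+x. g x \<partial>M)"
    by (intro nn_integral_mono) (auto simp: indicator_def)
  then have finA: "(\<integral>\<^sup>+x. g x * indicator A x \<partial>M) \<noteq> \<infinity>" using fin by (auto simp: top_unique)
  have "(\<integral>\<^sup>+x. f x * indicator A x - g x * indicator A x \<partial>M) =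
      (\<integral>\<^sup>+x. f x * indicator A x \<partial>M) - (\<integral>\<^sup>+x. g x * indicator A x \<partial>M)"
    using finA by (intro nn_integral_diff) (auto simp: A_def indicator_def intro!: AE_I2 less_imp_le)
  also have "\<dots> = 0" using le[of A] finA
    by (intro diff_eq_0_ennreal) (auto simp: less_top[symmetric] top_unique)
  finally have "AE x in M. f x * indicator A x - g x * indicator A x = 0"
    by (subst (asm) nn_integral_0_iff_AE) auto
  with AE_space show ?thesis
  proof (eventually_elim)
    case (elim x)
    show ?case
    proof (cases "x \<in> A")
      case True
      then have "f x - g x = 0" using elim(2) by simp
      then show ?thesis by (auto simp: diff_eq_0_iff_ennreal)
    next
      case False
      then show ?thesis using elim(1) by (simp add: A_def not_less)
    qed
  qed
qed

locale boundary_walk = symmetric_walk G \<mu> for G (structure) and \<mu> +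
  fixes B :: "'p measure" and T :: "'a \<Rightarrow> 'p \<Rightarrow> 'p"
  assumes countable_carrier: "countable (carrier G)"
    and generating: "generate G (set_pmf \<mu>) = carrier G"
    and boundary: "poisson_boundary G \<mu> B T"
begin

abbreviation P :: "('p \<Rightarrow> real) \<Rightarrow> 'a \<Rightarrow> real" where "P \<equiv> poisson_transform B T"

lemma stationary: "stationary_space G \<mu> B T"
  using boundary by (simp add: poisson_boundary_def)

sublocale prob_space B
  using stationary by (simp add: stationary_space_def)

sublocale action: group_action G "space B" T
  using stationary by (simp add: stationary_space_def)

lemma measurable_action: "g \<in> carrier G \<Longrightarrow> T g \<in> B \<rightarrow>\<^sub>M B"
  using stationary by (simp add: stationary_space_def)

lemma action_one: "\<xi> \<in> space B \<Longrightarrow> T \<one> \<xi> = \<xi>"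
  by (metis action.id_eq_one restrict_apply')

lemma action_mult:
  assumes "g \<in> carrier G" "h \<in> carrier G" "\<xi> \<in> space B"
  shows "T g (T h \<xi>) = T (g \<otimes> h) \<xi>"
  using action.composition_rule[OF assms(3,1,2)] by simp

lemma action_inv:
  assumes "g \<in> carrier G" "\<xi> \<in> space B"
  shows "T (inv g) (T g \<xi>) = \<xi>" "T g (T (inv g) \<xi>) = \<xi>"
  using assms by (simp_all add: action_mult action_one)

lemma bounded_harmonicD:
  assumes "u \<in> bounded_harmonic G \<mu>"
  obtains C where "\<And>g. g \<in> carrier G \<Longrightarrow> \<bar>u g\<bar> \<le> C"
proof -
  have "bounded (u ` carrier G)" using assms by (simp only: bounded_harmonic_def mem_Collect_eq)
  then show thesis using that unfolding bounded_iff by auto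
qed

lemma harmonic_step:
  assumes "u \<in> bounded_harmonic G \<mu>" "g \<in> carrier G"
  shows "u g = measure_pmf.expectation \<mu> (\<lambda>s. u (g \<otimes> s))"
  using assms by (simp add: bounded_harmonic_def expectation_eq_infsum[OF supp])

lemma harmonic_walk:
  assumes u: "u \<in> bounded_harmonic G \<mu>" and g: "g \<in> carrier G"
  shows "integrable (measure_pmf (walk n)) (\<lambda>s. u (g \<otimes> s))"
    and "u g = measure_pmf.expectation (walk n) (\<lambda>s. u (g \<otimes> s))"
proof -
  obtain C where C: "\<And>g. g \<in> carrier G \<Longrightarrow> \<bar>u g\<bar> \<le> C" using bounded_harmonicD[OF u] by blast
  show int: "integrable (measure_pmf (walk n)) (\<lambda>s. u (g \<otimes> s))" for n
    by (intro pmf_integrable_bounded[where C = C] C m_closed g) (rule subsetD[OF set_walk])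
  show "u g = measure_pmf.expectation (walk n) (\<lambda>s. u (g \<otimes> s))"
  proof (induction n)
    case 0
    then show ?case using g by simp
  next
    case (Suc n)
    have "measure_pmf.expectation (walk (Suc n)) (\<lambda>s. u (g \<otimes> s)) =
        measure_pmf.expectation (walk n) (\<lambda>x. measure_pmf.expectation \<mu> (\<lambda>s. u (g \<otimes> (x \<otimes> s))))"
      using expectation_convolution(3)[OF int[of "Suc n", simplified]] by simp
    also have "\<dots> = measure_pmf.expectation (walk n) (\<lambda>x. u (g \<otimes> x))"
    proof (rule pmf_expectation_cong)
      fix x assume "x \<in> set_pmf (walk n)"
      then have x: "x \<in> carrier G" using set_walk by auto
      have "measure_pmf.expectation \<mu> (\<lambda>s. u (g \<otimes> (x \<otimes> s))) =
          measure_pmf.expectation \<mu> (\<lambda>s. u ((g \<otimes> x) \<otimes> s))"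
        using supp g x by (intro pmf_expectation_cong) (metis m_assoc subsetD)
      also have "\<dots> = u (g \<otimes> x)" using harmonic_step[OF u, of "g \<otimes> x"] g x by simp
      finally show "measure_pmf.expectation \<mu> (\<lambda>s. u (g \<otimes> (x \<otimes> s))) = u (g \<otimes> x)" .
    qed
    finally show ?case using Suc by simp
  qed
qed

lemma poisson_transform_harmonic: "f \<in> Linfty B \<Longrightarrow> P f \<in> bounded_harmonic G \<mu>"
  using boundary by (simp add: poisson_boundary_def)

lemma walk_reaches:
  assumes "g \<in> carrier G"
  obtains n where "g \<in> set_pmf (walk n)"
proof -
  have inv_walk: "inv x \<in> set_pmf (walk n)" if "x \<in> set_pmf (walk n)" for x n
    using that set_walk pmf_walk_inv by (metis set_pmf_iff subsetD)
  have "g \<in> generate G (set_pmf \<mu>)" using assms generating by simp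
  then have "\<exists>n. g \<in> set_pmf (walk n)"
  proof induction
    case one
    have "\<one> \<in> set_pmf (walk 0)" by simp
    then show ?case by blast
  next
    case (incl h)
    then show ?case using walk_1 by metis
  next
    case (inv h)
    then show ?case using walk_1 inv_walk by metis
  next
    case (eng x y)
    then obtain m n where "x \<in> set_pmf (walk m)" "y \<in> set_pmf (walk n)" by auto
    then have "x \<otimes> y \<in> set_pmf (walk (m + n))" by (auto simp: walk_add convolution_eq_bind)
    then show ?case by blast
  qed
  then show thesis using that by blast
qed

text \<open>
  The transform of the indicator of \<open>A\<close> is \<open>g \<mapsto> \<nu>(g\<^sup>-\<^sup>1 A)\<close>. It is harmonic and nonnegative, so its
  value at the identity dominates each of the terms \<open>\<mu>\<^sup>*\<^sup>n(g) \<nu>(g\<^sup>-\<^sup>1 A)\<close>.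
\<close>

lemma measure_preimage_le:
  assumes A: "A \<in> sets B"
  shows "pmf (walk n) g * prob (T g -` A \<inter> space B) \<le> prob A"
proof (cases "g \<in> set_pmf (walk n)")
  case False
  then show ?thesis by (simp add: set_pmf_iff)
next
  case True
  define u where "u = P (indicator A)"
  have u: "u h = prob (T h -` A \<inter> space B)" if "h \<in> carrier G" for h
  proof -
    have "u h = (\<integral>\<xi>. indicator (T h -` A \<inter> space B) \<xi> \<partial>B)"
      unfolding u_def poisson_transform_def
      by (intro Bochner_Integration.integral_cong) (auto simp: indicator_def)
    then show ?thesis using measurable_sets[OF measurable_action[OF that] A] by simp
  qed
  have "indicator A \<in> Linfty B"
    using A unfolding Linfty_def by (auto intro!: exI[of _ 1] simp: indicator_def)
  then have harm: "u \<in> bounded_harmonic G \<mu>" unfolding u_def by (rule poisson_transform_harmonic)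
  have "pmf (walk n) g * prob (T g -` A \<inter> space B) = measure_pmf.expectation (walk n) (\<lambda>s. indicator {g} s * u s)"
    using True set_walk[of n] u
    by (subst integral_measure_pmf_real[where A = "{g}"]) (auto simp: indicator_def)
  also have "\<dots> \<le> measure_pmf.expectation (walk n) (\<lambda>s. u (\<one> \<otimes> s))"
    using harmonic_walk(1)[OF harm one_closed, of n] set_walk[of n] u
    by (intro pmf_expectation_mono pmf_integrable_bounded[where C = 1]) (auto simp: indicator_def subset_iff)
  also have "\<dots> = u \<one>" using harmonic_walk(2)[OF harm one_closed, of n] by simp
  also have "\<dots> = prob A"
  proof -
    have "T \<one> -` A \<inter> space B = A" using action_one sets.sets_into_space[OF A] by auto
    then show ?thesis using u[OF one_closed] by simp
  qed
  finally show ?thesis .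
qed

definition D :: "'a \<Rightarrow> 'p \<Rightarrow> real" where
  "D g \<xi> = enn2real (RN_deriv B (distr B B (T (inv g))) \<xi>)"

lemma D_measurable [measurable]: "D g \<in> borel_measurable B"
  unfolding D_def by measurable

lemma D_nonneg: "0 \<le> D g \<xi>"
  by (simp add: D_def)

context
  fixes g assumes g: "g \<in> carrier G"
begin

lemma action_measurable [measurable]: "T g \<in> B \<rightarrow>\<^sub>M B" "T (inv g) \<in> B \<rightarrow>\<^sub>M B"
  using g by (auto intro: measurable_action)

lemma translate_bounds:
  assumes A: "A \<in> sets B"
  shows "prob (T (inv g) -` A \<inter> space B) * pmf (walk n) g \<le> prob A"
    and "pmf (walk n) g * prob A \<le> prob (T (inv g) -` A \<inter> space B)"
proof -
  show "prob (T (inv g) -` A \<inter> space B) * pmf (walk n) g \<le> prob A"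
    using measure_preimage_le[OF A, of n "inv g"] pmf_walk_inv[OF g, of n] by (simp add: mult.commute)
  have "T g -` (T (inv g) -` A \<inter> space B) \<inter> space B = A"
    using sets.sets_into_space[OF A] action_inv[OF g] measurable_space[OF action_measurable(1)] by auto
  then show "pmf (walk n) g * prob A \<le> prob (T (inv g) -` A \<inter> space B)"
    using measure_preimage_le[of "T (inv g) -` A \<inter> space B" n g] A by simp
qed

lemma translate_ac: "absolutely_continuous B (distr B B (T (inv g)))"
proof -
  obtain n where n: "g \<in> set_pmf (walk n)" using walk_reaches[OF g] .
  show ?thesis unfolding absolutely_continuous_def
  proof
    fix A assume A: "A \<in> null_sets B"
    then have As: "A \<in> sets B" "prob A = 0" by (auto simp: null_sets_def measure_def)
    have "prob (T (inv g) -` A \<inter> space B) = 0"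
      using translate_bounds(1)[OF As(1), of n] As(2) pmf_positive[OF n]
      by (smt (verit, best) measure_nonneg mult_pos_pos)
    then show "A \<in> null_sets (distr B B (T (inv g)))"
      using As(1) by (auto simp: null_sets_def emeasure_distr emeasure_eq_measure)
  qed
qed

lemma AE_translate:
  assumes "AE \<xi> in B. Q \<xi>" shows "AE \<xi> in B. Q (T (inv g) \<xi>)"
proof -
  have "AE \<xi> in distr B B (T (inv g)). Q \<xi>"
    using absolutely_continuous_AE[OF _ translate_ac assms] by simp
  then show ?thesis by (rule AE_distrD[OF action_measurable(2)])
qed

lemma RN_deriv_eq_D: "AE \<xi> in B. RN_deriv B (distr B B (T (inv g))) \<xi> = ennreal (D g \<xi>)"
proof -
  interpret N: prob_space "distr B B (T (inv g))" by (rule prob_space_distr) simp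
  have "AE \<xi> in B. RN_deriv B (distr B B (T (inv g))) \<xi> \<noteq> \<infinity>"
    by (rule RN_deriv_finite[OF _ translate_ac]) (auto intro: N.sigma_finite_measure)
  then show ?thesis by eventually_elim (simp add: D_def less_top)
qed

lemma density_D: "density B (\<lambda>\<xi>. ennreal (D g \<xi>)) = distr B B (T (inv g))"
proof -
  have "density B (RN_deriv B (distr B B (T (inv g)))) = distr B B (T (inv g))"
    by (rule density_RN_deriv[OF translate_ac]) simp
  moreover have "density B (RN_deriv B (distr B B (T (inv g)))) = density B (\<lambda>\<xi>. ennreal (D g \<xi>))"
    using RN_deriv_eq_D by (intro density_cong) auto
  ultimately show ?thesis by simp
qed

lemma nn_integral_D:
  assumes [measurable]: "f \<in> borel_measurable B"
  shows "(\<integral>\<^sup>+\<xi>. ennreal (D g \<xi>) * f \<xi> \<partial>B) = (\<integral>\<^sup>+\<xi>. f (T (inv g) \<xi>) \<partial>B)"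
  using nn_integral_density[of "\<lambda>\<xi>. ennreal (D g \<xi>)" B f] unfolding density_D
  by (simp add: nn_integral_distr)

lemma integral_D:
  fixes f :: "'p \<Rightarrow> real"
  assumes [measurable]: "f \<in> borel_measurable B"
  shows "(\<integral>\<xi>. D g \<xi> * f \<xi> \<partial>B) = (\<integral>\<xi>. f (T (inv g) \<xi>) \<partial>B)"
  using integral_density[of f B "D g"] D_nonneg unfolding density_D
  by (simp add: integral_distr)

lemma D_lower: "AE \<xi> in B. pmf (walk n) g \<le> D g \<xi>"
proof -
  have "AE \<xi> in B. ennreal (pmf (walk n) g) \<le> ennreal (D g \<xi>)"
  proof (rule AE_le_if_integrals_le)
    show "(\<integral>\<^sup>+\<xi>. ennreal (D g \<xi>) \<partial>B) \<noteq> \<infinity>" using nn_integral_D[of "\<lambda>_. 1"] by (simp add: emeasure_space_1)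
    fix A assume [measurable]: "A \<in> sets B"
    have "(\<integral>\<^sup>+\<xi>. ennreal (pmf (walk n) g) * indicator A \<xi> \<partial>B) = ennreal (pmf (walk n) g * prob A)"
      by (simp add: nn_integral_cmult emeasure_eq_measure ennreal_mult)
    also have "\<dots> \<le> ennreal (prob (T (inv g) -` A \<inter> space B))"
      by (intro ennreal_leI translate_bounds) simp
    also have "\<dots> = emeasure (distr B B (T (inv g))) A"
      by (simp add: emeasure_distr emeasure_eq_measure)
    also have "\<dots> = (\<integral>\<^sup>+\<xi>. ennreal (D g \<xi>) * indicator A \<xi> \<partial>B)"
      by (subst density_D[symmetric], subst emeasure_density) auto
    finally show "(\<integral>\<^sup>+\<xi>. ennreal (pmf (walk n) g) * indicator A \<xi> \<partial>B) \<le> (\<integral>\<^sup>+\<xi>. ennreal (D g \<xi>) * indicator A \<xi> \<partial>B)" .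
  qed auto
  then show ?thesis by eventually_elim (simp add: D_nonneg)
qed

lemma D_upper:
  assumes n: "g \<in> set_pmf (walk n)" shows "AE \<xi> in B. D g \<xi> \<le> 1 / pmf (walk n) g"
proof -
  let ?c = "1 / pmf (walk n) g"
  have "AE \<xi> in B. ennreal (D g \<xi>) \<le> ennreal ?c"
  proof (rule AE_le_if_integrals_le)
    show "(\<integral>\<^sup>+\<xi>. ennreal ?c \<partial>B) \<noteq> \<infinity>" by (simp add: emeasure_space_1)
    fix A assume [measurable]: "A \<in> sets B"
    have "(\<integral>\<^sup>+\<xi>. ennreal (D g \<xi>) * indicator A \<xi> \<partial>B) = emeasure (distr B B (T (inv g))) A"
      by (subst density_D[symmetric], subst emeasure_density) auto
    also have "\<dots> = ennreal (prob (T (inv g) -` A \<inter> space B))"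
      by (simp add: emeasure_distr emeasure_eq_measure)
    also have "\<dots> \<le> ennreal (?c * prob A)"
      using translate_bounds(1)[of A n] pmf_positive[OF n] by (intro ennreal_leI) (simp add: field_simps)
    also have "\<dots> = (\<integral>\<^sup>+\<xi>. ennreal ?c * indicator A \<xi> \<partial>B)"
      by (subst ennreal_mult) (auto simp: nn_integral_cmult emeasure_eq_measure)
    finally show "(\<integral>\<^sup>+\<xi>. ennreal (D g \<xi>) * indicator A \<xi> \<partial>B) \<le> (\<integral>\<^sup>+\<xi>. ennreal ?c * indicator A \<xi> \<partial>B)" .
  qed auto
  then show ?thesis by eventually_elim simp
qed

text \<open>
  Every element is reached by the walk, so each single density is bounded away from 0 and infinity.
  All functions of it that occur below are therefore bounded, and integrability is never an issue for
  a fixed group element.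
\<close>

lemma D_bounded:
  obtains c C where "0 < c" "c \<le> C" "AE \<xi> in B. c \<le> D g \<xi> \<and> D g \<xi> \<le> C"
proof -
  obtain n where n: "g \<in> set_pmf (walk n)" using walk_reaches[OF g] .
  let ?c = "pmf (walk n) g"
  have "?c \<le> 1" "0 < ?c" using n by (auto simp: pmf_le_1 pmf_positive)
  then have "?c \<le> 1 / ?c" by (simp add: field_simps mult_le_one)
  moreover have "AE \<xi> in B. ?c \<le> D g \<xi> \<and> D g \<xi> \<le> 1 / ?c"
    using D_lower[of n] D_upper[OF n] by eventually_elim simp
  ultimately show thesis using that \<open>0 < ?c\<close> by blast
qed

lemma D_pos: "AE \<xi> in B. 0 < D g \<xi>"
  by (rule D_bounded) (elim AE_mp, auto)

lemma integrable_D_comp: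
  fixes F :: "real \<Rightarrow> real"
  assumes [measurable]: "F \<in> borel_measurable borel" and F: "continuous_on {0<..} F"
  shows "(\<lambda>\<xi>. F (D g \<xi>)) \<in> Linfty B" and "integrable B (\<lambda>\<xi>. F (D g \<xi>))"
proof -
  obtain c C where c: "0 < c" "c \<le> C" "AE \<xi> in B. c \<le> D g \<xi> \<and> D g \<xi> \<le> C" by (rule D_bounded)
  have "bounded (F ` {c..C})"
    using c by (intro compact_imp_bounded compact_continuous_image continuous_on_subset[OF F]) auto
  then obtain K where K: "\<And>x. x \<in> {c..C} \<Longrightarrow> \<bar>F x\<bar> \<le> K"
    unfolding bounded_iff by fastforce
  have AE: "AE \<xi> in B. \<bar>F (D g \<xi>)\<bar> \<le> K" using c(3) by eventually_elim (use K in auto)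
  then show "(\<lambda>\<xi>. F (D g \<xi>)) \<in> Linfty B" unfolding Linfty_def by auto
  show "integrable B (\<lambda>\<xi>. F (D g \<xi>))" using AE by (intro integrable_const_bound[where B = K]) auto
qed

lemma integrable_D [simp]: "integrable B (D g)"
  and integrable_ln_D [simp]: "integrable B (\<lambda>\<xi>. ln (D g \<xi>))"
  and integrable_D_ln_D [simp]: "integrable B (\<lambda>\<xi>. D g \<xi> * ln (D g \<xi>))"
  and integrable_sqrt_D [simp]: "integrable B (\<lambda>\<xi>. sqrt (D g \<xi>))"
  by (rule integrable_D_comp(2)[of "\<lambda>x. x"] integrable_D_comp(2)[of ln]
      integrable_D_comp(2)[of "\<lambda>x. x * ln x"] integrable_D_comp(2)[of sqrt];
      auto intro!: continuous_intros)+

lemma integral_D_eq_1: "(\<integral>\<xi>. D g \<xi> \<partial>B) = 1"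
  using integral_D[of "\<lambda>_. 1"] by (simp add: prob_space)

end

section \<open>The entropy of the boundary\<close>

lemma ln_D_Linfty: "g \<in> carrier G \<Longrightarrow> (\<lambda>\<xi>. - ln (D g \<xi>)) \<in> Linfty B"
  by (rule integrable_D_comp(1)[of g "\<lambda>x. - ln x"]) (auto intro!: continuous_intros)

text \<open>
  The chain rule for \<open>(g h)\<^sup>-\<^sup>1\<nu>\<close>, \<open>h\<^sup>-\<^sup>1\<nu>\<close> and \<open>\<nu>\<close>.
\<close>

lemma D_cocycle:
  assumes g: "g \<in> carrier G" and h: "h \<in> carrier G"
  shows "AE \<xi> in B. D (g \<otimes> h) \<xi> = D g (T h \<xi>) * D h \<xi>"
proof -
  note [measurable] = measurable_action[OF g] measurable_action[OF h]
    measurable_action[OF inv_closed[OF g]] measurable_action[OF inv_closed[OF h]]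
  have gh: "g \<otimes> h \<in> carrier G" using g h by simp
  have "AE \<xi> in B. ennreal (D (g \<otimes> h) \<xi>) = ennreal (D g (T h \<xi>) * D h \<xi>)"
  proof (rule density_unique)
    show "density B (\<lambda>\<xi>. ennreal (D (g \<otimes> h) \<xi>)) = density B (\<lambda>\<xi>. ennreal (D g (T h \<xi>) * D h \<xi>))"
    proof (rule measure_eqI)
      fix A assume "A \<in> sets (density B (\<lambda>\<xi>. ennreal (D (g \<otimes> h) \<xi>)))"
      then have [measurable]: "A \<in> sets B" by simp
      have "emeasure (density B (\<lambda>\<xi>. ennreal (D g (T h \<xi>) * D h \<xi>))) A =
          (\<integral>\<^sup>+\<xi>. ennreal (D h \<xi>) * (ennreal (D g (T h \<xi>)) * indicator A \<xi>) \<partial>B)"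
        by (subst emeasure_density) (auto simp: ennreal_mult D_nonneg mult_ac)
      also have "\<dots> = (\<integral>\<^sup>+\<xi>. ennreal (D g (T h (T (inv h) \<xi>))) * indicator A (T (inv h) \<xi>) \<partial>B)"
        by (rule nn_integral_D[OF h]) measurable
      also have "\<dots> = (\<integral>\<^sup>+\<xi>. ennreal (D g \<xi>) * indicator A (T (inv h) \<xi>) \<partial>B)"
        by (intro nn_integral_cong) (simp add: action_inv[OF h])
      also have "\<dots> = (\<integral>\<^sup>+\<xi>. indicator A (T (inv h) (T (inv g) \<xi>)) \<partial>B)"
        by (rule nn_integral_D[OF g]) measurable
      also have "\<dots> = (\<integral>\<^sup>+\<xi>. ennreal (D (g \<otimes> h) \<xi>) * indicator A \<xi> \<partial>B)"
        using g h by (subst nn_integral_D[OF gh]) (auto intro!: nn_integral_cong simp: action_mult inv_mult_group)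
      also have "\<dots> = emeasure (density B (\<lambda>\<xi>. ennreal (D (g \<otimes> h) \<xi>))) A"
        by (subst emeasure_density) auto
      finally show "emeasure (density B (\<lambda>\<xi>. ennreal (D (g \<otimes> h) \<xi>))) A =
          emeasure (density B (\<lambda>\<xi>. ennreal (D g (T h \<xi>) * D h \<xi>))) A" by simp
    qed simp
  qed measurable
  then show ?thesis by eventually_elim (simp add: D_nonneg)
qed

text \<open>
  The Kullback-Leibler divergence of \<open>\<nu>\<close> from \<open>g\<^sup>-\<^sup>1\<nu>\<close>.
\<close>

definition divergence :: "'a \<Rightarrow> real" where
  "divergence g = (\<integral>\<xi>. - ln (D g \<xi>) \<partial>B)"

lemma divergence_nonneg:
  assumes g: "g \<in> carrier G" shows "0 \<le> divergence g"
proof -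
  have "(\<integral>\<xi>. 1 - D g \<xi> \<partial>B) \<le> divergence g"
    unfolding divergence_def
  proof (rule integral_mono_AE)
    show "AE \<xi> in B. 1 - D g \<xi> \<le> - ln (D g \<xi>)"
      using D_pos[OF g] by eventually_elim (use ln_le_minus_one in force)
  qed (use g in auto)
  then show ?thesis using g by (simp add: integral_D_eq_1 prob_space)
qed

lemma divergence_le:
  assumes n: "g \<in> set_pmf (walk n)" shows "divergence g \<le> - ln (pmf (walk n) g)"
proof -
  have g: "g \<in> carrier G" using n set_walk by auto
  have "divergence g \<le> (\<integral>\<xi>. - ln (pmf (walk n) g) \<partial>B)"
    unfolding divergence_def
  proof (rule integral_mono_AE)
    show "AE \<xi> in B. - ln (D g \<xi>) \<le> - ln (pmf (walk n) g)"
      using D_lower[OF g, of n] by eventually_elim (use pmf_positive[OF n] in simp)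
  qed (use g in auto)
  then show ?thesis by (simp add: prob_space)
qed

text \<open>
  The logarithm of the cocycle relation. As a function of \<open>h\<close>, the first term on the right is a
  Poisson transform, so its mean over \<open>h\<close> is its value at the identity, which is the divergence of \<open>g\<close>.
\<close>

lemma divergence_mult:
  assumes g: "g \<in> carrier G" and h: "h \<in> carrier G"
  shows "divergence (g \<otimes> h) = P (\<lambda>\<xi>. - ln (D g \<xi>)) h + divergence h"
proof -
  note [measurable] = measurable_action[OF h]
  have gh: "g \<otimes> h \<in> carrier G" using g h by simp
  have pos: "AE \<xi> in B. 0 < D g (T h \<xi>)"
    using AE_translate[OF inv_closed[OF h] D_pos[OF g]] h by simp
  have eq: "AE \<xi> in B. - ln (D g (T h \<xi>)) = - ln (D (g \<otimes> h) \<xi>) + ln (D h \<xi>)"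
    using D_cocycle[OF g h] pos D_pos[OF h] by eventually_elim (simp add: ln_mult)
  have "P (\<lambda>\<xi>. - ln (D g \<xi>)) h = (\<integral>\<xi>. - ln (D (g \<otimes> h) \<xi>) + ln (D h \<xi>) \<partial>B)"
    unfolding poisson_transform_def using eq by (intro integral_cong_AE) auto
  also have "\<dots> = divergence (g \<otimes> h) - divergence h"
    using gh h by (simp add: divergence_def)
  finally show ?thesis by simp
qed

lemma divergence_one: "divergence \<one> = 0"
  using divergence_le[of \<one> 0] divergence_nonneg[of \<one>] by simp

lemma divergence_inv:
  assumes g: "g \<in> carrier G"
  shows "divergence (inv g) = (\<integral>\<xi>. D g \<xi> * ln (D g \<xi>) \<partial>B)"
proof -
  have "divergence (inv g) = - P (\<lambda>\<xi>. - ln (D g \<xi>)) (inv g)"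
    using divergence_mult[OF g inv_closed[OF g]] g divergence_one by simp
  also have "P (\<lambda>\<xi>. - ln (D g \<xi>)) (inv g) = (\<integral>\<xi>. D g \<xi> * - ln (D g \<xi>) \<partial>B)"
    unfolding poisson_transform_def using integral_D[OF g, of "\<lambda>\<xi>. - ln (D g \<xi>)"] by simp
  finally show ?thesis by simp
qed

definition boundary_entropy :: real where
  "boundary_entropy = measure_pmf.expectation \<mu> divergence"

text \<open>
  The divergence has mean \<open>n I\<close> under \<open>\<mu>\<^sup>*\<^sup>n\<close> by \<open>divergence_mult\<close>, and it is at most the information
  \<open>- ln \<mu>\<^sup>*\<^sup>n\<close> pointwise.
\<close>

lemma boundary_entropy_le:
  assumes fin: "finite_entropy G \<mu>"
  shows "integrable (measure_pmf \<mu>) divergence"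
    and "boundary_entropy \<le> asymptotic_entropy G \<mu>"
proof -
  have int: "integrable (measure_pmf (walk n)) divergence" for n
    by (rule pmf_integrable_mono[OF integrable_walk_entropy[OF fin]])
      (use divergence_le divergence_nonneg set_walk in \<open>force simp: subset_iff\<close>)
  show int1: "integrable (measure_pmf \<mu>) divergence" using int[of 1] by (simp only: walk_1)
  have sum: "measure_pmf.expectation (walk n) divergence = real n * boundary_entropy" for n
  proof (induction n)
    case 0
    then show ?case by (simp add: divergence_one)
  next
    case (Suc n)
    have "measure_pmf.expectation (walk (Suc n)) divergence =
        measure_pmf.expectation (walk n) (\<lambda>x. measure_pmf.expectation \<mu> (\<lambda>s. divergence (x \<otimes> s)))"
      using expectation_convolution(3)[OF int[of "Suc n", simplified]] by simp
    also have "\<dots> = measure_pmf.expectation (walk n) (\<lambda>x. divergence x + boundary_entropy)"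
    proof (rule pmf_expectation_cong)
      fix x assume "x \<in> set_pmf (walk n)"
      then have x: "x \<in> carrier G" using set_walk by auto
      let ?u = "P (\<lambda>\<xi>. - ln (D x \<xi>))"
      have harm: "?u \<in> bounded_harmonic G \<mu>"
        by (rule poisson_transform_harmonic[OF ln_D_Linfty[OF x]])
      have u1: "?u (\<one> \<otimes> s) = ?u s" if "s \<in> set_pmf \<mu>" for s using that supp by auto
      have "measure_pmf.expectation \<mu> (\<lambda>s. divergence (x \<otimes> s)) =
          measure_pmf.expectation \<mu> (\<lambda>s. ?u (\<one> \<otimes> s) + divergence s)"
        using supp x by (intro pmf_expectation_cong) (auto simp: divergence_mult u1)
      also have "\<dots> = measure_pmf.expectation \<mu> (\<lambda>s. ?u (\<one> \<otimes> s)) + boundary_entropy"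
        using harmonic_walk(1)[OF harm one_closed, of 1] int1
        unfolding walk_1 boundary_entropy_def by (intro Bochner_Integration.integral_add) 
      also have "measure_pmf.expectation \<mu> (\<lambda>s. ?u (\<one> \<otimes> s)) = ?u \<one>"
        by (rule harmonic_step[OF harm one_closed, symmetric])
      also have "?u \<one> = divergence x"
        using divergence_mult[OF x one_closed] x divergence_one by simp
      finally show "measure_pmf.expectation \<mu> (\<lambda>s. divergence (x \<otimes> s)) = divergence x + boundary_entropy" .
    qed
    also have "\<dots> = real (Suc n) * boundary_entropy"
      using int[of n] Suc by (simp add: algebra_simps)
    finally show ?case .
  qed
  show "boundary_entropy \<le> asymptotic_entropy G \<mu>"
  proof (rule asymptotic_entropy_ge[OF fin])
    fix n
    show "real n * boundary_entropy \<le> pmf_entropy (walk n)"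
      unfolding sum[symmetric] pmf_entropy_def
      by (intro pmf_expectation_mono int integrable_walk_entropy[OF fin] divergence_le)
  qed
qed

section \<open>Affinities on the boundary\<close>

lemma LinftyD:
  assumes "f \<in> Linfty B" shows "f \<in> borel_measurable B" "integrable B f"
    and "g \<in> carrier G \<Longrightarrow> integrable B (\<lambda>\<xi>. f (T g \<xi>))"
proof -
  show m[measurable]: "f \<in> borel_measurable B" using assms by (simp add: Linfty_def)
  obtain C where C: "AE \<xi> in B. \<bar>f \<xi>\<bar> \<le> C" using assms by (auto simp: Linfty_def)
  then show "integrable B f" by (intro integrable_const_bound[where B = C]) auto
  assume g: "g \<in> carrier G"
  note [measurable] = measurable_action[OF g]
  have "AE \<xi> in B. \<bar>f (T g \<xi>)\<bar> \<le> C" using AE_translate[OF inv_closed[OF g] C] g by simp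
  then show "integrable B (\<lambda>\<xi>. f (T g \<xi>))" by (intro integrable_const_bound[where B = C]) auto
qed

lemma poisson_transform_isometry:
  assumes "f \<in> Linfty B" "f' \<in> Linfty B"
  shows "esssup B (\<lambda>\<xi>. ereal \<bar>f \<xi> - f' \<xi>\<bar>) = (SUP g\<in>carrier G. ereal \<bar>P f g - P f' g\<bar>)"
  using boundary assms unfolding poisson_boundary_def by blast

text \<open>
  A linear isometry that fixes constants preserves order: a function with values in \<open>[c, C]\<close> is one
  at distance at most \<open>(C - c) / 2\<close> from the constant \<open>(c + C) / 2\<close>.
\<close>

lemma poisson_transform_positive:
  assumes f: "f \<in> Linfty B" and lower: "\<And>g. g \<in> carrier G \<Longrightarrow> c \<le> P f g"
  shows "AE \<xi> in B. c \<le> f \<xi>"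
proof -
  obtain C where C: "\<And>g. g \<in> carrier G \<Longrightarrow> \<bar>P f g\<bar> \<le> C"
    using bounded_harmonicD[OF poisson_transform_harmonic[OF f]] by blast
  \<comment> \<open>The midpoint of the range of the transform.\<close>
  define m where "m = (c + C) / 2"
  have const: "(\<lambda>_. m) \<in> Linfty B" by (auto simp: Linfty_def)
  have Pm: "P (\<lambda>_. m) g = m" for g by (simp add: poisson_transform_def prob_space)
  have "(SUP g\<in>carrier G. ereal \<bar>P f g - P (\<lambda>_. m) g\<bar>) \<le> ereal ((C - c) / 2)"
  proof (rule SUP_least)
    fix g assume g: "g \<in> carrier G"
    have "\<bar>P f g - m\<bar> \<le> (C - c) / 2"
      using abs_le_D1[OF C[OF g]] lower[OF g] by (intro abs_leI) (simp_all add: m_def field_simps)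
    then show "ereal \<bar>P f g - P (\<lambda>_. m) g\<bar> \<le> ereal ((C - c) / 2)"
      by (simp only: Pm ereal_less_eq)
  qed
  then have ess: "esssup B (\<lambda>\<xi>. ereal \<bar>f \<xi> - m\<bar>) \<le> ereal ((C - c) / 2)"
    by (simp only: poisson_transform_isometry[OF f const])
  have "AE \<xi> in B. ereal \<bar>f \<xi> - m\<bar> \<le> ereal ((C - c) / 2)"
    using esssup_AE[where f = "\<lambda>\<xi>. ereal \<bar>f \<xi> - m\<bar>" and M = B]
    by eventually_elim (rule order_trans[OF _ ess])
  then show ?thesis
  proof eventually_elim
    case (elim \<xi>)
    then have "\<bar>f \<xi> - m\<bar> \<le> (C - c) / 2" by (simp only: ereal_less_eq)
    then have "- (f \<xi> - m) \<le> (C - c) / 2" by (rule abs_le_D2)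
    then show ?case unfolding m_def by (simp add: field_simps)
  qed
qed

definition affinity :: "'a \<Rightarrow> real" where
  "affinity g = (\<integral>\<xi>. sqrt (D g \<xi>) \<partial>B)"

lemma affinity_bounds:
  assumes g: "g \<in> carrier G" shows "0 < affinity g" and "affinity g \<le> 1"
proof -
  show "affinity g \<le> 1"
    unfolding affinity_def
    using hellinger(3)[of "D g"] D_nonneg g by (simp add: integral_D_eq_1)
  have "affinity g \<noteq> 0"
  proof
    assume "affinity g = 0"
    then have "AE \<xi> in B. sqrt (D g \<xi>) = 0"
      unfolding affinity_def using g by (subst (asm) integral_nonneg_eq_0_iff_AE) (auto simp: D_nonneg)
    then have "AE \<xi> in B. False" using D_pos[OF g] by eventually_elim simp
    then show False by simp
  qed
  moreover have "0 \<le> affinity g" unfolding affinity_def by (simp add: D_nonneg)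
  ultimately show "0 < affinity g" by simp
qed

text \<open>
  The easy half of the duality. The inequalities between the transforms give \<open>a\<^sup>2 f + f' \<ge> 2 a\<close> almost
  everywhere, simultaneously for all rational and hence for all real \<open>a\<close>; the choice
  \<open>a = sqrt (D g \<xi>)\<close> makes the left-hand side the integrand of the transforms.
\<close>

lemma affinity_le_transforms:
  assumes g: "g \<in> carrier G" and f: "f \<in> Linfty B" "f' \<in> Linfty B"
    and le: "\<And>a h. 0 < a \<Longrightarrow> h \<in> carrier G \<Longrightarrow> 2 * a \<le> a\<^sup>2 * P f h + P f' h"
  shows "2 * affinity g \<le> P f (inv g) + P f' \<one>"
proof -
  note meas[measurable] = LinftyD(1)[OF f(1)] LinftyD(1)[OF f(2)]
  have "AE \<xi> in B. 2 * a \<le> a\<^sup>2 * f \<xi> + f' \<xi>" if "0 < a" for a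
  proof (rule poisson_transform_positive)
    obtain C C' where "AE \<xi> in B. \<bar>f \<xi>\<bar> \<le> C" "AE \<xi> in B. \<bar>f' \<xi>\<bar> \<le> C'"
      using f by (auto simp: Linfty_def)
    then have "AE \<xi> in B. \<bar>a\<^sup>2 * f \<xi> + f' \<xi>\<bar> \<le> a\<^sup>2 * C + C'"
    proof eventually_elim
      case (elim \<xi>)
      have "\<bar>a\<^sup>2 * f \<xi> + f' \<xi>\<bar> \<le> a\<^sup>2 * \<bar>f \<xi>\<bar> + \<bar>f' \<xi>\<bar>"
        using abs_triangle_ineq[of "a\<^sup>2 * f \<xi>" "f' \<xi>"] by (simp add: abs_mult)
      also have "\<dots> \<le> a\<^sup>2 * C + C'" using elim by (intro add_mono mult_left_mono) auto
      finally show ?case .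
    qed
    then show "(\<lambda>\<xi>. a\<^sup>2 * f \<xi> + f' \<xi>) \<in> Linfty B" by (auto simp: Linfty_def)
    fix h assume h: "h \<in> carrier G"
    have "P (\<lambda>\<xi>. a\<^sup>2 * f \<xi> + f' \<xi>) h = a\<^sup>2 * P f h + P f' h"
      using LinftyD(3)[OF f(1) h] LinftyD(3)[OF f(2) h] by (simp add: poisson_transform_def)
    then show "2 * a \<le> P (\<lambda>\<xi>. a\<^sup>2 * f \<xi> + f' \<xi>) h" using le[OF that h] by simp
  qed
  then have "AE \<xi> in B. \<forall>a\<in>{a\<in>\<rat>. 0 < a}. 2 * a \<le> a\<^sup>2 * f \<xi> + f' \<xi>"
    by (subst AE_ball_countable) (auto intro: countable_subset[OF _ countable_rat])
  then have pointwise: "AE \<xi> in B. 2 * sqrt (D g \<xi>) \<le> D g \<xi> * f \<xi> + f' \<xi>"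
  proof eventually_elim
    case (elim \<xi>)
    let ?s = "sqrt (D g \<xi>)"
    have "2 * ?s \<le> ?s\<^sup>2 * f \<xi> + f' \<xi>"
    proof (rule ccontr)
      assume "\<not> ?thesis"
      then have neg: "?s\<^sup>2 * f \<xi> + f' \<xi> - 2 * ?s < 0" by simp
      have "((\<lambda>a. a\<^sup>2 * f \<xi> + f' \<xi> - 2 * a) \<longlongrightarrow> ?s\<^sup>2 * f \<xi> + f' \<xi> - 2 * ?s) (at_right ?s)"
        by (intro tendsto_intros)
      from order_tendstoD(2)[OF this neg]
      obtain b where b: "?s < b" "\<And>a. ?s < a \<Longrightarrow> a < b \<Longrightarrow> a\<^sup>2 * f \<xi> + f' \<xi> - 2 * a < 0"
        unfolding eventually_at_right_field by blast
      obtain q where q: "q \<in> \<rat>" "?s < q" "q < b" using Rats_dense_in_real[OF b(1)] by blast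
      moreover have "0 \<le> ?s" by (simp add: D_nonneg)
      ultimately have "0 < q" by linarith
      then have "2 * q \<le> q\<^sup>2 * f \<xi> + f' \<xi>" using elim q(1) by blast
      then show False using b(2)[OF q(2,3)] by linarith
    qed
    then show ?case by (simp add: D_nonneg)
  qed
  have intDf: "integrable B (\<lambda>\<xi>. D g \<xi> * f \<xi>)"
  proof -
    obtain C where C: "AE \<xi> in B. \<bar>f \<xi>\<bar> \<le> C" using f by (auto simp: Linfty_def)
    show ?thesis
    proof (rule Bochner_Integration.integrable_bound[of B "\<lambda>\<xi>. D g \<xi> * C"])
      show "AE \<xi> in B. norm (D g \<xi> * f \<xi>) \<le> norm (D g \<xi> * C)"
        using C by eventually_elim (auto simp: abs_mult D_nonneg intro!: mult_left_mono)
    qed (use g in auto)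
  qed
  have "2 * affinity g = (\<integral>\<xi>. 2 * sqrt (D g \<xi>) \<partial>B)" by (simp add: affinity_def)
  also have "\<dots> \<le> (\<integral>\<xi>. D g \<xi> * f \<xi> + f' \<xi> \<partial>B)"
    using pointwise intDf LinftyD(2)[OF f(2)] g by (intro integral_mono_AE) auto
  also have "\<dots> = (\<integral>\<xi>. f (T (inv g) \<xi>) \<partial>B) + (\<integral>\<xi>. f' \<xi> \<partial>B)"
    using intDf LinftyD(2)[OF f(2)] integral_D[OF g meas(1)] by simp
  also have "(\<integral>\<xi>. f' \<xi> \<partial>B) = P f' \<one>"
    unfolding poisson_transform_def by (intro Bochner_Integration.integral_cong) (auto simp: action_one)
  finally show ?thesis by (simp add: poisson_transform_def)
qed

end

lemma pmf_dominated_convergence: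
  fixes f :: "nat \<Rightarrow> 'a \<Rightarrow> real"
  assumes "\<And>x. x \<in> set_pmf p \<Longrightarrow> (\<lambda>n. f n x) \<longlonglongrightarrow> F x"
    and "\<And>n x. x \<in> set_pmf p \<Longrightarrow> \<bar>f n x\<bar> \<le> C"
  shows "(\<lambda>n. measure_pmf.expectation p (f n)) \<longlonglongrightarrow> measure_pmf.expectation p F"
  by (rule integral_dominated_convergence[where w = "\<lambda>_. C"])
    (use assms in \<open>auto simp: AE_measure_pmf_iff\<close>)

context symmetric_walk
begin

text \<open>
  Averages over \<open>\<lambda>\<close> are harmonic up to an error of order \<open>t\<close>, by the equation for \<open>\<lambda>\<close>.
\<close>

lemma green_limit_harmonic:
  assumes t: "\<And>n. 0 < t n" "\<And>n. t n < 1" "t \<longlonglongrightarrow> 0"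
    and \<phi>: "\<And>n z. z \<in> carrier G \<Longrightarrow> \<bar>\<phi> n z\<bar> \<le> C"
    and u: "\<And>g. g \<in> carrier G \<Longrightarrow>
      (\<lambda>n. measure_pmf.expectation (green (t n)) (\<lambda>x. \<phi> n (g \<otimes> x))) \<longlonglongrightarrow> u g"
  shows "u \<in> bounded_harmonic G \<mu>"
proof -
  let ?u = "\<lambda>n g. measure_pmf.expectation (green (t n)) (\<lambda>x. \<phi> n (g \<otimes> x))"
  have carr: "x \<in> carrier G" if "x \<in> set_pmf (green s)" for x s using that set_green by auto
  have int: "integrable (measure_pmf (green (t n))) (\<lambda>x. \<phi> n (g \<otimes> x))" if "g \<in> carrier G" for n g
    using that carr by (intro pmf_integrable_bounded[where C = C] \<phi>) auto
  have bound: "\<bar>?u n g\<bar> \<le> C" if g: "g \<in> carrier G" for n g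
  proof -
    have "\<bar>?u n g\<bar> \<le> measure_pmf.expectation (green (t n)) (\<lambda>x. \<bar>\<phi> n (g \<otimes> x)\<bar>)"
      by (rule integral_abs_bound)
    also have "\<dots> \<le> measure_pmf.expectation (green (t n)) (\<lambda>x. C)"
      using int[OF g] g carr \<phi> by (intro pmf_expectation_mono) auto
    finally show ?thesis by simp
  qed
  have bounded: "\<bar>u g\<bar> \<le> C" if "g \<in> carrier G" for g
    by (rule LIMSEQ_le_const2[OF tendsto_rabs[OF u[OF that]]]) (use bound that in auto)
  have "u g = measure_pmf.expectation \<mu> (\<lambda>s. u (g \<otimes> s))" if g: "g \<in> carrier G" for g
  proof -
    have step: "?u n g = t n * \<phi> n g + (1 - t n) * measure_pmf.expectation \<mu> (\<lambda>s. ?u n (g \<otimes> s))" for n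
    proof -
      note conv = expectation_green[OF t(1,2) int[OF g], of n]
      have "measure_pmf.expectation (convolution G \<mu> (green (t n))) (\<lambda>x. \<phi> n (g \<otimes> x)) =
          measure_pmf.expectation \<mu> (\<lambda>s. measure_pmf.expectation (green (t n)) (\<lambda>x. \<phi> n (g \<otimes> (s \<otimes> x))))"
        by (rule expectation_convolution(3)[OF conv(1)])
      also have "\<dots> = measure_pmf.expectation \<mu> (\<lambda>s. ?u n (g \<otimes> s))"
      proof (intro pmf_expectation_cong)
        fix s x assume "s \<in> set_pmf \<mu>" "x \<in> set_pmf (green (t n))"
        then have "g \<otimes> (s \<otimes> x) = (g \<otimes> s) \<otimes> x" using g supp carr by (auto simp: m_assoc subset_iff)
        then show "\<phi> n (g \<otimes> (s \<otimes> x)) = \<phi> n ((g \<otimes> s) \<otimes> x)" by simp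
      qed
      finally show ?thesis using conv(2) g by simp
    qed
    have "(\<lambda>n. t n * \<phi> n g) \<longlonglongrightarrow> 0"
    proof (rule tendsto_rabs_zero_cancel, rule tendsto_sandwich[where f = "\<lambda>_. 0" and h = "\<lambda>n. t n * C"])
      show "(\<lambda>n. t n * C) \<longlonglongrightarrow> 0" using tendsto_mult_left_zero[OF t(3)] by simp
      show "\<forall>\<^sub>F n in sequentially. \<bar>t n * \<phi> n g\<bar> \<le> t n * C"
        using t(1) \<phi>[OF g] by (intro always_eventually allI) (auto simp: abs_mult less_imp_le intro!: mult_mono)
    qed auto
    moreover have "(\<lambda>n. measure_pmf.expectation \<mu> (\<lambda>s. ?u n (g \<otimes> s))) \<longlonglongrightarrow>
        measure_pmf.expectation \<mu> (\<lambda>s. u (g \<otimes> s))"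
      using supp g by (intro pmf_dominated_convergence[where C = C] u bound) auto
    moreover have "(\<lambda>n. 1 - t n) \<longlonglongrightarrow> 1 - 0" by (intro tendsto_intros t)
    ultimately have "(\<lambda>n. t n * \<phi> n g + (1 - t n) * measure_pmf.expectation \<mu> (\<lambda>s. ?u n (g \<otimes> s)))
        \<longlonglongrightarrow> 0 + (1 - 0) * measure_pmf.expectation \<mu> (\<lambda>s. u (g \<otimes> s))"
      by (intro tendsto_add tendsto_mult)
    then have "(\<lambda>n. ?u n g) \<longlonglongrightarrow> measure_pmf.expectation \<mu> (\<lambda>s. u (g \<otimes> s))"
      by (simp add: step[symmetric])
    then show ?thesis by (rule LIMSEQ_unique[OF u[OF g]])
  qed
  then show ?thesis
    unfolding bounded_harmonic_def using bounded
    by (auto simp: bounded_iff expectation_eq_infsum[OF supp])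
qed

end

context boundary_walk
begin

text \<open>
  The other half of the duality: \<open>\<phi> = sqrt (\<lambda>(z) / \<lambda>(g z))\<close> and \<open>\<psi> = 1 / \<phi>\<close> attain the affinities of
  \<open>\<lambda>\<close>, and limits of their averages provide the two transforms. One subsequence serves all \<open>g\<close> in the
  support of \<open>\<mu>\<close> and all base points, so the bound \<open>r\<close> on the mean passes to the limit by dominated
  convergence.
\<close>

lemma affinity_le_of_green:
  assumes r: "\<And>t. 0 < t \<Longrightarrow> t < 1 \<Longrightarrow> measure_pmf.expectation \<mu> (pmf_affinity (green t)) \<le> r"
  shows "integrable (measure_pmf \<mu>) affinity" and "measure_pmf.expectation \<mu> affinity \<le> r"
proof -
  have carr: "g \<in> carrier G" if "g \<in> set_pmf \<mu>" for g using that supp by auto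
  have "\<bar>affinity g\<bar> \<le> 1" if "g \<in> set_pmf \<mu>" for g
    using affinity_bounds[OF carr[OF that]] by simp
  then show int: "integrable (measure_pmf \<mu>) affinity" by (rule pmf_integrable_bounded)
  define t :: "nat \<Rightarrow> real" where "t n = 1 / (real n + 2)" for n
  have t: "0 < t n" "t n < 1" "1 / 2 \<le> 1 - t n" for n by (auto simp: t_def field_simps)
  have t_lim: "t \<longlonglongrightarrow> 0" unfolding t_def by real_asymp
  let ?p = "\<lambda>n. pmf (green (t n))"
  \<comment> \<open>Off the support of \<open>\<lambda>\<close> any pair with product 1 will do; a quotient there would be 0.\<close>
  define \<phi> where "\<phi> n g z = (if z \<in> set_pmf (green (t n)) then sqrt (?p n z / ?p n (g \<otimes> z)) else 1)" for n g z
  define \<psi> where "\<psi> n g z = (if z \<in> set_pmf (green (t n)) then sqrt (?p n (g \<otimes> z) / ?p n z) else 1)" for n g z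
  \<comment> \<open>The bound from \<open>green_ratio_le\<close>, where \<open>1 - t n\<close> is at least 1/2.\<close>
  define C where "C g = sqrt (2 / pmf \<mu> g)" for g
  have C: "1 \<le> C g" "\<bar>\<phi> n g z\<bar> \<le> C g" "\<bar>\<psi> n g z\<bar> \<le> C g" "0 < \<phi> n g z" "\<phi> n g z * \<psi> n g z = 1"
    if g: "g \<in> set_pmf \<mu>" and z: "z \<in> carrier G" for g z n
  proof -
    have \<mu>: "0 < pmf \<mu> g" "pmf \<mu> g \<le> 1" using g by (auto simp: pmf_positive pmf_le_1)
    show "1 \<le> C g" using \<mu> by (simp add: C_def field_simps)
    have shift: "g \<otimes> z \<in> set_pmf (green (t n)) \<longleftrightarrow> z \<in> set_pmf (green (t n))"
      by (rule set_green_shift[OF t(1,2) g z])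
    have pos: "0 < ?p n z" "0 < ?p n (g \<otimes> z)" if "z \<in> set_pmf (green (t n))"
      using that shift by (auto simp: pmf_positive)
    have "1 / ((1 - t n) * pmf \<mu> g) \<le> 2 / pmf \<mu> g" using \<mu> t(2,3)[of n] by (simp add: field_simps)
    then have "a \<le> b * (2 / pmf \<mu> g)" if "a \<le> b / ((1 - t n) * pmf \<mu> g)" "0 \<le> b" for a b
      using that mult_left_mono[of "1 / ((1 - t n) * pmf \<mu> g)" "2 / pmf \<mu> g" b] by simp
    then have ratio: "?p n (g \<otimes> z) \<le> ?p n z * (2 / pmf \<mu> g)" "?p n z \<le> ?p n (g \<otimes> z) * (2 / pmf \<mu> g)"
      using green_ratio_le[OF t(1,2) g z] by auto
    show "\<bar>\<phi> n g z\<bar> \<le> C g" "\<bar>\<psi> n g z\<bar> \<le> C g"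
      using \<open>1 \<le> C g\<close> ratio pos by (auto simp: \<phi>_def \<psi>_def C_def divide_le_eq mult.commute)
    show "0 < \<phi> n g z" "\<phi> n g z * \<psi> n g z = 1"
      using pos by (auto simp: \<phi>_def \<psi>_def real_sqrt_divide)
  qed
  define u where "u n g h = measure_pmf.expectation (green (t n)) (\<lambda>x. \<phi> n g (h \<otimes> x))" for n g h
  define v where "v n g h = measure_pmf.expectation (green (t n)) (\<lambda>x. \<psi> n g (h \<otimes> x))" for n g h
  have gcarr: "x \<in> carrier G" if "x \<in> set_pmf (green s)" for x s using that set_green by auto
  have u_int: "integrable (measure_pmf (green (t n))) (\<lambda>x. \<phi> n g (h \<otimes> x))"
      "integrable (measure_pmf (green (t n))) (\<lambda>x. \<psi> n g (h \<otimes> x))"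
    if "g \<in> set_pmf \<mu>" "h \<in> carrier G" for n g h
    using that gcarr by (intro pmf_integrable_bounded[where C = "C g"] C(2,3); simp)+
  have uv_bound: "\<bar>u n g h\<bar> \<le> C g" "\<bar>v n g h\<bar> \<le> C g" if "g \<in> set_pmf \<mu>" "h \<in> carrier G" for n g h
  proof -
    have "\<bar>u n g h\<bar> \<le> measure_pmf.expectation (green (t n)) (\<lambda>x. \<bar>\<phi> n g (h \<otimes> x)\<bar>)"
      unfolding u_def by (rule integral_abs_bound)
    also have "\<dots> \<le> measure_pmf.expectation (green (t n)) (\<lambda>x. C g)"
      using u_int[OF that] that gcarr C(2) by (intro pmf_expectation_mono) auto
    finally show "\<bar>u n g h\<bar> \<le> C g" by simp
    have "\<bar>v n g h\<bar> \<le> measure_pmf.expectation (green (t n)) (\<lambda>x. \<bar>\<psi> n g (h \<otimes> x)\<bar>)"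
      unfolding v_def by (rule integral_abs_bound)
    also have "\<dots> \<le> measure_pmf.expectation (green (t n)) (\<lambda>x. C g)"
      using u_int[OF that] that gcarr C(3) by (intro pmf_expectation_mono) auto
    finally show "\<bar>v n g h\<bar> \<le> C g" by simp
  qed
  \<comment> \<open>Dividing by \<open>C g\<close> makes the family uniformly bounded, so that one diagonal sequence suffices.\<close>
  obtain k where k: "strict_mono (k :: nat \<Rightarrow> nat)"
    and k_lim: "\<And>w. w \<in> set_pmf \<mu> \<times> carrier G \<Longrightarrow>
      \<exists>l. (\<lambda>n. (u (k n) (fst w) (snd w) / C (fst w), v (k n) (fst w) (snd w) / C (fst w))) \<longlonglongrightarrow> l"
  proof (rule function_convergent_subsequence[of "set_pmf \<mu> \<times> carrier G"
      "\<lambda>n w. (u n (fst w) (snd w) / C (fst w), v n (fst w) (snd w) / C (fst w))" 2])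
    show "countable (set_pmf \<mu> \<times> carrier G)" using countable_carrier by simp
    fix n w assume w: "w \<in> set_pmf \<mu> \<times> carrier G"
    then have w': "fst w \<in> set_pmf \<mu>" "snd w \<in> carrier G" by auto
    have "\<bar>u n (fst w) (snd w) / C (fst w)\<bar> \<le> 1" "\<bar>v n (fst w) (snd w) / C (fst w)\<bar> \<le> 1"
      using uv_bound[OF w'] C(1)[OF w'] by (auto simp: abs_div divide_le_eq)
    then show "norm (u n (fst w) (snd w) / C (fst w), v n (fst w) (snd w) / C (fst w)) \<le> 2"
      using norm_Pair_le[of "u n (fst w) (snd w) / C (fst w)" "v n (fst w) (snd w) / C (fst w)"]
      by (simp only: real_norm_def)
  qed blast
  have "\<exists>U V. \<forall>g\<in>set_pmf \<mu>. \<forall>h\<in>carrier G. (\<lambda>n. u (k n) g h) \<longlonglongrightarrow> U g h \<and> (\<lambda>n. v (k n) g h) \<longlonglongrightarrow> V g h"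
  proof -
    have "\<exists>a b. (\<lambda>n. u (k n) g h) \<longlonglongrightarrow> a \<and> (\<lambda>n. v (k n) g h) \<longlonglongrightarrow> b"
      if g: "g \<in> set_pmf \<mu>" and h: "h \<in> carrier G" for g h
    proof -
      obtain l where l: "(\<lambda>n. (u (k n) g h / C g, v (k n) g h / C g)) \<longlonglongrightarrow> l"
        using k_lim[of "(g, h)"] g h by auto
      have "C g \<noteq> 0" using C(1)[OF g h] by simp
      then have "(\<lambda>n. u (k n) g h) \<longlonglongrightarrow> C g * fst l" "(\<lambda>n. v (k n) g h) \<longlonglongrightarrow> C g * snd l"
        using tendsto_mult_left[OF tendsto_fst[OF l], of "C g"] tendsto_mult_left[OF tendsto_snd[OF l], of "C g"]
        by simp_all
      then show ?thesis by blast
    qed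
    then show ?thesis by metis
  qed
  then obtain U V where UV: "\<And>g h. g \<in> set_pmf \<mu> \<Longrightarrow> h \<in> carrier G \<Longrightarrow> (\<lambda>n. u (k n) g h) \<longlonglongrightarrow> U g h"
    "\<And>g h. g \<in> set_pmf \<mu> \<Longrightarrow> h \<in> carrier G \<Longrightarrow> (\<lambda>n. v (k n) g h) \<longlonglongrightarrow> V g h" by blast
  have tk_lim: "(\<lambda>n. t (k n)) \<longlonglongrightarrow> 0"
    using LIMSEQ_subseq_LIMSEQ[OF t_lim k] by (simp add: comp_def)
  have le: "2 * affinity g \<le> U g (inv g) + V g \<one>" if g: "g \<in> set_pmf \<mu>" for g
  proof -
    have harm: "U g \<in> bounded_harmonic G \<mu>" "V g \<in> bounded_harmonic G \<mu>"
      using green_limit_harmonic[OF t(1,2) tk_lim C(2)[OF g] UV(1)[OF g, unfolded u_def]]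
        green_limit_harmonic[OF t(1,2) tk_lim C(3)[OF g] UV(2)[OF g, unfolded v_def]] by auto
    then obtain f f' where f: "f \<in> Linfty B" "f' \<in> Linfty B"
      "\<And>h. h \<in> carrier G \<Longrightarrow> U g h = P f h" "\<And>h. h \<in> carrier G \<Longrightarrow> V g h = P f' h"
      using boundary unfolding poisson_boundary_def by metis
    have "2 * affinity g \<le> P f (inv g) + P f' \<one>"
    proof (rule affinity_le_transforms[OF carr[OF g] f(1,2)])
      fix a :: real and h assume a: "0 < a" and h: "h \<in> carrier G"
      have "2 * a \<le> a\<^sup>2 * u n g h + v n g h" for n
      proof -
        have "2 * a \<le> a\<^sup>2 * \<phi> n g z + \<psi> n g z" if z: "z \<in> carrier G" for z
        proof -
          have p: "0 < \<phi> n g z" by (rule C(4)[OF g z])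
          have "2 * a * \<phi> n g z \<le> (a * \<phi> n g z)\<^sup>2 + \<phi> n g z * \<psi> n g z"
            using sum_squares_bound[of "a * \<phi> n g z" 1] C(5)[OF g z, of n] by simp
          also have "\<dots> = (a\<^sup>2 * \<phi> n g z + \<psi> n g z) * \<phi> n g z"
            by (simp add: algebra_simps power2_eq_square)
          finally show ?thesis using p by (rule mult_right_le_imp_le)
        qed
        then have "measure_pmf.expectation (green (t n)) (\<lambda>x. 2 * a) \<le>
            measure_pmf.expectation (green (t n)) (\<lambda>x. a\<^sup>2 * \<phi> n g (h \<otimes> x) + \<psi> n g (h \<otimes> x))"
          using u_int[OF g h] gcarr h by (intro pmf_expectation_mono) auto
        then show ?thesis using u_int[OF g h] by (simp add: u_def v_def)
      qed
      moreover have "(\<lambda>n. a\<^sup>2 * u (k n) g h + v (k n) g h) \<longlonglongrightarrow> a\<^sup>2 * U g h + V g h"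
        by (intro tendsto_intros UV g h)
      ultimately have "2 * a \<le> a\<^sup>2 * U g h + V g h" by (intro LIMSEQ_le_const) auto
      then show "2 * a \<le> a\<^sup>2 * P f h + P f' h" by (simp only: f(3,4)[OF h])
    qed
    then show ?thesis using f(3,4) carr[OF g] by simp
  qed
  \<comment> \<open>By symmetry of \<open>\<mu>\<close> the average over \<open>g\<close> and its inverse has the same mean as the affinity itself.\<close>
  define w where "w n g = (pmf_affinity (green (t (k n))) (inv g) + pmf_affinity (green (t (k n))) g) / 2" for n g
  define W where "W g = (U g (inv g) + V g \<one>) / 2" for g
  have inv_supp: "inv g \<in> set_pmf \<mu>" if "g \<in> set_pmf \<mu>" for g
    using that pmf_walk_inv[OF carr[OF that], of 1] unfolding walk_1 by (simp add: set_pmf_iff)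
  have w_eq: "w n g = (u (k n) g (inv g) + v (k n) g \<one>) / 2" if g: "g \<in> set_pmf \<mu>" for n g
  proof -
    have "u (k n) g (inv g) = pmf_affinity (green (t (k n))) (inv g)"
      unfolding u_def pmf_affinity_def
    proof (rule pmf_expectation_cong)
      fix x assume x: "x \<in> set_pmf (green (t (k n)))"
      then have "inv g \<otimes> x \<in> set_pmf (green (t (k n)))"
        using set_green_shift[OF t(1,2) inv_supp[OF g]] gcarr by blast
      moreover have "g \<otimes> (inv g \<otimes> x) = x" using carr[OF g] gcarr[OF x] by (simp add: m_assoc[symmetric])
      ultimately show "\<phi> (k n) g (inv g \<otimes> x) =
          sqrt (?p (k n) (inv g \<otimes> x) / ?p (k n) x)" by (simp add: \<phi>_def)
    qed
    moreover have "v (k n) g \<one> = pmf_affinity (green (t (k n))) g"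
      unfolding v_def pmf_affinity_def using gcarr by (intro pmf_expectation_cong) (simp add: \<psi>_def)
    ultimately show ?thesis by (simp add: w_def)
  qed
  have aff1: "0 \<le> pmf_affinity (green (t n)) g" "pmf_affinity (green (t n)) g \<le> 1" if "g \<in> set_pmf \<mu>" for n g
    using green_hellinger(2,3)[OF t(1,2) that] by auto
  have w_bound: "\<bar>w n g\<bar> \<le> 1" if "g \<in> set_pmf \<mu>" for n g
    using aff1[OF that, of "k n"] aff1[OF inv_supp[OF that], of "k n"] by (simp add: w_def)
  have w_lim: "(\<lambda>n. w n g) \<longlonglongrightarrow> W g" if g: "g \<in> set_pmf \<mu>" for g
    unfolding w_eq[OF g] W_def using carr[OF g] by (intro tendsto_intros UV g) auto
  have W_bound: "\<bar>W g\<bar> \<le> 1" if "g \<in> set_pmf \<mu>" for g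
    by (rule LIMSEQ_le_const2[OF tendsto_rabs[OF w_lim[OF that]]]) (use w_bound that in auto)
  have "(\<lambda>n. measure_pmf.expectation \<mu> (w n)) \<longlonglongrightarrow> measure_pmf.expectation \<mu> W"
    by (rule pmf_dominated_convergence[OF w_lim w_bound])
  moreover have "measure_pmf.expectation \<mu> (w n) \<le> r" for n
  proof -
    let ?a = "pmf_affinity (green (t (k n)))"
    have "\<bar>?a g\<bar> \<le> 1" if "g \<in> set_pmf \<mu>" for g using aff1[OF that, of "k n"] by simp
    then have a_int: "integrable (measure_pmf \<mu>) ?a" by (rule pmf_integrable_bounded)
    then have "measure_pmf.expectation \<mu> (w n) =
        (measure_pmf.expectation \<mu> (\<lambda>g. ?a (inv g)) + measure_pmf.expectation \<mu> ?a) / 2"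
      using expectation_inv(2)[of ?a] by (simp add: w_def[abs_def])
    also have "\<dots> = measure_pmf.expectation \<mu> ?a" using expectation_inv(1)[of ?a] by simp
    also have "\<dots> \<le> r" by (rule r[OF t(1,2)])
    finally show ?thesis .
  qed
  ultimately have "measure_pmf.expectation \<mu> W \<le> r" by (intro LIMSEQ_le_const2) auto
  moreover have "measure_pmf.expectation \<mu> affinity \<le> measure_pmf.expectation \<mu> W"
  proof (rule pmf_expectation_mono[OF int])
    show "integrable (measure_pmf \<mu>) W" using W_bound by (rule pmf_integrable_bounded)
    show "affinity g \<le> W g" if "g \<in> set_pmf \<mu>" for g using le[OF that] by (simp add: W_def)
  qed
  ultimately show "measure_pmf.expectation \<mu> affinity \<le> r" by simp
qed

section \<open>The equality case\<close>

text \<open>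
  The excess is nonnegative, and its mean is at most \<open>h\<close> minus the value \<open>2 y tanh y\<close> prescribed for
  \<open>h\<close>. So it vanishes almost everywhere, for every \<open>g\<close> in the support of \<open>\<mu>\<close>.
\<close>

lemma RN_deriv_two_values:
  assumes fin: "finite_entropy G \<mu>" and y: "0 \<le> y"
    and entropy: "asymptotic_entropy G \<mu> = 2 * y * tanh y"
    and aff: "integrable (measure_pmf \<mu>) affinity" "measure_pmf.expectation \<mu> affinity \<le> 1 / cosh y"
    and g: "g \<in> set_pmf \<mu>"
  shows "AE \<xi> in B. D g \<xi> \<in> {exp (2 * y), exp (- (2 * y))}"
proof -
  have carr: "g \<in> carrier G" if "g \<in> set_pmf \<mu>" for g using that supp by auto
  define J where "J g = (\<integral>\<xi>. entropy_excess y (D g \<xi>) \<partial>B)" for g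
  have J: "integrable B (\<lambda>\<xi>. entropy_excess y (D g \<xi>))"
    "J g = (divergence g + divergence (inv g)) / 2 - 2 * (1 + xcoth y) + 2 * affinity_weight y * affinity g"
    if g: "g \<in> carrier G" for g
  proof -
    have eq: "entropy_excess y (D g \<xi>) = (D g \<xi> * ln (D g \<xi>) - ln (D g \<xi>)) / 2
        - (1 + xcoth y) * (1 + D g \<xi>) + 2 * affinity_weight y * sqrt (D g \<xi>)" for \<xi>
      by (simp add: entropy_excess_def algebra_simps)
    show "integrable B (\<lambda>\<xi>. entropy_excess y (D g \<xi>))" unfolding eq using g by simp
    show "J g = (divergence g + divergence (inv g)) / 2 - 2 * (1 + xcoth y) + 2 * affinity_weight y * affinity g"
    proof -
      have "J g = (\<integral>\<xi>. (D g \<xi> * ln (D g \<xi>) - ln (D g \<xi>)) / 2 \<partial>B)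
          - (\<integral>\<xi>. (1 + xcoth y) * (1 + D g \<xi>) \<partial>B) + (\<integral>\<xi>. 2 * affinity_weight y * sqrt (D g \<xi>) \<partial>B)"
        unfolding J_def eq using g
        by (subst Bochner_Integration.integral_add, simp, simp, subst Bochner_Integration.integral_diff, simp_all)
      moreover have "(\<integral>\<xi>. (D g \<xi> * ln (D g \<xi>) - ln (D g \<xi>)) / 2 \<partial>B) = (divergence g + divergence (inv g)) / 2"
      proof -
        have "(\<integral>\<xi>. (D g \<xi> * ln (D g \<xi>) - ln (D g \<xi>)) / 2 \<partial>B) =
            ((\<integral>\<xi>. D g \<xi> * ln (D g \<xi>) \<partial>B) - (\<integral>\<xi>. ln (D g \<xi>) \<partial>B)) / 2"
          by (simp add: integrable_D_ln_D[OF g] integrable_ln_D[OF g])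
        also have "(\<integral>\<xi>. ln (D g \<xi>) \<partial>B) = - divergence g" by (simp add: divergence_def)
        finally show ?thesis by (simp add: divergence_inv[OF g])
      qed
      moreover have "(\<integral>\<xi>. (1 + xcoth y) * (1 + D g \<xi>) \<partial>B) = 2 * (1 + xcoth y)"
        using g by (simp add: integral_D_eq_1 prob_space)
      moreover have "(\<integral>\<xi>. 2 * affinity_weight y * sqrt (D g \<xi>) \<partial>B) = 2 * affinity_weight y * affinity g"
        by (simp add: affinity_def)
      ultimately show ?thesis by (simp only:)
    qed
  qed
  have J_nonneg: "0 \<le> J g" if g: "g \<in> carrier G" for g
    unfolding J_def using D_pos[OF g]
    by (intro integral_nonneg_AE) (auto elim: AE_mp intro: entropy_excess_nonneg[OF y])
  note div_int = boundary_entropy_le(1)[OF fin]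
  have div_int': "integrable (measure_pmf \<mu>) (\<lambda>g. divergence (inv g))"
    using div_int expectation_inv(2)[of divergence] by simp
  have J_int: "integrable (measure_pmf \<mu>) J"
    using div_int div_int' aff(1) by (subst pmf_integrable_cong[OF J(2)[OF carr]]) auto
  have "measure_pmf.expectation \<mu> J = (boundary_entropy + boundary_entropy) / 2 - 2 * (1 + xcoth y)
      + 2 * affinity_weight y * measure_pmf.expectation \<mu> affinity"
    using div_int div_int' aff(1) expectation_inv(1)[of divergence]
    by (subst pmf_expectation_cong[OF J(2)[OF carr]]) (auto simp: boundary_entropy_def)
  also have "\<dots> \<le> 2 * y * tanh y - 2 * (1 + xcoth y) + 2 * affinity_weight y * (1 / cosh y)"
    using boundary_entropy_le(2)[OF fin] affinity_weight_nonneg[OF y] aff(2) entropy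
    by (intro add_mono diff_mono mult_left_mono) auto
  also have "\<dots> = 0" using tanh_affinity_weight[of y] by simp
  finally have "measure_pmf.expectation \<mu> J \<le> 0" .
  moreover have "0 \<le> measure_pmf.expectation \<mu> J"
    using J_nonneg carr by (intro integral_nonneg_AE) (auto simp: AE_measure_pmf_iff)
  ultimately have "measure_pmf.expectation \<mu> J = 0" by simp
  then have "AE g in measure_pmf \<mu>. J g = 0"
    using J_int J_nonneg carr by (subst (asm) integral_nonneg_eq_0_iff_AE) (auto simp: AE_measure_pmf_iff)
  then have "J g = 0" using g by (simp add: AE_measure_pmf_iff)
  then have "AE \<xi> in B. entropy_excess y (D g \<xi>) = 0"
    unfolding J_def using J(1)[OF carr[OF g]] D_pos[OF carr[OF g]]
    by (subst (asm) integral_nonneg_eq_0_iff_AE) (auto elim: AE_mp intro: entropy_excess_nonneg[OF y])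
  then show ?thesis
    using D_pos[OF carr[OF g]] by eventually_elim (rule entropy_excess_eq_0D[OF y])
qed

end

text \<open>
  The exceptional set is covered by a countable union of null slices over the support, together with
  the null set of pairs outside the support. Such a covering is measurable even when the set of
  exceptional pairs is not.
\<close>

lemma AE_measure_pmf_pair:
  assumes "sigma_finite_measure M" and Q: "\<And>x. x \<in> set_pmf p \<Longrightarrow> AE y in M. Q x y"
  shows "AE (x, y) in measure_pmf p \<Otimes>\<^sub>M M. Q x y"
proof -
  interpret M: sigma_finite_measure M by fact
  have "\<exists>N. N \<in> null_sets M \<and> {y \<in> space M. \<not> Q x y} \<subseteq> N" if "x \<in> set_pmf p" for x
    using Q[OF that] by (auto simp: eventually_ae_filter)
  then obtain N where N: "\<And>x. x \<in> set_pmf p \<Longrightarrow> N x \<in> null_sets M"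
    "\<And>x. x \<in> set_pmf p \<Longrightarrow> {y \<in> space M. \<not> Q x y} \<subseteq> N x" by metis
  define Z where "Z = (UNIV - set_pmf p) \<times> space M \<union> (\<Union>x\<in>set_pmf p. {x} \<times> N x)"
  have "(UNIV - set_pmf p) \<times> space M \<in> null_sets (measure_pmf p \<Otimes>\<^sub>M M)"
  proof (rule null_setsI)
    have "emeasure (measure_pmf p) (UNIV - set_pmf p) = 0"
      by (simp add: measure_pmf.emeasure_eq_measure measure_pmf_zero_iff)
    then show "emeasure (measure_pmf p \<Otimes>\<^sub>M M) ((UNIV - set_pmf p) \<times> space M) = 0"
      by (simp add: M.emeasure_pair_measure_Times)
  qed auto
  moreover have "(\<Union>x\<in>set_pmf p. {x} \<times> N x) \<in> null_sets (measure_pmf p \<Otimes>\<^sub>M M)"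
  proof (rule null_sets_UN')
    fix x assume "x \<in> set_pmf p"
    then have n: "N x \<in> sets M" "emeasure M (N x) = 0" using N(1) by auto
    then show "{x} \<times> N x \<in> null_sets (measure_pmf p \<Otimes>\<^sub>M M)"
      by (intro null_setsI) (auto simp: M.emeasure_pair_measure_Times)
  qed simp
  ultimately have "Z \<in> null_sets (measure_pmf p \<Otimes>\<^sub>M M)"
    unfolding Z_def by (rule null_sets.Un)
  moreover have "{w \<in> space (measure_pmf p \<Otimes>\<^sub>M M). \<not> (case w of (x, y) \<Rightarrow> Q x y)} \<subseteq> Z"
    using N(2) by (auto simp: Z_def space_pair_measure)
  ultimately show ?thesis by (rule AE_I')
qed

theorem proposition2p4:
  fixes G :: "('a, 'm) monoid_scheme"
    and d :: "'a \<Rightarrow> 'a \<Rightarrow> real"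
    and \<mu> :: "'a pmf"
    and B :: "'b measure"
    and T :: "'a \<Rightarrow> 'b \<Rightarrow> 'b"
  assumes "group G" and "countable (carrier G)"
    and "proper_distance G d" and "left_invariant_distance G d"
    and "set_pmf \<mu> \<subseteq> carrier G"
    and "\<mu> \<noteq> return_pmf \<one>\<^bsub>G\<^esub>"
    and "symmetric_pmf G \<mu>"
    and "finite_second_moment G d \<mu>"
    and "finite_entropy G \<mu>"
    and "generate G (set_pmf \<mu>) = carrier G"
    and "2 * sqrt (1 - (spectral_radius G \<mu>)\<^sup>2) * artanh (sqrt (1 - (spectral_radius G \<mu>)\<^sup>2))
           = asymptotic_entropy G \<mu>
         \<or> 2 * (drift G d \<mu> / M2 G d \<mu>) * artanh (drift G d \<mu> / M2 G d \<mu>)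
           = asymptotic_entropy G \<mu>"
    and "poisson_boundary G \<mu> B T"
  shows "\<exists>\<alpha>::real. AE (\<gamma>, \<xi>) in measure_pmf \<mu> \<Otimes>\<^sub>M B.
           RN_deriv B (distr B B (T (inv\<^bsub>G\<^esub> \<gamma>))) \<xi> \<in> {ennreal (exp \<alpha>), ennreal (exp (- \<alpha>))}"
proof -
  interpret metric_walk G \<mu> d
    using assms by (intro_locales)
      (simp_all add: group_def symmetric_walk_axioms_def metric_walk_axioms_def proper_distance_def)
  interpret boundary_walk G \<mu> B T
    using assms by unfold_locales simp_all
  let ?A = "measure_pmf.expectation \<mu> affinity"
  have carr: "g \<in> carrier G" if "g \<in> set_pmf \<mu>" for g using that supp by auto
  have A_int: "integrable (measure_pmf \<mu>) affinity"
    and A_spectral: "?A \<le> \<rho>"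
    and A_drift: "?A \<le> sqrt (1 - (drift G d \<mu> / M2 G d \<mu>)\<^sup>2)"
    using affinity_le_of_green[of \<rho>] pmf_affinity_spectral(3)[OF set_green]
      affinity_le_of_green[of "sqrt (1 - (drift G d \<mu> / M2 G d \<mu>)\<^sup>2)"] affinity_le_drift
    by auto
  \<comment> \<open>Positivity excludes \<open>q = 1\<close> below, where \<open>artanh\<close> has a pole.\<close>
  have A_pos: "0 < ?A"
  proof -
    have AE: "AE g in measure_pmf \<mu>. 0 \<le> affinity g"
      using affinity_bounds(1) carr by (auto simp: AE_measure_pmf_iff intro: less_imp_le)
    have "?A \<noteq> 0"
    proof
      assume "?A = 0"
      then have "AE g in measure_pmf \<mu>. affinity g = 0"
        using integral_nonneg_eq_0_iff_AE[OF A_int AE] by simp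
      then show False
        using affinity_bounds(1)[OF carr] set_pmf_not_empty[of \<mu>] by (force simp: AE_measure_pmf_iff)
    qed
    then show ?thesis using integral_nonneg_AE[OF AE] by simp
  qed
  \<comment> \<open>Both hypotheses have the form \<open>h = 2 q artanh q\<close> with \<open>?A \<le> sqrt (1 - q\<^sup>2)\<close>.\<close>
  obtain q where q: "0 \<le> q" "q < 1" "?A \<le> sqrt (1 - q\<^sup>2)" "asymptotic_entropy G \<mu> = 2 * q * artanh q"
  proof (cases "2 * sqrt (1 - \<rho>\<^sup>2) * artanh (sqrt (1 - \<rho>\<^sup>2)) = asymptotic_entropy G \<mu>")
    case True
    have "0 < \<rho>" using A_pos A_spectral by simp
    then have "\<rho>\<^sup>2 \<le> 1" using spectral_radius_limsup(3) by (simp add: power_le_one)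
    then show thesis
      using True \<open>0 < \<rho>\<close> A_spectral by (intro that[of "sqrt (1 - \<rho>\<^sup>2)"]) auto
  next
    case False
    let ?q = "drift G d \<mu> / M2 G d \<mu>"
    have "0 \<le> ?q" using drift_bounds(2) by (simp add: M2_eq)
    moreover have "0 < sqrt (1 - ?q\<^sup>2)" using A_pos A_drift by linarith
    then have "?q\<^sup>2 < 1\<^sup>2" by simp
    then have "?q < 1" by (rule power_less_imp_less_base) simp
    ultimately show thesis
      using False assms(11) A_drift by (intro that[of ?q]) auto
  qed
  define y where "y = artanh q"
  have tanh: "tanh y = q" 
  proof -
    have "exp (- 2 * y) = (1 - q) / (1 + q)"
      using q by (simp add: y_def artanh_def exp_minus field_simps)
    then have "tanh y = (1 - (1 - q) / (1 + q)) / (1 + (1 - q) / (1 + q))"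
      by (simp only: tanh_real_altdef)
    also have "\<dots> = q" using q by (simp add: field_simps)
    finally show ?thesis .
  qed
  then have y: "0 \<le> y" using q(1) by (metis tanh_real_nonneg_iff)
  have "1 - q\<^sup>2 = ((cosh y)\<^sup>2 - (sinh y)\<^sup>2) / (cosh y)\<^sup>2"
    using cosh_real_pos[of y]
    unfolding tanh[symmetric] tanh_def by (simp add: power_divide diff_divide_distrib)
  then have "1 - q\<^sup>2 = (1 / cosh y)\<^sup>2"
    by (simp add: cosh_square_eq power_divide)
  then have A_cosh: "?A \<le> 1 / cosh y" using q(3) cosh_real_pos[of y] by simp
  have h: "asymptotic_entropy G \<mu> = 2 * y * tanh y" using q(4) unfolding tanh by (simp add: y_def)
  have "AE \<xi> in B. RN_deriv B (distr B B (T (inv\<^bsub>G\<^esub> \<gamma>))) \<xi> \<in> {ennreal (exp (2 * y)), ennreal (exp (- (2 * y)))}"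
    if \<gamma>: "\<gamma> \<in> set_pmf \<mu>" for \<gamma>
    using RN_deriv_two_values[OF assms(9) y h A_int A_cosh \<gamma>] RN_deriv_eq_D[OF carr[OF \<gamma>]]
    by eventually_elim auto
  then show ?thesis
    by (intro exI[of _ "2 * y"] AE_measure_pmf_pair sigma_finite_measure_axioms)
qed

end
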